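(* Let $n\ge 1$, $s\in(0,1]$ and $p\in(n/(n+s),\infty)$. Let $\mathcal A=\mathcal A^\ell_{0,m}$ with $\ell\in\mathbb Z_+$ and $m\in(n+1,\infty)$. Then $\dot M^{s,p}(\mathbb R^n)=\mathcal A\dot F^s_{p,\infty}(\mathbb R^n)$ with equivalent norms.
   Context: $\mathbb Z_+=\{0,1,2,\dots\}$. Hajłasz–Sobolev space: for $p\in(0,\infty)$ and $s\in(0,1]$, $\dot M^{s,p}(\mathbb R^n)$ is the set of all measurable $f\in L^p_{\rm loc}(\mathbb R^n)$ for which there exist a nonnegative $g\in L^p(\mathbb R^n)$ and a set $E$ of measure zero such that $|f(x)-f(y)|\le |x-y|^s[g(x)+g(y)]$ for all $x,y\in\mathbb R^n\setminus E$; $\|f\|_{\dot M^{s,p}(\mathbb R^n)}$ is the infimum of $\|g\|_{L^p(\mathbb R^n)}$ over all such $g$. Test functions: $\mathcal S(\mathbb R^n)$ is the Schwartz space and $\mathcal S'(\mathbb R^n)$ its dual. For $k\in\mathbb Z_+$ and $m\in(0,\infty)$ put $\|\varphi\|_{\mathcal S_{k,m}(\mathbb R^n)}=\sup_{|\alpha|\le k}\sup_{x\in\mathbb R^n}(1+|x|)^m|\partial^\alpha\varphi(x)|$. For $N\in\mathbb Z_+$, $\mathcal S_N(\mathbb R^n)$ is the set of $f\in\mathcal S(\mathbb R^n)$ with $\int_{\mathbb R^n} x^\alpha f(x)\,dx=0$ for all $|\alpha|\le N$. For $\ell,N\in\mathbb Z_+$ and $m\in(0,\infty)$, $\mathcal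 A^\ell_{N,m}=\{\phi\in\mathcal S_N(\mathbb R^n):\|\phi\|_{\mathcal S_{N+\ell+1,m}(\mathbb R^n)}\le 1\}$. For $t>0$, $\phi_t(x)=t^{-n}\phi(x/t)$. Grand Triebel–Lizorkin space: $\mathcal A\dot F^s_{p,\infty}(\mathbb R^n)$ is the set of all $f\in\mathcal S'(\mathbb R^n)$ with $\|f\|_{\mathcal A\dot F^s_{p,\infty}(\mathbb R^n)}=\big\|\sup_{k\in\mathbb Z}2^{ks}\sup_{\phi\in\mathcal A}|\phi_{2^{-k}}*f|\big\|_{L^p(\mathbb R^n)}<\infty$. Both spaces are considered modulo constants. The equality means: every $f\in\dot M^{s,p}(\mathbb R^n)$ is locally integrable and defines an element of $\mathcal S'(\mathbb R^n)$ lying in $\mathcal A\dot F^s_{p,\infty}(\mathbb R^n)$; every $f\in\mathcal A\dot F^s_{p,\infty}(\mathbb R^n)$ coincides (in $\mathcal S'(\mathbb R^n)$, modulo constants) with a locally integrable function lying in $\dot M^{s,p}(\mathbb R^n)$; and the two (quasi-)norms are comparable with constants independent of $f$. *)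

theory Defs
  imports "HOL-Analysis.Analysis"
begin

section \<open>Lebesgue quasi-norms\<close>

definition epowr :: "ennreal \<Rightarrow> real \<Rightarrow> ennreal" where
  "epowr x a = (if x = \<infinity> then \<infinity> else ennreal (enn2real x powr a))"
  \<comment> \<open>only used with a positive exponent\<close>

definition Lp_norm :: "real \<Rightarrow> (real^'n \<Rightarrow> ennreal) \<Rightarrow> ennreal" where
  "Lp_norm p F = epowr (\<integral>\<^sup>+x. epowr (F x) p \<partial>lebesgue) (1 / p)"

definition Lp_loc :: "real \<Rightarrow> (real^'n \<Rightarrow> complex) set" where
  "Lp_loc p = {f \<in> borel_measurable lebesgue. \<forall>K. compact K \<longrightarrow>
      Lp_norm p (\<lambda>x. ennreal (norm (f x)) * indicator K x) < \<infinity>}"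

definition locally_integrable :: "(real^'n \<Rightarrow> complex) \<Rightarrow> bool" where
  "locally_integrable f \<longleftrightarrow> (\<forall>K. compact K \<longrightarrow> set_integrable lebesgue K f)"

section \<open>Hajlasz--Sobolev spaces\<close>

definition hajlasz_gradients ::
    "real \<Rightarrow> real \<Rightarrow> (real^'n \<Rightarrow> complex) \<Rightarrow> (real^'n \<Rightarrow> real) set" where
  "hajlasz_gradients s p f = {g \<in> borel_measurable lebesgue.
      (\<forall>x. 0 \<le> g x) \<and> Lp_norm p (\<lambda>x. ennreal (g x)) < \<infinity> \<and>
      (\<exists>E \<in> null_sets lebesgue. \<forall>x\<in>-E. \<forall>y\<in>-E.
          norm (f x - f y) \<le> norm (x - y) powr s * (g x + g y))}"

definition hajlasz_space :: "real \<Rightarrow> real \<Rightarrow> (real^'n \<Rightarrow> complex) set" where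
  "hajlasz_space s p = {f \<in> Lp_loc p. hajlasz_gradients s p f \<noteq> {}}"

definition hajlasz_norm :: "real \<Rightarrow> real \<Rightarrow> (real^'n \<Rightarrow> complex) \<Rightarrow> ennreal" where
  "hajlasz_norm s p f = (INF g\<in>hajlasz_gradients s p f. Lp_norm p (\<lambda>x. ennreal (g x)))"

section \<open>Schwartz functions and tempered distributions\<close>

definition partial :: "'n \<Rightarrow> (real^'n \<Rightarrow> complex) \<Rightarrow> real^'n \<Rightarrow> complex" where
  "partial i f x = vector_derivative (\<lambda>t. f (x + t *\<^sub>R axis i 1)) (at 0)"

definition smooth :: "(real^'n \<Rightarrow> complex) \<Rightarrow> bool" where
  "smooth f \<longleftrightarrow> (\<forall>is x. foldr partial is f differentiable (at x))"

text \<open>A multi-index is a function on the finite index type. The partial derivatives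
  of a smooth function commute, so the enumeration chosen below is immaterial.\<close>

definition coord_list :: "'n::finite list" where
  "coord_list = (SOME xs. distinct xs \<and> set xs = UNIV)"

definition multi_partial :: "('n::finite \<Rightarrow> nat) \<Rightarrow> (real^'n \<Rightarrow> complex) \<Rightarrow> real^'n \<Rightarrow> complex" where
  "multi_partial \<alpha> f = foldr (\<lambda>i. partial i ^^ \<alpha> i) coord_list f"

definition multi_order :: "('n::finite \<Rightarrow> nat) \<Rightarrow> nat" where
  "multi_order \<alpha> = (\<Sum>i\<in>UNIV. \<alpha> i)"

definition monomial :: "('n::finite \<Rightarrow> nat) \<Rightarrow> real^'n \<Rightarrow> real" where
  "monomial \<alpha> x = (\<Prod>i\<in>UNIV. (x $ i) ^ \<alpha> i)"

definition schwartz_norm :: "nat \<Rightarrow> real \<Rightarrow> (real^'n \<Rightarrow> complex) \<Rightarrow> ennreal" where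
  "schwartz_norm k m \<phi> =
     (SUP \<alpha>\<in>{\<alpha>. multi_order \<alpha> \<le> k}. SUP x. ennreal ((1 + norm x) powr m * norm (multi_partial \<alpha> \<phi> x)))"

definition schwartz :: "(real^'n \<Rightarrow> complex) set" where
  "schwartz = {\<phi>. smooth \<phi> \<and> (\<forall>k. \<forall>m>0. schwartz_norm k m \<phi> < \<infinity>)}"

text \<open>Continuous complex-linear functionals on the Schwartz space; the norms are increasing in
  both indices, so continuity is boundedness by a single one of them. Functionals are total
  functions whose values outside the Schwartz space are irrelevant.\<close>

definition tempered :: "((real^'n \<Rightarrow> complex) \<Rightarrow> complex) \<Rightarrow> bool" where
  "tempered u \<longleftrightarrow>
     (\<forall>\<phi>\<in>schwartz. \<forall>\<psi>\<in>schwartz. u (\<lambda>x. \<phi> x + \<psi> x) = u \<phi> + u \<psi>) \<and>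
     (\<forall>c. \<forall>\<phi>\<in>schwartz. u (\<lambda>x. c * \<phi> x) = c * u \<phi>) \<and>
     (\<exists>C k m. 0 < m \<and> (\<forall>\<phi>\<in>schwartz. ennreal (norm (u \<phi>)) \<le> ennreal C * schwartz_norm k m \<phi>))"

definition dist_of :: "(real^'n \<Rightarrow> complex) \<Rightarrow> (real^'n \<Rightarrow> complex) \<Rightarrow> complex" where
  "dist_of f \<phi> = (LINT x|lebesgue. f x * \<phi> x)"

text \<open>The integrability clause is needed because the Bochner integral of a non-integrable
  function is 0.\<close>

definition defines_tempered :: "(real^'n \<Rightarrow> complex) \<Rightarrow> bool" where
  "defines_tempered f \<longleftrightarrow>
     (\<forall>\<phi>\<in>schwartz. integrable lebesgue (\<lambda>x. f x * \<phi> x)) \<and> tempered (dist_of f)"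

definition coincides_mod_const ::
    "((real^'n \<Rightarrow> complex) \<Rightarrow> complex) \<Rightarrow> (real^'n \<Rightarrow> complex) \<Rightarrow> bool" where
  "coincides_mod_const u f \<longleftrightarrow> locally_integrable f \<and> defines_tempered f \<and>
     (\<exists>c. \<forall>\<phi>\<in>schwartz. u \<phi> = dist_of f \<phi> + dist_of (\<lambda>_. c) \<phi>)"

section \<open>Grand Triebel--Lizorkin spaces\<close>

definition schwartz_vanishing :: "nat \<Rightarrow> (real^'n \<Rightarrow> complex) set" where
  "schwartz_vanishing N = {\<phi> \<in> schwartz. \<forall>\<alpha>. multi_order \<alpha> \<le> N \<longrightarrow>
      (LINT x|lebesgue. monomial \<alpha> x *\<^sub>R \<phi> x) = 0}"

definition test_class :: "nat \<Rightarrow> nat \<Rightarrow> real \<Rightarrow> (real^'n \<Rightarrow> complex) set" where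
  "test_class l N m = {\<phi> \<in> schwartz_vanishing N. schwartz_norm (N + l + 1) m \<phi> \<le> 1}"

definition dilate :: "real \<Rightarrow> (real^'n \<Rightarrow> complex) \<Rightarrow> real^'n \<Rightarrow> complex" where
  "dilate t \<phi> x = (1 / t ^ CARD('n)) *\<^sub>R \<phi> (x /\<^sub>R t)"

definition conv :: "(real^'n \<Rightarrow> complex) \<Rightarrow> ((real^'n \<Rightarrow> complex) \<Rightarrow> complex) \<Rightarrow> real^'n \<Rightarrow> complex" where
  "conv \<phi> u x = u (\<lambda>y. \<phi> (x - y))"

definition grand_TL_norm ::
    "(real^'n \<Rightarrow> complex) set \<Rightarrow> real \<Rightarrow> real \<Rightarrow> ((real^'n \<Rightarrow> complex) \<Rightarrow> complex) \<Rightarrow> ennreal" where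
  "grand_TL_norm A s p u = Lp_norm p (\<lambda>x. SUP k::int.
      ennreal (2 powr (of_int k * s)) *
        (SUP \<phi>\<in>A. ennreal (norm (conv (dilate (2 powi (- k)) \<phi>) u x))))"

definition grand_TL_space ::
    "(real^'n \<Rightarrow> complex) set \<Rightarrow> real \<Rightarrow> real \<Rightarrow> ((real^'n \<Rightarrow> complex) \<Rightarrow> complex) set" where
  "grand_TL_space A s p = {u. tempered u \<and> grand_TL_norm A s p u < \<infinity>}"

end

theory Submission
  imports Defs "HOL-Library.Sublist" "HOL-Computational_Algebra.Polynomial"
begin

text \<open>
  Write n for the dimension, q = n/(n+s) and h = g^q for a gradient g of f.  For g the Hajlasz
  inequality yields a Poincare inequality with the exponent q below one: inside a ball, every point
  with h of size 2^(k+1) M has a neighbour with h at most 2^k M at a distance dictated by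
  Chebyshev's inequality, and the increments along such a descent add up.  A dyadic decomposition of
  the kernel then bounds all averages against dilated test functions by the maximal function of h to
  the power 1/q, which the Hardy-Littlewood theorem controls in L^p because p > q.

  Conversely, let G be the grand maximal function of u and F the limit of the mollifications of u at
  dyadic scales; differences of mollifications are averages against zero-mean functions, so F exists
  wherever G is finite and a multiple of G is a Hajlasz gradient of F.  By the first part F defines a
  distribution, and v = u - F satisfies |v(\<phi>_t(x - .))| \<le> t^s T(x) with T in L^p for all normalised
  test functions \<phi>, without moment conditions.  Decomposing a test function along a grid of mesh t
  and letting t tend to 0 shows that v vanishes; this again uses p > q.
\<close>

section \<open>Partial derivatives and Schwartz seminorms\<close>

text \<open>Write a = 1/q = 1 + s/n. For p below one neither f nor g need be locally integrable a
  priori, and the exponent q is what restores integrability. At level 2^k of h the descent moves a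
  distance of order 2^(-k/n), while the gradient h^a has size 2^(ka); the increment of f is
  therefore of order 2^(ka - ks/n) = 2^k. The increments form a geometric sum, so the oscillation of
  f is bounded linearly in h, whose averages are controlled. Summing over dyadic balls then needs a
  kernel with decay m > n + s. In the converse direction the obstacle is that pointwise convergence
  of mollifications to F does not identify the distribution u, since for small p there is no
  integrable majorant. A piece of a test function on a cube of side t contributes at most t^(n+s)
  times a value of T anywhere in the cube. With r = min(1, p), r-th powers are subadditive over the
  pieces, and averaging over cubes divides by t^n. The surviving power t^((n+s)r - n) tends to 0
  precisely when p > n/(n+s).\<close>

lemma partial_eq:
  assumes "(f has_derivative D) (at x)"
  shows "partial i f x = D (axis i 1)"
proof -
  have "((\<lambda>t::real. x + t *\<^sub>R axis i 1) has_derivative (\<lambda>t. t *\<^sub>R axis i 1)) (at 0)"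
    by (auto intro!: derivative_eq_intros)
  then have "((\<lambda>t::real. f (x + t *\<^sub>R axis i 1)) has_derivative (\<lambda>t. D (t *\<^sub>R axis i 1))) (at 0)"
    by (rule has_derivative_compose) (use assms in simp)
  moreover have "(\<lambda>t::real. D (t *\<^sub>R axis i 1)) = (\<lambda>t. t *\<^sub>R D (axis i 1))"
    using has_derivative_linear[OF assms] by (simp add: linear_scale)
  ultimately have "((\<lambda>t::real. f (x + t *\<^sub>R axis i 1)) has_vector_derivative D (axis i 1)) (at 0)"
    by (simp add: has_vector_derivative_def)
  then show ?thesis unfolding partial_def by (rule vector_derivative_at)
qed

abbreviation pd :: "'n list \<Rightarrow> (real^'n \<Rightarrow> complex) \<Rightarrow> real^'n \<Rightarrow> complex"
  where "pd ns f \<equiv> foldr partial ns f"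

lemma smooth_pd_differentiable: "smooth f \<Longrightarrow> pd ns f differentiable (at x)"
  by (simp add: smooth_def)

lemma smooth_continuous: "smooth f \<Longrightarrow> continuous_on A (pd ns f)"
  using smooth_pd_differentiable differentiable_imp_continuous_on
  by (metis differentiable_at_imp_differentiable_on)

lemma smooth_borel: "smooth f \<Longrightarrow> f \<in> borel_measurable borel"
  using smooth_continuous[of f UNIV "[]"] by (simp add: borel_measurable_continuous_onI)

lemma partial_add:
  assumes "f differentiable (at x)" "g differentiable (at x)"
  shows "partial i (\<lambda>x. f x + g x) x = partial i f x + partial i g x"
proof -
  obtain D E where D: "(f has_derivative D) (at x)" "(g has_derivative E) (at x)"
    using assms unfolding differentiable_def by auto
  show ?thesis using partial_eq[OF has_derivative_add[OF D]] partial_eq[OF D(1)] partial_eq[OF D(2)] by simp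
qed

lemma partial_mult:
  assumes "f differentiable (at x)" "g differentiable (at x)"
  shows "partial i (\<lambda>x. f x * g x) x = partial i f x * g x + f x * partial i g x"
proof -
  obtain D E where D: "(f has_derivative D) (at x)" "(g has_derivative E) (at x)"
    using assms unfolding differentiable_def by auto
  show ?thesis using partial_eq[OF has_derivative_mult[OF D]] partial_eq[OF D(1)] partial_eq[OF D(2)] by simp
qed

lemma partial_const [simp]: "partial i (\<lambda>x. c) = (\<lambda>x. 0)"
  by (rule ext) (simp add: partial_def)

lemma has_derivative_affine:
  fixes f :: "real^'n \<Rightarrow> complex"
  assumes "(f has_derivative D) (at (a + b *\<^sub>R x))"
  shows "((\<lambda>x. c * f (a + b *\<^sub>R x)) has_derivative (\<lambda>y. c * D (b *\<^sub>R y))) (at x)"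
proof -
  have "((\<lambda>x. a + b *\<^sub>R x) has_derivative (\<lambda>x. b *\<^sub>R x)) (at x)"
    by (auto intro!: derivative_eq_intros)
  from has_derivative_compose[of "\<lambda>x. a + b *\<^sub>R x", OF this assms]
  show ?thesis by (rule has_derivative_mult_right)
qed

lemma smooth_const: "smooth (\<lambda>x. c)"
proof -
  have "pd ns (\<lambda>x :: real^'n. c) \<in> {\<lambda>x. c, \<lambda>x. 0}" for ns
    by (induction ns) auto
  then have "pd ns (\<lambda>x. c) differentiable (at x)" for ns and x :: "real^'n"
    using differentiable_const by (metis insertE singletonD)
  then show ?thesis unfolding smooth_def by blast
qed

lemma partial_affine:
  assumes "\<And>x. f differentiable (at x)"
  shows "partial i (\<lambda>x. c * f (a + b *\<^sub>R x)) x = (c * of_real b) * partial i f (a + b *\<^sub>R x)"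
proof -
  obtain D where D: "(f has_derivative D) (at (a + b *\<^sub>R x))"
    using assms unfolding differentiable_def by blast
  from partial_eq[OF has_derivative_affine[OF D]] partial_eq[OF D] show ?thesis
    using linear_scale[OF has_derivative_linear[OF D]]
    by (simp add: scaleR_conv_of_real[where 'a = complex])
qed

lemma pd_add:
  assumes "smooth f" "smooth g"
  shows "pd ns (\<lambda>x. f x + g x) = (\<lambda>x. pd ns f x + pd ns g x)"
proof (induction ns)
  case (Cons i ns')
  show ?case
    by (rule ext) (use Cons partial_add smooth_pd_differentiable assms in \<open>simp, blast\<close>)
qed simp

lemma pd_affine:
  assumes "smooth f"
  shows "pd ns (\<lambda>x. c * f (a + b *\<^sub>R x)) = (\<lambda>x. (c * of_real b ^ length ns) * pd ns f (a + b *\<^sub>R x))"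
proof (induction ns)
  case (Cons i ns')
  show ?case
    unfolding foldr.simps o_apply Cons
    by (rule ext, subst partial_affine) (simp_all add: smooth_pd_differentiable assms mult_ac)
qed simp

lemma pd_cmult: "smooth f \<Longrightarrow> pd ns (\<lambda>x. c * f x) = (\<lambda>x. c * pd ns f x)"
  using pd_affine[of f ns c 0 1] by simp

lemma smooth_add:
  assumes "smooth f" "smooth g"
  shows "smooth (\<lambda>x. f x + g x)"
  unfolding smooth_def pd_add[OF assms] using assms
  by (intro allI differentiable_add) (auto simp: smooth_def)

lemma smooth_affine:
  assumes "smooth f"
  shows "smooth (\<lambda>x. c * f (a + b *\<^sub>R x))"
  unfolding smooth_def pd_affine[OF assms]
proof (intro allI)
  fix ns x
  obtain D where D: "(pd ns f has_derivative D) (at (a + b *\<^sub>R x))"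
    using assms unfolding smooth_def differentiable_def by blast
  from has_derivative_affine[OF D]
  show "(\<lambda>x. (c * of_real b ^ length ns) * pd ns f (a + b *\<^sub>R x)) differentiable (at x)"
    unfolding differentiable_def by blast
qed

section \<open>Leibniz rule for iterated partial derivatives\<close>

fun splits :: "'a list \<Rightarrow> ('a list \<times> 'a list) list" where
  "splits [] = [([], [])]"
| "splits (i # ns) = map (\<lambda>(A, B). (i # A, B)) (splits ns) @ map (\<lambda>(A, B). (A, i # B)) (splits ns)"

lemma length_splits: "length (splits ns) = 2 ^ length ns"
  by (induction ns) auto

lemma splits_subseq: "(A, B) \<in> set (splits ns) \<Longrightarrow> subseq A ns \<and> subseq B ns"
  by (induction ns arbitrary: A B) auto

lemma differentiable_sum_list:
  "(\<And>a. a \<in> set L \<Longrightarrow> F a differentiable (at x)) \<Longrightarrow> (\<lambda>x. \<Sum>a\<leftarrow>L. F a x) differentiable (at x)"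
  for F :: "'a \<Rightarrow> real^'n \<Rightarrow> complex"
  by (induction L) (auto intro!: differentiable_add)

lemma partial_sum_list:
  "(\<And>a. a \<in> set L \<Longrightarrow> F a differentiable (at x)) \<Longrightarrow>
   partial i (\<lambda>x. \<Sum>a\<leftarrow>L. F a x) x = (\<Sum>a\<leftarrow>L. partial i (F a) x)"
  by (induction L) (auto simp: partial_add differentiable_sum_list)

lemma pd_mult:
  assumes "smooth f" "smooth g"
  shows "pd ns (\<lambda>x. f x * g x) = (\<lambda>x. \<Sum>(A, B)\<leftarrow>splits ns. pd A f x * pd B g x)"
proof (induction ns)
  case (Cons i ns')
  show ?case
  proof
    fix x
    have "pd (i # ns') (\<lambda>x. f x * g x) x = partial i (\<lambda>x. \<Sum>a\<leftarrow>splits ns'. pd (fst a) f x * pd (snd a) g x) x"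
      by (simp add: Cons case_prod_beta)
    also have "\<dots> = (\<Sum>a\<leftarrow>splits ns'. partial i (\<lambda>x. pd (fst a) f x * pd (snd a) g x) x)"
      by (rule partial_sum_list) (intro differentiable_mult smooth_pd_differentiable assms)
    also have "\<dots> = (\<Sum>a\<leftarrow>splits ns'. pd (i # fst a) f x * pd (snd a) g x + pd (fst a) f x * pd (i # snd a) g x)"
      by (simp add: partial_mult smooth_pd_differentiable assms)
    also have "\<dots> = (\<Sum>(A, B)\<leftarrow>splits (i # ns'). pd A f x * pd B g x)"
      by (simp add: sum_list_addf case_prod_beta o_def)
    finally show "pd (i # ns') (\<lambda>x. f x * g x) x = (\<Sum>(A, B)\<leftarrow>splits (i # ns'). pd A f x * pd B g x)" .
  qed
qed simp

lemma smooth_mult: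
  assumes "smooth f" "smooth g"
  shows "smooth (\<lambda>x. f x * g x)"
  unfolding smooth_def pd_mult[OF assms]
  by (auto intro!: differentiable_sum_list differentiable_mult smooth_pd_differentiable assms
      simp: case_prod_beta)

text \<open>These lists spell out a multi-index in the order of \<open>coord_list\<close>, so they
  give exactly the derivatives formed by \<open>multi_partial\<close>. The Leibniz rule distributes
  such a list over two subsequences; closure under subsequences (\<open>sorted_lists_subseq\<close>)
  keeps every estimate within the derivatives that the seminorms control.\<close>

definition sorted_lists :: "'n::finite list set" where
  "sorted_lists = range (\<lambda>\<alpha>. concat (map (\<lambda>i. replicate (\<alpha> i) i) coord_list))"

lemma coord_list: "distinct (coord_list :: 'n::finite list)" "set (coord_list :: 'n list) = UNIV"
proof -
  have "\<exists>xs::'n list. distinct xs \<and> set xs = UNIV"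
    using finite_distinct_list[of "UNIV :: 'n set"] by auto
  from someI_ex[OF this] show "distinct (coord_list :: 'n list)" "set (coord_list :: 'n list) = UNIV"
    unfolding coord_list_def by auto
qed

lemma subseq_replicate: "subseq ys (replicate n x) \<Longrightarrow> \<exists>k. ys = replicate k x"
proof (induction n arbitrary: ys)
  case (Suc n)
  show ?case
  proof (cases ys)
    case Nil
    then show ?thesis by (intro exI[of _ 0]) simp
  next
    case (Cons y zs)
    with Suc.prems have "y = x \<and> subseq zs (replicate n x) \<or> subseq (y # zs) (replicate n x)"
      by (auto simp: subseq_Cons2_iff split: if_splits)
    then show ?thesis
      using Suc.IH[of zs] Suc.IH[of "y # zs"] Cons replicate_Suc by metis
  qed
qed (auto intro: exI[of _ 0])

lemma subseq_concat_replicate: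
  assumes "distinct xs" "subseq ys (concat (map (\<lambda>i. replicate (\<alpha> i) i) xs))"
  shows "\<exists>\<beta>. ys = concat (map (\<lambda>i. replicate (\<beta> i) i) xs)"
  using assms
proof (induction xs arbitrary: ys)
  case (Cons x xs)
  from Cons.prems(2) have "subseq ys (replicate (\<alpha> x) x @ concat (map (\<lambda>i. replicate (\<alpha> i) i) xs))"
    by simp
  then obtain us vs where ys: "ys = us @ vs" "subseq us (replicate (\<alpha> x) x)"
      "subseq vs (concat (map (\<lambda>i. replicate (\<alpha> i) i) xs))"
    by (rule subseq_appendE)
  from subseq_replicate[OF ys(2)] obtain k where k: "us = replicate k x" ..
  from Cons.IH[OF _ ys(3)] Cons.prems(1)
  obtain \<beta> where b: "vs = concat (map (\<lambda>i. replicate (\<beta> i) i) xs)" by auto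
  have "map (\<lambda>i. replicate ((\<beta>(x := k)) i) i) xs = map (\<lambda>i. replicate (\<beta> i) i) xs"
    using Cons.prems(1) by auto
  then have "ys = concat (map (\<lambda>i. replicate ((\<beta>(x := k)) i) i) (x # xs))"
    using ys k b by (simp cong: map_cong)
  then show ?case by blast
qed simp

lemma sorted_lists_subseq: "js \<in> sorted_lists \<Longrightarrow> subseq ns js \<Longrightarrow> ns \<in> sorted_lists"
  unfolding sorted_lists_def using subseq_concat_replicate[OF coord_list(1)] by fastforce

lemma Nil_sorted_lists [simp]: "[] \<in> sorted_lists"
  unfolding sorted_lists_def by (rule image_eqI[of _ _ "\<lambda>_. 0"]) (simp_all add: concat_replicate_trivial)

lemma multi_partial_eq: "multi_partial \<alpha> f = pd (concat (map (\<lambda>i. replicate (\<alpha> i) i) coord_list)) f"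
proof -
  have "foldr (\<lambda>i. partial i ^^ \<alpha> i) xs f = pd (concat (map (\<lambda>i. replicate (\<alpha> i) i) xs)) f" for xs
    by (induction xs) (auto simp: foldr_replicate)
  then show ?thesis by (simp add: multi_partial_def)
qed

lemma multi_order_eq: "multi_order \<alpha> = length (concat (map (\<lambda>i. replicate (\<alpha> i) i) (coord_list :: 'n::finite list)))"
proof -
  have "length (concat (map (\<lambda>i. replicate (\<alpha> i) i) coord_list)) = sum_list (map \<alpha> (coord_list :: 'n list))"
    by (simp add: length_concat o_def)
  then show ?thesis
    by (simp add: multi_order_def sum_list_distinct_conv_sum_set coord_list)
qed

text \<open>The inequality \<open>schwartz_norm k m \<phi> \<le> C\<close> with a real constant and
  an arbitrary real weight. A negative weight permits growth at infinity; the cutoff functions are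
  measured with \<open>m = -1\<close>.\<close>

definition sbound :: "nat \<Rightarrow> real \<Rightarrow> real \<Rightarrow> (real^'n \<Rightarrow> complex) \<Rightarrow> bool" where
  "sbound k m C \<phi> \<longleftrightarrow> (\<forall>ns\<in>sorted_lists. length ns \<le> k \<longrightarrow>
      (\<forall>x. (1 + norm x) powr m * norm (pd ns \<phi> x) \<le> C))"

lemma sboundD: "sbound k m C \<phi> \<Longrightarrow> ns \<in> sorted_lists \<Longrightarrow> length ns \<le> k \<Longrightarrow>
    (1 + norm x) powr m * norm (pd ns \<phi> x) \<le> C"
  by (auto simp: sbound_def)

lemma sboundD':
  assumes "sbound k m C \<phi>" "ns \<in> sorted_lists" "length ns \<le> k"
  shows "norm (pd ns \<phi> x) \<le> C * (1 + norm x) powr (- m)"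
proof -
  have "0 < (1 + norm x) powr m" using add_pos_nonneg[OF zero_less_one norm_ge_zero, of x] by simp
  then show ?thesis
    using sboundD[OF assms, of x] by (simp add: powr_minus divide_inverse[symmetric] pos_le_divide_eq mult.commute)
qed

lemma sbound0: "sbound k m C \<phi> \<Longrightarrow> norm (\<phi> x) \<le> C * (1 + norm x) powr (- m)"
  using sboundD'[of k m C \<phi> "[]"] by simp

lemma sbound_nonneg: "sbound k m C \<phi> \<Longrightarrow> 0 \<le> C"
  using sboundD[of k m C \<phi> "[]" 0] order_trans[OF norm_ge_zero] by simp

lemma sboundI:
  fixes \<phi> :: "real^'n \<Rightarrow> complex"
  shows "(\<And>ns x. ns \<in> sorted_lists \<Longrightarrow> length ns \<le> k \<Longrightarrow>
    norm (pd ns \<phi> x) \<le> C * (1 + norm x) powr (- m)) \<Longrightarrow> sbound k m C \<phi>"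
  unfolding sbound_def
proof (intro ballI impI allI)
  fix ns :: "'n list" and x :: "real^'n"
  assume a: "\<And>ns x. ns \<in> sorted_lists \<Longrightarrow> length ns \<le> k \<Longrightarrow> norm (pd ns \<phi> x) \<le> C * (1 + norm x) powr (- m)"
    and ns: "ns \<in> sorted_lists" "length ns \<le> k"
  have "(1 + norm x) powr m * norm (pd ns \<phi> x) \<le> (1 + norm x) powr m * (C * (1 + norm x) powr (- m))"
    by (intro mult_left_mono a ns) auto
  also have "\<dots> = C * (1 + norm x) powr (m + - m)" by (simp only: powr_add mult_ac)
  also have "\<dots> = C" using add_pos_nonneg[OF zero_less_one norm_ge_zero, of x] by simp
  finally show "(1 + norm x) powr m * norm (pd ns \<phi> x) \<le> C" .
qed

lemma schwartz_norm_le_iff: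
  assumes "0 \<le> C"
  shows "schwartz_norm k m \<phi> \<le> ennreal C \<longleftrightarrow> sbound k m C \<phi>"
  unfolding schwartz_norm_def sbound_def sorted_lists_def SUP_le_iff multi_partial_eq multi_order_eq
  using assms by (auto simp: ennreal_le_iff)

lemma sbound_mono:
  assumes "sbound k m C \<phi>" "k' \<le> k" "m' \<le> m" "C \<le> C'"
  shows "sbound k' m' C' \<phi>"
  unfolding sbound_def
proof (intro ballI impI allI)
  fix ns :: "'a list" and x assume ns: "ns \<in> sorted_lists" "length ns \<le> k'"
  have "(1 + norm x) powr m' * norm (pd ns \<phi> x) \<le> (1 + norm x) powr m * norm (pd ns \<phi> x)"
    using assms by (intro mult_right_mono powr_mono) auto
  also have "\<dots> \<le> C" using assms ns sboundD[OF assms(1), of ns x] by auto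
  finally show "(1 + norm x) powr m' * norm (pd ns \<phi> x) \<le> C'" using assms by simp
qed

text \<open>The weights in \<open>schwartz\<close> are positive. Since the bounds are monotone in
  the weight, a bound for \<open>max m 1\<close> yields one for every real \<open>m\<close>.\<close>

lemma schwartz_iff: "\<phi> \<in> schwartz \<longleftrightarrow> smooth \<phi> \<and> (\<forall>k m. \<exists>C. sbound k m C \<phi>)"
proof -
  have *: "schwartz_norm k m \<phi> < \<infinity> \<longleftrightarrow> (\<exists>C. sbound k m C \<phi>)" for k m
  proof
    assume "schwartz_norm k m \<phi> < \<infinity>"
    then obtain C where "schwartz_norm k m \<phi> = ennreal C" "0 \<le> C" by (cases "schwartz_norm k m \<phi>") auto
    then show "\<exists>C. sbound k m C \<phi>" using schwartz_norm_le_iff[of C k m \<phi>] by auto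
  next
    assume "\<exists>C. sbound k m C \<phi>"
    then obtain C where "sbound k m C \<phi>" ..
    then have "schwartz_norm k m \<phi> \<le> ennreal C"
      using sbound_nonneg schwartz_norm_le_iff by blast
    then show "schwartz_norm k m \<phi> < \<infinity>"
      using le_less_trans[OF _ ennreal_less_top, of "schwartz_norm k m \<phi>" C] by simp
  qed
  have "(\<forall>k m. m > 0 \<longrightarrow> (\<exists>C. sbound k m C \<phi>)) \<Longrightarrow> \<exists>C. sbound k m C \<phi>" for k m
    using sbound_mono[of k "max m 1" _ \<phi> k m] by (metis less_max_iff_disj max.cobounded1 order_refl zero_less_one)
  then show ?thesis unfolding schwartz_def mem_Collect_eq * by blast
qed

lemma schwartzE:
  assumes "\<phi> \<in> schwartz"
  obtains C where "0 < C" "sbound k m C \<phi>"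
proof -
  obtain C where "sbound k m C \<phi>" using assms schwartz_iff by blast
  then have "sbound k m (max C 1) \<phi>" by (rule sbound_mono) auto
  then show ?thesis by (intro that[of "max C 1"]) auto
qed

lemma schwartz_smooth: "\<phi> \<in> schwartz \<Longrightarrow> smooth \<phi>"
  by (simp add: schwartz_iff)

lemma sbound_add:
  assumes "smooth f" "smooth g" "sbound k m C f" "sbound k m D g"
  shows "sbound k m (C + D) (\<lambda>x. f x + g x)"
proof (rule sboundI)
  fix ns :: "'a list" and x assume ns: "ns \<in> sorted_lists" "length ns \<le> k"
  show "norm (pd ns (\<lambda>x. f x + g x) x) \<le> (C + D) * (1 + norm x) powr - m"
    unfolding pd_add[OF assms(1,2)] distrib_right
    by (intro norm_triangle_le add_mono sboundD'[OF assms(3)] sboundD'[OF assms(4)] ns)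
qed

text \<open>The substitution changes the weight by at most 1 + |x| \<le> (1 + |a|) (1 + 1/|b|) (1 +
  |a + b x|). Every derivative brings a factor \<open>b\<close>, and
  \<open>(1 + \<bar>b\<bar>) ^ k\<close> dominates all its powers up to order
  \<open>k\<close>.\<close>

lemma sbound_affine:
  assumes "smooth f" "sbound k m C f" "b \<noteq> 0" "0 \<le> m"
  shows "sbound k m (norm c * C * (1 + \<bar>b\<bar>) ^ k * ((1 + norm a) * (1 + 1 / \<bar>b\<bar>)) powr m) (\<lambda>x. c * f (a + b *\<^sub>R x))"
  unfolding sbound_def
proof (intro ballI impI allI)
  fix ns :: "'a list" and x assume ns: "ns \<in> sorted_lists" "length ns \<le> k"
  let ?y = "a + b *\<^sub>R x"
  have "norm x = norm ((?y - a) /\<^sub>R b)" using assms(3) by simp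
  also have "\<dots> = norm (?y - a) / \<bar>b\<bar>"
    unfolding norm_scaleR by (simp add: divide_inverse mult.commute)
  also have "\<dots> \<le> (norm ?y + norm a) / \<bar>b\<bar>"
    by (intro divide_right_mono norm_triangle_ineq4) auto
  finally have "norm x \<le> (norm ?y + norm a) / \<bar>b\<bar>" .
  then have "1 + norm x \<le> 1 + (norm ?y + norm a) / \<bar>b\<bar>" by simp
  also have "\<dots> \<le> ((1 + norm a) * (1 + 1 / \<bar>b\<bar>)) * (1 + norm ?y)"
    using assms(3) by (auto simp: field_simps intro!: add_nonneg_nonneg)
  finally have "(1 + norm x) powr m \<le> (((1 + norm a) * (1 + 1 / \<bar>b\<bar>)) * (1 + norm ?y)) powr m"
    using assms(4) by (intro powr_mono2) auto
  also have "\<dots> = ((1 + norm a) * (1 + 1 / \<bar>b\<bar>)) powr m * (1 + norm ?y) powr m"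
    by (simp add: powr_mult)
  finally have 1: "(1 + norm x) powr m \<le> ((1 + norm a) * (1 + 1 / \<bar>b\<bar>)) powr m * (1 + norm ?y) powr m" .
  have "\<bar>b\<bar> ^ length ns \<le> (1 + \<bar>b\<bar>) ^ length ns" by (intro power_mono) auto
  also have "\<dots> \<le> (1 + \<bar>b\<bar>) ^ k" using ns by (intro power_increasing) auto
  finally have 2: "\<bar>b\<bar> ^ length ns \<le> (1 + \<bar>b\<bar>) ^ k" .
  have "(1 + norm x) powr m * norm (pd ns (\<lambda>x. c * f (a + b *\<^sub>R x)) x)
      = (1 + norm x) powr m * (norm c * \<bar>b\<bar> ^ length ns * norm (pd ns f ?y))"
    by (simp add: pd_affine[OF assms(1)] norm_mult norm_power)
  also have "\<dots> \<le> (((1 + norm a) * (1 + 1 / \<bar>b\<bar>)) powr m * (1 + norm ?y) powr m)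
      * (norm c * (1 + \<bar>b\<bar>) ^ k * norm (pd ns f ?y))"
    by (intro mult_mono 1 2) auto
  also have "\<dots> = ((1 + norm a) * (1 + 1 / \<bar>b\<bar>)) powr m * norm c * (1 + \<bar>b\<bar>) ^ k *
       ((1 + norm ?y) powr m * norm (pd ns f ?y))" by simp
  also have "\<dots> \<le> ((1 + norm a) * (1 + 1 / \<bar>b\<bar>)) powr m * norm c * (1 + \<bar>b\<bar>) ^ k * C"
    using sboundD[OF assms(2) ns] by (intro mult_left_mono) auto
  finally show "(1 + norm x) powr m * norm (pd ns (\<lambda>x. c * f (a + b *\<^sub>R x)) x)
     \<le> norm c * C * (1 + \<bar>b\<bar>) ^ k * ((1 + norm a) * (1 + 1 / \<bar>b\<bar>)) powr m"
    by (simp add: mult_ac)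
qed

lemma schwartz_affine:
  assumes "\<phi> \<in> schwartz" "b \<noteq> 0"
  shows "(\<lambda>x. c * \<phi> (a + b *\<^sub>R x)) \<in> schwartz"
  unfolding schwartz_iff
proof (intro conjI allI)
  show "smooth (\<lambda>x. c * \<phi> (a + b *\<^sub>R x))" by (intro smooth_affine schwartz_smooth assms)
  fix k m
  obtain C where "sbound k (max m 0) C \<phi>" using schwartzE[OF assms(1)] .
  from sbound_mono[OF sbound_affine[OF schwartz_smooth[OF assms(1)] this assms(2)] order_refl _ order_refl, of m]
  show "\<exists>C. sbound k m C (\<lambda>x. c * \<phi> (a + b *\<^sub>R x))" by auto
qed

lemma sbound_cmult:
  assumes "smooth f" "sbound k m C f"
  shows "sbound k m (norm c * C) (\<lambda>x. c * f x)"
proof (rule sboundI)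
  fix ns :: "'a list" and x assume ns: "ns \<in> sorted_lists" "length ns \<le> k"
  show "norm (pd ns (\<lambda>x. c * f x) x) \<le> norm c * C * (1 + norm x) powr - m"
  proof -
    have "pd ns (\<lambda>x. c * f x) x = c * pd ns f x"
      using pd_affine[OF assms(1), of ns c 0 1] by simp
    then show ?thesis
      using mult_left_mono[OF sboundD'[OF assms(2) ns, of x] norm_ge_zero[of c]]
      by (simp only: norm_mult mult.assoc)
  qed
qed

lemma schwartz_cmult:
  assumes "\<phi> \<in> schwartz"
  shows "(\<lambda>x. c * \<phi> x) \<in> schwartz"
proof -
  have "(\<lambda>x. c * \<phi> (0 + 1 *\<^sub>R x)) \<in> schwartz" by (rule schwartz_affine[OF assms]) simp
  then show ?thesis by simp
qed

lemma schwartz_add: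
  assumes "\<phi> \<in> schwartz" "\<psi> \<in> schwartz"
  shows "(\<lambda>x. \<phi> x + \<psi> x) \<in> schwartz"
  unfolding schwartz_iff
proof (intro conjI allI)
  show "smooth (\<lambda>x. \<phi> x + \<psi> x)" by (intro smooth_add schwartz_smooth assms)
  fix k m
  obtain C where C: "sbound k m C \<phi>" using schwartzE[OF assms(1)] .
  obtain D where D: "sbound k m D \<psi>" using schwartzE[OF assms(2)] .
  from sbound_add[OF schwartz_smooth[OF assms(1)] schwartz_smooth[OF assms(2)] C D]
  show "\<exists>C. sbound k m C (\<lambda>x. \<phi> x + \<psi> x)" ..
qed

lemma schwartz_diff:
  assumes "\<phi> \<in> schwartz" "\<psi> \<in> schwartz"
  shows "(\<lambda>x. \<phi> x - \<psi> x) \<in> schwartz"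
proof -
  from schwartz_add[OF assms(1) schwartz_cmult[OF assms(2), of "-1"]]
  show ?thesis by simp
qed

lemma sbound_diff:
  assumes "smooth f" "smooth g" "sbound k m C f" "sbound k m D g"
  shows "sbound k m (C + D) (\<lambda>x. f x - g x)"
proof -
  have "smooth (\<lambda>x. -1 * g x)" using smooth_affine[OF assms(2), of "-1" 0 1] by simp
  from sbound_add[OF assms(1) this assms(3) sbound_cmult[OF assms(2,4), of "-1"]]
  show ?thesis by simp
qed

text \<open>Each of the \<open>2 ^ length ns\<close> splittings contributes at most
  \<open>a * b\<close>. The estimate is made at a single point so that the factors may carry
  unrelated weights there, as happens in \<open>tempered_vanishes\<close>.\<close>

lemma leibniz_bound:
  fixes f g :: "real^'n \<Rightarrow> complex"
  assumes "smooth f" "smooth g" "ns \<in> sorted_lists" "length ns \<le> k"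
    and f: "\<And>js. js \<in> sorted_lists \<Longrightarrow> length js \<le> k \<Longrightarrow> norm (pd js f x) \<le> a"
    and g: "\<And>js. js \<in> sorted_lists \<Longrightarrow> length js \<le> k \<Longrightarrow> norm (pd js g x) \<le> b"
  shows "norm (pd ns (\<lambda>x. f x * g x) x) \<le> 2 ^ k * (a * b)"
proof -
  have a: "0 \<le> a" using order_trans[OF norm_ge_zero f[of "[]"]] by simp
  have b: "0 \<le> b" using order_trans[OF norm_ge_zero g[of "[]"]] by simp
  have gen: "norm (\<Sum>a\<leftarrow>L. F a) \<le> (\<Sum>a\<leftarrow>L. norm (F a))"
    for L :: "('n list \<times> 'n list) list" and F :: "_ \<Rightarrow> complex"
    by (induction L) (auto intro!: norm_triangle_le)
  have "norm (pd ns (\<lambda>x. f x * g x) x) \<le> (\<Sum>(A, B)\<leftarrow>splits ns. norm (pd A f x * pd B g x))"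
    unfolding pd_mult[OF assms(1,2)] case_prod_beta by (rule gen)
  also have "\<dots> \<le> (\<Sum>(A, B)\<leftarrow>splits ns. a * b)"
  proof (rule sum_list_mono, clarify)
    fix A B assume "(A, B) \<in> set (splits ns)"
    then have "subseq A ns" "subseq B ns" using splits_subseq by blast+
    then have "A \<in> sorted_lists" "B \<in> sorted_lists" "length A \<le> k" "length B \<le> k"
      using assms(3,4) sorted_lists_subseq list_emb_length order_trans by blast+
    then show "norm (pd A f x * pd B g x) \<le> a * b"
      unfolding norm_mult using a by (intro mult_mono f g) auto
  qed
  also have "\<dots> = real (length (splits ns)) * (a * b)"
    by (simp add: split_def map_replicate_const sum_list_replicate)
  also have "\<dots> = 2 ^ length ns * (a * b)" by (simp add: length_splits)
  also have "\<dots> \<le> 2 ^ k * (a * b)"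
    using assms(4) a b by (intro mult_right_mono power_increasing) auto
  finally show ?thesis .
qed

lemma sbound_mult:
  assumes "smooth f" "smooth g" "sbound k m C f" "sbound k m' D g"
  shows "sbound k (m + m') (2 ^ k * (C * D)) (\<lambda>x. f x * g x)"
proof (rule sboundI)
  fix ns :: "'a list" and x assume ns: "ns \<in> sorted_lists" "length ns \<le> k"
  from leibniz_bound[OF assms(1,2) this sboundD'[OF assms(3)] sboundD'[OF assms(4)]]
  show "norm (pd ns (\<lambda>x. f x * g x) x) \<le> 2 ^ k * (C * D) * (1 + norm x) powr - (m + m')"
    by (simp add: powr_add[of _ "-m" "-m'", simplified] mult_ac)
qed

lemma finite_lists_length: "finite {ns :: 'n::finite list. length ns \<le> k}"
  using finite_lists_length_le[of "UNIV :: 'n set" k] by simp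

text \<open>On a large ball this is uniform continuity of finitely many derivatives; outside, the
  decay with weight \<open>m + 1\<close> gains one power of the radius over the required weight
  \<open>m\<close>.\<close>

lemma schwartz_translation_continuous:
  fixes \<phi> :: "real^'n \<Rightarrow> complex"
  assumes "\<phi> \<in> schwartz" "0 < e" "0 \<le> m"
  shows "\<forall>\<^sub>F h in nhds 0. sbound k m e (\<lambda>x. \<phi> (x + h) - \<phi> x)"
proof -
  have sm: "smooth \<phi>" using assms(1) by (rule schwartz_smooth)
  have "\<forall>\<^sub>F h in nhds 0. \<forall>x. (1 + norm x) powr m * norm (pd ns \<phi> (x + h) - pd ns \<phi> x) \<le> e"
    if ns: "ns \<in> sorted_lists" "length ns \<le> k" for ns
  proof -
    let ?\<psi> = "pd ns \<phi>"
    obtain C where C: "0 < C" "sbound k (m + 1) C \<phi>" using schwartzE[OF assms(1)] .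
    \<comment> \<open>The radius at which the tail bound C (1 + 2^(m+1)) / R drops to
      \<open>e\<close>; the factor 2^(m+1) compares the weights at x and at x + h.\<close>
    define R where "R = C * (1 + 2 powr (m + 1)) / e"
    have R: "0 < R" using C assms by (simp add: R_def add_pos_nonneg)
    have "uniformly_continuous_on (cball 0 (R + 1)) ?\<psi>"
      by (intro compact_uniformly_continuous smooth_continuous sm) auto
    moreover have "0 < e / (1 + R) powr m" using assms R by auto
    ultimately obtain d where d: "0 < d" "\<And>x x'. x \<in> cball 0 (R + 1) \<Longrightarrow> x' \<in> cball 0 (R + 1) \<Longrightarrow>
        dist x' x < d \<Longrightarrow> dist (?\<psi> x') (?\<psi> x) < e / (1 + R) powr m"
      unfolding uniformly_continuous_on_def by meson
    have "(1 + norm x) powr m * norm (?\<psi> (x + h) - ?\<psi> x) \<le> e" if h: "norm h < min d 1" for x h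
    proof (cases "norm x \<le> R")
      case True
      have "norm (x + h) \<le> norm x + norm h" by (rule norm_triangle_ineq)
      then have "norm (?\<psi> (x + h) - ?\<psi> x) < e / (1 + R) powr m"
        using d(2)[of x "x + h"] True h unfolding mem_cball_0 by (simp add: dist_norm)
      moreover have "(1 + norm x) powr m \<le> (1 + R) powr m" using True assms by (intro powr_mono2) auto
      ultimately have "(1 + norm x) powr m * norm (?\<psi> (x + h) - ?\<psi> x) \<le> (1 + R) powr m * (e / (1 + R) powr m)"
        by (intro mult_mono) auto
      then show ?thesis using R by simp
    next
      case False
      let ?X = "1 + norm x"
      have X: "?X > 0" by (simp add: add_pos_nonneg)
      have "norm ((x + h) - h) \<le> norm (x + h) + norm h" by (rule norm_triangle_ineq4)
      then have "?X \<le> 2 * (1 + norm (x + h))" using h norm_ge_zero[of "x+h"] by (simp, linarith)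
      then have "?X powr (m + 1) \<le> (2 * (1 + norm (x + h))) powr (m + 1)"
        using assms by (intro powr_mono2) auto
      also have "\<dots> = 2 powr (m + 1) * (1 + norm (x + h)) powr (m + 1)"
        by (rule powr_mult)
      finally have "?X powr (m + 1) * norm (?\<psi> (x + h)) \<le> 2 powr (m + 1) * (1 + norm (x + h)) powr (m + 1) * norm (?\<psi> (x + h))"
        by (intro mult_right_mono) auto
      also have "\<dots> = 2 powr (m + 1) * ((1 + norm (x + h)) powr (m + 1) * norm (?\<psi> (x + h)))" by simp
      also have "\<dots> \<le> 2 powr (m + 1) * C" using sboundD[OF C(2) ns] by (intro mult_left_mono) auto
      finally have 1: "?X powr (m + 1) * norm (?\<psi> (x + h)) \<le> 2 powr (m + 1) * C" .
      have 2: "?X powr (m + 1) * norm (?\<psi> x) \<le> C" using sboundD[OF C(2) ns] .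
      have "?X * (?X powr m * norm (?\<psi> (x + h) - ?\<psi> x)) = ?X powr (m + 1) * norm (?\<psi> (x + h) - ?\<psi> x)"
        using X by (simp add: powr_add)
      also have "\<dots> \<le> ?X powr (m + 1) * (norm (?\<psi> (x + h)) + norm (?\<psi> x))"
        by (intro mult_left_mono norm_triangle_ineq4) auto
      also have "\<dots> \<le> C * (1 + 2 powr (m + 1))" using 1 2 by (simp add: algebra_simps)
      also have "\<dots> = R * e" using assms by (simp add: R_def)
      also have "\<dots> \<le> ?X * e" using False assms by (intro mult_right_mono) auto
      finally show ?thesis using X by simp
    qed
    then show ?thesis
      unfolding eventually_nhds_metric using d(1) by (intro exI[of _ "min d 1"]) (auto simp: dist_norm)
  qed
  then have "\<forall>\<^sub>F h in nhds 0. \<forall>ns\<in>{ns \<in> sorted_lists. length ns \<le> k}.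
      \<forall>x. (1 + norm x) powr m * norm (pd ns \<phi> (x + h) - pd ns \<phi> x) \<le> e"
    by (intro eventually_ball_finite finite_subset[OF _ finite_lists_length]) auto
  then show ?thesis
  proof eventually_elim
    case (elim h)
    have 1: "smooth (\<lambda>x. \<phi> (x + h))" using smooth_affine[OF sm, of 1 h 1] by (simp add: add.commute)
    have 2: "pd ns (\<lambda>x. \<phi> (x + h) - \<phi> x) = (\<lambda>x. pd ns \<phi> (x + h) - pd ns \<phi> x)" for ns
      using pd_add[OF 1 smooth_affine[OF sm, of "-1" 0 1], of ns]
        pd_affine[OF sm, of ns "-1" 0 1] pd_affine[OF sm, of ns 1 h 1] by (simp add: add.commute)
    show ?case unfolding sbound_def 2 using elim by auto
  qed
qed

lemma schwartz_borel: "\<phi> \<in> schwartz \<Longrightarrow> \<phi> \<in> borel_measurable borel"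
  by (simp add: schwartz_smooth smooth_borel)

section \<open>The uncentred Hardy--Littlewood maximal function\<close>

definition vball :: "(real^'n) itself \<Rightarrow> real \<Rightarrow> real" where
  "vball _ r = unit_ball_vol (real CARD('n)) * r ^ CARD('n)"

lemma vball_pos [simp]: "0 < r \<Longrightarrow> 0 < vball TYPE(real^'n) r"
  by (simp add: vball_def unit_ball_vol_pos)

lemma vball_mult: "vball TYPE(real^'n) (a * r) = a ^ CARD('n) * vball TYPE(real^'n) r"
  by (simp add: vball_def power_mult_distrib)

lemma emeasure_lebesgue_ball:
  "0 \<le> r \<Longrightarrow> emeasure lebesgue (ball (c::real^'n) r) = ennreal (vball TYPE(real^'n) r)"
  by (simp add: emeasure_ball vball_def)

text \<open>Uncentred: all balls containing x compete. Superlevel sets are then unions of balls,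
  hence open, which gives measurability at once.\<close>

definition hl_max :: "(real^'n \<Rightarrow> real) \<Rightarrow> real^'n \<Rightarrow> ennreal" where
  "hl_max h x = (SUP z\<in>{z. 0 < snd z \<and> x \<in> ball (fst z) (snd z)}.
     (\<integral>\<^sup>+y\<in>ball (fst z) (snd z). ennreal (h y) \<partial>lebesgue) / ennreal (vball TYPE(real^'n) (snd z)))"

lemma less_divide_ennreal_iff:
  fixes I t :: ennreal and v :: real
  assumes "0 < v"
  shows "t < I / ennreal v \<longleftrightarrow> t * ennreal v < I"
proof -
  have "I / ennreal v \<le> t \<longleftrightarrow> I \<le> t * ennreal v"
  proof
    assume "I / ennreal v \<le> t"
    then have "I / ennreal v * ennreal v \<le> t * ennreal v" by (rule mult_right_mono) simp
    then show "I \<le> t * ennreal v" using assms by (simp add: ennreal_divide_times)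
  next
    assume "I \<le> t * ennreal v"
    then show "I / ennreal v \<le> t" using assms by (intro divide_le_posI_ennreal) (auto simp: mult.commute)
  qed
  then show ?thesis by (meson not_le)
qed

lemma less_hl_max_iff:
  fixes h :: "real^'n \<Rightarrow> real"
  shows "t < hl_max h x \<longleftrightarrow> (\<exists>c r. 0 < r \<and> x \<in> ball c r \<and>
     t * ennreal (vball TYPE(real^'n) r) < (\<integral>\<^sup>+y\<in>ball c r. ennreal (h y) \<partial>lebesgue))"
  unfolding hl_max_def less_SUP_iff by (auto simp: less_divide_ennreal_iff)

lemma integral_ball_le_hl_max:
  fixes h :: "real^'n \<Rightarrow> real"
  assumes "0 < r" "x \<in> ball c r"
  shows "(\<integral>\<^sup>+y\<in>ball c r. ennreal (h y) \<partial>lebesgue) \<le> hl_max h x * ennreal (vball TYPE(real^'n) r)"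
  using less_hl_max_iff[of "hl_max h x" h x] assms by (meson less_irrefl not_le)

lemma open_hl_max:
  fixes h :: "real^'n \<Rightarrow> real"
  shows "open {x. t < hl_max h x}"
proof -
  have "{x. t < hl_max h x} = (\<Union>z\<in>{z. 0 < snd z \<and>
     t * ennreal (vball TYPE(real^'n) (snd z)) < (\<integral>\<^sup>+y\<in>ball (fst z) (snd z). ennreal (h y) \<partial>lebesgue)}.
       ball (fst z) (snd z))"
    unfolding less_hl_max_iff by fastforce
  then show ?thesis by (simp add: open_UN)
qed

lemma borel_measurable_hl_max [measurable]: "hl_max h \<in> borel_measurable borel"
  by (rule borel_measurableI_greater) (simp add: open_hl_max borel_open)

text \<open>Vitali covering: countably many disjoint balls with average above t suffice after
  fivefold enlargement, and the enlargement costs \<open>5 ^ CARD('n)\<close>. Sums over the family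
  are written as integrals over \<open>count_space C\<close> so that they can be exchanged with the
  Lebesgue integral.\<close>

lemma hl_max_weak:
  fixes h :: "real^'n \<Rightarrow> real"
  assumes h[measurable]: "h \<in> borel_measurable borel" and "0 < t"
  shows "ennreal t * emeasure lebesgue {x. ennreal t < hl_max h x} \<le> 5 ^ CARD('n) * (\<integral>\<^sup>+y. ennreal (h y) \<partial>lebesgue)"
proof (cases "(\<integral>\<^sup>+y. ennreal (h y) \<partial>lebesgue) = \<infinity>")
  case True
  have "(5::ennreal) ^ CARD('n) \<noteq> 0" by simp
  with True show ?thesis by (simp add: ennreal_mult_top)
next
  case False
  then obtain I where I: "(\<integral>\<^sup>+y. ennreal (h y) \<partial>lebesgue) = ennreal I" "0 \<le> I"
    by (cases "\<integral>\<^sup>+y. ennreal (h y) \<partial>lebesgue") auto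
  let ?v = "vball TYPE(real^'n)"
  define K where "K = {z :: (real^'n) \<times> real. 0 < snd z \<and>
     ennreal t * ennreal (?v (snd z)) < (\<integral>\<^sup>+y\<in>ball (fst z) (snd z). ennreal (h y) \<partial>lebesgue)}"
  let ?B = "\<lambda>z :: (real^'n) \<times> real. ball (fst z) (snd z)"
  let ?S = "{x. ennreal t < hl_max h x}"
  have S: "?S \<subseteq> (\<Union>z\<in>K. ?B z)"
    unfolding less_hl_max_iff K_def by fastforce
  \<comment> \<open>The covering lemma asks for bounded radii. A radius r \<ge> 1 satisfies r \<le>
    r^n, so t |B_r| < I bounds it by I / (t |B_1|).\<close>
  have rad: "0 < snd z \<and> snd z \<le> max 1 (I / (t * ?v 1))" if "z \<in> K" for z
  proof -
    have z: "0 < snd z" "ennreal t * ennreal (?v (snd z)) < (\<integral>\<^sup>+y\<in>?B z. ennreal (h y) \<partial>lebesgue)"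
      using that by (auto simp: K_def)
    have "(\<integral>\<^sup>+y\<in>?B z. ennreal (h y) \<partial>lebesgue) \<le> ennreal I"
      unfolding I(1)[symmetric] by (intro nn_integral_mono) (auto simp: indicator_def)
    with z have "ennreal (t * ?v (snd z)) < ennreal I"
      using assms by (simp add: ennreal_mult less_imp_le)
    then have lt: "t * ?v (snd z) < I" using assms z by (simp add: ennreal_less_iff less_imp_le)
    have "snd z \<le> I / (t * ?v 1)" if "1 \<le> snd z"
    proof -
      have "snd z * (t * ?v 1) \<le> (snd z) ^ CARD('n) * (t * ?v 1)"
        using that assms by (intro mult_right_mono self_le_power) (auto simp: less_imp_le)
      also have "\<dots> = t * ?v (snd z)" using vball_mult[of "snd z" 1, where 'n='n] by simp
      also have "\<dots> < I" by (rule lt)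
      finally show ?thesis using assms by (simp add: pos_le_divide_eq)
    qed
    with z show ?thesis by fastforce
  qed
  obtain C where C: "countable C" "C \<subseteq> K" "pairwise (\<lambda>i j. disjnt (?B i) (?B j)) C"
     "?S \<subseteq> (\<Union>i\<in>C. ball (fst i) (5 * snd i))"
    using Vitali_covering_lemma_balls[OF S, of "max 1 (I / (t * ?v 1))"] rad by blast
  have "emeasure lebesgue ?S = (\<integral>\<^sup>+x. indicator ?S x \<partial>lebesgue)"
    using borel_open[OF open_hl_max] by (intro nn_integral_indicator[symmetric]) auto
  also have "\<dots> \<le> (\<integral>\<^sup>+x. (\<integral>\<^sup>+i. indicator (ball (fst i) (5 * snd i)) x \<partial>count_space C) \<partial>lebesgue)"
  proof (rule nn_integral_mono)
    fix x
    show "indicator ?S x \<le> (\<integral>\<^sup>+i. (indicator (ball (fst i) (5 * snd i)) x :: ennreal) \<partial>count_space C)"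
    proof (cases "x \<in> ?S")
      case True
      then obtain i where i: "i \<in> C" "x \<in> ball (fst i) (5 * snd i)" using C(4) by blast
      have "(1::ennreal) = indicator (ball (fst i) (5 * snd i)) x" using i by simp
      also have "\<dots> \<le> (\<integral>\<^sup>+i. indicator (ball (fst i) (5 * snd i)) x \<partial>count_space C)"
        by (rule nn_integral_ge_point) (rule i)
      finally show ?thesis using True by simp
    qed simp
  qed
  also have "\<dots> = (\<integral>\<^sup>+i. (\<integral>\<^sup>+x. indicator (ball (fst i) (5 * snd i)) x \<partial>lebesgue) \<partial>count_space C)"
    by (rule nn_integral_count_space_nn_integral)
      (use C in \<open>auto intro!: measurable_completion borel_measurable_indicator\<close>)
  finally have "ennreal t * emeasure lebesgue ?S \<le>
     ennreal t * (\<integral>\<^sup>+i. (\<integral>\<^sup>+x. indicator (ball (fst i) (5 * snd i)) x \<partial>lebesgue) \<partial>count_space C)"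
    by (rule mult_left_mono) simp
  also have "\<dots> = (\<integral>\<^sup>+i. ennreal t * (\<integral>\<^sup>+x. indicator (ball (fst i) (5 * snd i)) x \<partial>lebesgue) \<partial>count_space C)"
    by (rule nn_integral_cmult[symmetric]) simp
  also have "\<dots> \<le> (\<integral>\<^sup>+i. 5 ^ CARD('n) * (\<integral>\<^sup>+y\<in>?B i. ennreal (h y) \<partial>lebesgue) \<partial>count_space C)"
  proof (rule nn_integral_mono)
    fix i assume "i \<in> space (count_space C)"
    then have i: "0 < snd i" "ennreal t * ennreal (?v (snd i)) < (\<integral>\<^sup>+y\<in>?B i. ennreal (h y) \<partial>lebesgue)"
      using C(2) by (auto simp: K_def)
    have "(\<integral>\<^sup>+x. indicator (ball (fst i) (5 * snd i)) x \<partial>lebesgue) = ennreal (?v (5 * snd i))"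
      using i by (subst nn_integral_indicator) (auto simp: emeasure_lebesgue_ball simp del: emeasure_completion)
    also have "\<dots> = 5 ^ CARD('n) * ennreal (?v (snd i))"
      using i by (simp add: vball_mult ennreal_mult less_imp_le ennreal_power[symmetric])
    finally show "ennreal t * (\<integral>\<^sup>+x. indicator (ball (fst i) (5 * snd i)) x \<partial>lebesgue)
       \<le> 5 ^ CARD('n) * (\<integral>\<^sup>+y\<in>?B i. ennreal (h y) \<partial>lebesgue)"
      using mult_left_mono[OF less_imp_le[OF i(2)], of "5 ^ CARD('n)"] by (simp add: mult_ac)
  qed
  also have "\<dots> = 5 ^ CARD('n) * (\<integral>\<^sup>+i. (\<integral>\<^sup>+y. ennreal (h y) * indicator (?B i) y \<partial>lebesgue) \<partial>count_space C)"
    by (rule nn_integral_cmult) simp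
  also have "(\<integral>\<^sup>+i. (\<integral>\<^sup>+y. ennreal (h y) * indicator (?B i) y \<partial>lebesgue) \<partial>count_space C)
     = (\<integral>\<^sup>+y. (\<integral>\<^sup>+i. ennreal (h y) * indicator (?B i) y \<partial>count_space C) \<partial>lebesgue)"
    by (rule nn_integral_count_space_nn_integral[symmetric]) (use C in \<open>auto intro!: measurable_completion borel_measurable_times_ennreal
       borel_measurable_indicator measurable_compose[OF h measurable_ennreal]\<close>)
  also have "\<dots> \<le> (\<integral>\<^sup>+y. ennreal (h y) \<partial>lebesgue)"
  proof (rule nn_integral_mono)
    fix y :: "real^'n"
    show "(\<integral>\<^sup>+i. ennreal (h y) * indicator (?B i) y \<partial>count_space C) \<le> ennreal (h y)"
    proof (cases "\<exists>i\<in>C. y \<in> ?B i")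
      case True
      then obtain j where j: "j \<in> C" "y \<in> ?B j" by blast
      have "(\<integral>\<^sup>+i. ennreal (h y) * indicator (?B i) y \<partial>count_space C)
          = (\<integral>\<^sup>+i. ennreal (h y) * indicator {j} i \<partial>count_space C)"
      proof (rule nn_integral_cong)
        fix i assume "i \<in> space (count_space C)"
        then have iC: "i \<in> C" by simp
        have "i = j" if "y \<in> ?B i"
        proof (rule ccontr)
          assume "i \<noteq> j"
          from pairwiseD[OF C(3) iC j(1) this] have "?B i \<inter> ?B j = {}" by (simp only: disjnt_def)
          then show False using that j(2) by blast
        qed
        then have "y \<in> ?B i \<longleftrightarrow> i = j" using j(2) by blast
        then show "ennreal (h y) * indicator (?B i) y = ennreal (h y) * indicator {j} i"
          by (simp only: indicator_def singleton_iff)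
      qed
      also have "\<dots> = ennreal (h y)" using j by (simp add: nn_integral_cmult)
      finally show ?thesis by simp
    next
      case False
      then have "(\<integral>\<^sup>+i. ennreal (h y) * indicator (?B i) y \<partial>count_space C) = (\<integral>\<^sup>+i. 0 \<partial>count_space C)"
        by (intro nn_integral_cong) (auto simp: indicator_def)
      then show ?thesis by simp
    qed
  qed
  finally show ?thesis by (simp add: mult_left_mono)
qed

lemma hl_max_add_le:
  fixes h g :: "real^'n \<Rightarrow> real"
  assumes "\<And>y. h y \<le> g y + a" "0 \<le> a" "\<And>y. 0 \<le> g y" and g: "g \<in> borel_measurable borel"
  shows "hl_max h x \<le> hl_max g x + ennreal a"
  unfolding hl_max_def[of h]
proof (rule SUP_least, clarsimp)
  fix c r assume r: "0 < r" "dist c x < r"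
  let ?v = "vball TYPE(real^'n) r"
  have "(\<integral>\<^sup>+y\<in>ball c r. ennreal (h y) \<partial>lebesgue) \<le> (\<integral>\<^sup>+y. ennreal (g y) * indicator (ball c r) y + ennreal a * indicator (ball c r) y \<partial>lebesgue)"
    using assms by (intro nn_integral_mono) (auto simp: indicator_def ennreal_plus[symmetric] simp del: ennreal_plus intro!: ennreal_leI)
  also have "\<dots> = (\<integral>\<^sup>+y\<in>ball c r. ennreal (g y) \<partial>lebesgue) + ennreal a * ennreal ?v"
    using assms r
    by (subst nn_integral_add) (auto simp: nn_integral_cmult_indicator emeasure_lebesgue_ball
        simp del: emeasure_completion intro!: measurable_completion borel_measurable_times_ennreal
        borel_measurable_indicator measurable_compose[OF g measurable_ennreal])
  also have "\<dots> \<le> hl_max g x * ennreal ?v + ennreal a * ennreal ?v"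
    using r by (intro add_right_mono integral_ball_le_hl_max) auto
  also have "\<dots> = ennreal ?v * (hl_max g x + ennreal a)" by (simp add: algebra_simps)
  finally show "(\<integral>\<^sup>+y\<in>ball c r. ennreal (h y) \<partial>lebesgue) / ennreal ?v \<le> hl_max g x + ennreal a"
    using r by (intro divide_le_posI_ennreal) auto
qed

text \<open>Marcinkiewicz truncation: discarding the values of \<open>h\<close> up to t/2 lowers the
  maximal function by at most t/2, so the weak bound at level t/2 only sees the set where 2 h > t.
  The factor 2 compensates for the halved level.\<close>

lemma hl_max_level:
  fixes h :: "real^'n \<Rightarrow> real"
  assumes h[measurable]: "h \<in> borel_measurable borel" and "0 < t" "\<And>y. 0 \<le> h y"
  shows "ennreal t * emeasure lborel {x. ennreal t < hl_max h x}
    \<le> 2 * 5 ^ CARD('n) * (\<integral>\<^sup>+y. ennreal (h y) * indicator {..<2 * h y} t \<partial>lborel)"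
proof -
  define h1 where "h1 y = h y * indicator {y. t < 2 * h y} y" for y
  have m[measurable]: "h1 \<in> borel_measurable borel" unfolding h1_def by measurable
  have "{x. ennreal t < hl_max h x} \<subseteq> {x. ennreal (t / 2) < hl_max h1 x}"
  proof clarify
    fix x assume "ennreal t < hl_max h x"
    also have "hl_max h x \<le> hl_max h1 x + ennreal (t / 2)"
      using assms by (intro hl_max_add_le) (auto simp: h1_def indicator_def)
    finally have "ennreal (t / 2) + ennreal (t / 2) < hl_max h1 x + ennreal (t / 2)"
      using assms by (simp add: ennreal_plus[symmetric] del: ennreal_plus)
    then show "ennreal (t / 2) < hl_max h1 x"
      by (meson add_right_mono not_le)
  qed
  then have "ennreal (t / 2) * emeasure lebesgue {x. ennreal t < hl_max h x}
       \<le> ennreal (t / 2) * emeasure lebesgue {x. ennreal (t / 2) < hl_max h1 x}"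
    using borel_open[OF open_hl_max] by (intro mult_left_mono emeasure_mono) auto
  also have "\<dots> \<le> 5 ^ CARD('n) * (\<integral>\<^sup>+y. ennreal (h1 y) \<partial>lebesgue)"
    using assms by (intro hl_max_weak m) auto
  also have "(\<integral>\<^sup>+y. ennreal (h1 y) \<partial>lebesgue) = (\<integral>\<^sup>+y. ennreal (h y) * indicator {..<2 * h y} t \<partial>lborel)"
    unfolding nn_integral_completion
    using assms by (intro nn_integral_cong) (auto simp: h1_def indicator_def)
  finally have *: "ennreal (t / 2) * emeasure lebesgue {x. ennreal t < hl_max h x} \<le>
     5 ^ CARD('n) * (\<integral>\<^sup>+y. ennreal (h y) * indicator {..<2 * h y} t \<partial>lborel)" .
  have "ennreal t = 2 * ennreal (t / 2)"
    using ennreal_mult[of 2 "t / 2"] assms by simp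
  then have "ennreal t * emeasure lborel {x. ennreal t < hl_max h x}
     = 2 * (ennreal (t / 2) * emeasure lebesgue {x. ennreal t < hl_max h x})"
    using borel_open[OF open_hl_max] by (simp add: mult.assoc)
  also have "\<dots> \<le> 2 * (5 ^ CARD('n) * (\<integral>\<^sup>+y. ennreal (h y) * indicator {..<2 * h y} t \<partial>lborel))"
    by (intro mult_left_mono *) simp
  finally show ?thesis by (simp add: mult.assoc)
qed

lemma nn_integral_powr_0:
  assumes "-1 < a" "0 \<le> b"
  shows "(\<integral>\<^sup>+t\<in>{0..b}. ennreal (t powr a) \<partial>lborel) = ennreal (b powr (a + 1) / (a + 1))"
  using nn_integral_has_integral_lebesgue'[OF _ has_integral_powr_from_0[OF assms]] by simp

text \<open>The integral of r t^(r-1) up to any finite height b below \<open>a\<close> equals b^r.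
  For infinite \<open>a\<close> these lower bounds are unbounded, which forces the right-hand side
  to be infinite.\<close>

lemma epowr_layer_cake:
  assumes "0 < r"
  shows "epowr a r \<le> (\<integral>\<^sup>+t\<in>{0<..}. ennreal (r * t powr (r - 1)) * indicator {t. ennreal t < a} t \<partial>lborel)"
    (is "_ \<le> ?L")
proof -
  have *: "ennreal (b powr r) \<le> ?L" if "0 \<le> b" "ennreal b \<le> a" for b
  proof -
    have "ennreal (b powr r) = ennreal r * (\<integral>\<^sup>+t\<in>{0..b}. ennreal (t powr (r - 1)) \<partial>lborel)"
      using assms that by (simp add: nn_integral_powr_0 ennreal_mult[symmetric])
    also have "\<dots> = (\<integral>\<^sup>+t. ennreal r * (ennreal (t powr (r - 1)) * indicator {0..b} t) \<partial>lborel)"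
      by (rule nn_integral_cmult[symmetric]) simp
    also have "\<dots> \<le> ?L"
    proof (rule nn_integral_mono_AE)
      have ae: "AE t in lborel. t \<noteq> (0::real) \<and> t \<noteq> b"
        by (intro AE_conjI AE_lborel_singleton)
      show "AE t in lborel. ennreal r * (ennreal (t powr (r - 1)) * indicator {0..b} t) \<le>
          ennreal (r * t powr (r - 1)) * indicator {t. ennreal t < a} t * indicator {0<..} t"
        using ae
      proof eventually_elim
        case (elim t)
        show ?case
        proof (cases "t \<in> {0..b}")
          case True
          then have "ennreal t < ennreal b" using elim by (simp add: ennreal_less_iff)
          then have "ennreal t < a" using that by simp
          then show ?thesis using True elim assms by (simp add: ennreal_mult)
        qed simp
      qed
    qed
    finally show ?thesis .
  qed
  show ?thesis
  proof (cases a)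
    case (real b)
    then show ?thesis using *[of b] by (simp add: epowr_def)
  next
    case top
    have N: "ennreal N \<le> ?L" if "0 \<le> N" for N
      using *[of "N powr (1 / r)"] that assms top by (simp add: powr_powr)
    have "?L = \<infinity>"
    proof (cases ?L)
      case (real b)
      with N[of "b + 1"] have "ennreal (b + 1) \<le> ennreal b" by (simp only: add_nonneg_nonneg zero_le_one)
      with real(1) have False by (simp add: ennreal_le_iff)
      then show ?thesis ..
    qed (simp only: infinity_ennreal_def)
    then show ?thesis by (simp only: top_greatest infinity_ennreal_def)
  qed
qed

text \<open>Layer cake, the truncated weak bound and Fubini leave the integral of t^(r-2) over (0, 2
  h). It converges at 0 because r > 1 and equals (2 h)^(r-1) / (r - 1), which is the origin of the
  constant.\<close>

theorem hl_max_strong: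
  fixes h :: "real^'n \<Rightarrow> real"
  assumes h[measurable]: "h \<in> borel_measurable borel" and h0: "\<And>y. 0 \<le> h y" and "1 < r"
  shows "(\<integral>\<^sup>+x. epowr (hl_max h x) r \<partial>lebesgue) \<le>
    ennreal (2 * 5 ^ CARD('n) * r * 2 powr (r - 1) / (r - 1)) * (\<integral>\<^sup>+x. ennreal (h x powr r) \<partial>lebesgue)"
proof -
  have r: "0 < r" using assms by simp
  have [measurable]: "{x. ennreal (snd x) < hl_max h (fst x)} \<in> sets (borel \<Otimes>\<^sub>M borel)" 
    using borel_measurable_less[of "\<lambda>x. ennreal (snd x)" "borel \<Otimes>\<^sub>M borel" "\<lambda>x. hl_max h (fst x)"]
    by (simp add: space_pair_measure)
  have [measurable]: "Measurable.pred (borel \<Otimes>\<^sub>M borel) (\<lambda>x :: (real^'n) \<times> real. snd x \<in> {0<..<2 * h (fst x)})"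
    unfolding greaterThanLessThan_iff by measurable
  have "(\<integral>\<^sup>+x. epowr (hl_max h x) r \<partial>lebesgue) \<le>
     (\<integral>\<^sup>+x. (\<integral>\<^sup>+t. ennreal (r * t powr (r - 1)) * indicator {t. ennreal t < hl_max h x} t * indicator {0<..} t \<partial>lborel) \<partial>lborel)"
    unfolding nn_integral_completion by (intro nn_integral_mono epowr_layer_cake r)
  also have "\<dots> = (\<integral>\<^sup>+x. (\<integral>\<^sup>+t. ennreal (r * t powr (r - 1)) * indicator {x. ennreal (snd x) < hl_max h (fst x)} (x, t) * indicator {0<..} t \<partial>lborel) \<partial>lborel)"
    by (simp add: indicator_def)
  also have "\<dots> = (\<integral>\<^sup>+t. (\<integral>\<^sup>+x. ennreal (r * t powr (r - 1)) * indicator {x. ennreal (snd x) < hl_max h (fst x)} (x, t) * indicator {0<..} t \<partial>lborel) \<partial>lborel)"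
    by (rule lborel_pair.Fubini'[symmetric]) measurable
  also have "\<dots> \<le> (\<integral>\<^sup>+t. (\<integral>\<^sup>+y. ennreal (2 * 5 ^ CARD('n) * r) * (ennreal (h y) * (ennreal (t powr (r - 2)) * indicator {0<..<2 * h y} t)) \<partial>lborel) \<partial>lborel)"
  proof (rule nn_integral_mono)
    fix t :: real
    show "(\<integral>\<^sup>+x. ennreal (r * t powr (r - 1)) * indicator {x. ennreal (snd x) < hl_max h (fst x)} (x, t) * indicator {0<..} t \<partial>lborel)
       \<le> (\<integral>\<^sup>+y. ennreal (2 * 5 ^ CARD('n) * r) * (ennreal (h y) * (ennreal (t powr (r - 2)) * indicator {0<..<2 * h y} t)) \<partial>lborel)"
    proof (cases "0 < t")
      case True
      have "(\<integral>\<^sup>+x. ennreal (r * t powr (r - 1)) * indicator {x. ennreal (snd x) < hl_max h (fst x)} (x, t) * indicator {0<..} t \<partial>lborel)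
         = (\<integral>\<^sup>+x. ennreal (r * t powr (r - 1)) * indicator {x. ennreal t < hl_max h x} x \<partial>lborel)"
        using True by (intro nn_integral_cong) (simp add: indicator_def)
      also have "\<dots> = ennreal (r * t powr (r - 1)) * emeasure lborel {x. ennreal t < hl_max h x}"
        using borel_open[OF open_hl_max] by (intro nn_integral_cmult_indicator) auto
      also have "\<dots> = ennreal (r * t powr (r - 2)) * ennreal t * emeasure lborel {x. ennreal t < hl_max h x}"
      proof -
        have "t powr (r - 1) = t powr (r - 2) * t" using True powr_add[of t "r - 2" 1] by simp
        then show ?thesis using r True by (simp add: ennreal_mult[symmetric] mult.assoc)
      qed
      also have "ennreal (r * t powr (r - 2)) * ennreal t * emeasure lborel {x. ennreal t < hl_max h x}
         \<le> ennreal (r * t powr (r - 2)) * (2 * 5 ^ CARD('n) * (\<integral>\<^sup>+y. ennreal (h y) * indicator {..<2 * h y} t \<partial>lborel))"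
        unfolding mult.assoc[of "ennreal (r * t powr (r - 2))"] using True by (intro mult_left_mono hl_max_level h h0) auto
      also have "\<dots> = (ennreal (r * t powr (r - 2)) * (2 * 5 ^ CARD('n))) * (\<integral>\<^sup>+y. ennreal (h y) * indicator {..<2 * h y} t \<partial>lborel)"
        by (simp add: mult.assoc)
      also have "\<dots> = (\<integral>\<^sup>+y. (ennreal (r * t powr (r - 2)) * (2 * 5 ^ CARD('n))) * (ennreal (h y) * indicator {..<2 * h y} t) \<partial>lborel)"
      proof (rule nn_integral_cmult[symmetric])
        have "indicator {..<2 * h y} t = (indicator {y. t < 2 * h y} y :: ennreal)" for y
          by (simp add: indicator_def)
        then show "(\<lambda>y. ennreal (h y) * indicator {..<2 * h y} t) \<in> borel_measurable lborel" by simp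
      qed
      also have "\<dots> = (\<integral>\<^sup>+y. ennreal (2 * 5 ^ CARD('n) * r) * (ennreal (h y) * (ennreal (t powr (r - 2)) * indicator {0<..<2 * h y} t)) \<partial>lborel)"
      proof (rule nn_integral_cong)
        fix y
        have "ennreal (r * t powr (r - 2)) * (2 * 5 ^ CARD('n)) = ennreal (2 * 5 ^ CARD('n) * r) * ennreal (t powr (r - 2))"
          using r by (simp add: ennreal_mult ennreal_power[symmetric] mult_ac)
        then show "(ennreal (r * t powr (r - 2)) * (2 * 5 ^ CARD('n))) * (ennreal (h y) * indicator {..<2 * h y} t)
          = ennreal (2 * 5 ^ CARD('n) * r) * (ennreal (h y) * (ennreal (t powr (r - 2)) * indicator {0<..<2 * h y} t))"
          using True by (simp add: indicator_def mult_ac)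
      qed
      finally show ?thesis .
    qed simp
  qed
  also have "\<dots> = (\<integral>\<^sup>+y. (\<integral>\<^sup>+t. ennreal (2 * 5 ^ CARD('n) * r) * (ennreal (h y) * (ennreal (t powr (r - 2)) * indicator {0<..<2 * h y} t)) \<partial>lborel) \<partial>lborel)"
    by (rule lborel_pair.Fubini') measurable
  also have "\<dots> \<le> (\<integral>\<^sup>+y. ennreal (2 * 5 ^ CARD('n) * r * 2 powr (r - 1) / (r - 1)) * ennreal (h y powr r) \<partial>lborel)"
  proof (rule nn_integral_mono)
    fix y
    have "(\<integral>\<^sup>+t. ennreal (2 * 5 ^ CARD('n) * r) * (ennreal (h y) * (ennreal (t powr (r - 2)) * indicator {0<..<2 * h y} t)) \<partial>lborel)
      = ennreal (2 * 5 ^ CARD('n) * r) * (ennreal (h y) * (\<integral>\<^sup>+t. (ennreal (t powr (r - 2)) * indicator {0<..<2 * h y} t) \<partial>lborel))"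
      by (simp add: nn_integral_cmult)
    also have "\<dots> \<le> ennreal (2 * 5 ^ CARD('n) * r) * (ennreal (h y) * (\<integral>\<^sup>+t\<in>{0..2 * h y}. ennreal (t powr (r - 2)) \<partial>lborel))"
      by (intro mult_left_mono nn_integral_mono) (auto simp: indicator_def)
    also have "\<dots> = ennreal (2 * 5 ^ CARD('n) * r) * (ennreal (h y) * ennreal ((2 * h y) powr (r - 1) / (r - 1)))"
      using assms by (subst nn_integral_powr_0) (auto simp: algebra_simps)
    also have "\<dots> = ennreal (2 * 5 ^ CARD('n) * r * (h y * ((2 * h y) powr (r - 1) / (r - 1))))"
      using assms by (simp add: ennreal_mult[symmetric])
    also have "2 * 5 ^ CARD('n) * r * (h y * ((2 * h y) powr (r - 1) / (r - 1))) = 2 * 5 ^ CARD('n) * r * 2 powr (r - 1) / (r - 1) * h y powr r"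
    proof (cases "h y = 0")
      case False
      then have "h y powr r = h y * h y powr (r - 1)" using h0[of y] powr_add[of "h y" 1 "r - 1"] by simp
      then show ?thesis by (simp add: powr_mult)
    qed simp
    finally show "(\<integral>\<^sup>+t. ennreal (2 * 5 ^ CARD('n) * r) * (ennreal (h y) * (ennreal (t powr (r - 2)) * indicator {0<..<2 * h y} t)) \<partial>lborel)
      \<le> ennreal (2 * 5 ^ CARD('n) * r * 2 powr (r - 1) / (r - 1)) * ennreal (h y powr r)"
      by (subst ennreal_mult''[symmetric]) simp_all
  qed
  also have "\<dots> = ennreal (2 * 5 ^ CARD('n) * r * 2 powr (r - 1) / (r - 1)) * (\<integral>\<^sup>+y. ennreal (h y powr r) \<partial>lborel)"
    by (rule nn_integral_cmult) measurable
  finally show ?thesis by (simp only: nn_integral_completion)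
qed

section \<open>A Poincare inequality below the exponent one\<close>

lemma nn_integral_ball_add_const:
  fixes u :: "real^'n \<Rightarrow> ennreal"
  assumes [measurable]: "u \<in> borel_measurable lebesgue" and "0 \<le> r"
  shows "(\<integral>\<^sup>+y. u y * indicator (ball c r) y + b * indicator (ball c r) y \<partial>lebesgue)
    = (\<integral>\<^sup>+y\<in>ball c r. u y \<partial>lebesgue) + b * ennreal (vball TYPE(real^'n) r)"
proof -
  have [measurable]: "ball c r \<in> sets lebesgue" by simp
  have "(\<integral>\<^sup>+y. u y * indicator (ball c r) y + b * indicator (ball c r) y \<partial>lebesgue)
    = (\<integral>\<^sup>+y\<in>ball c r. u y \<partial>lebesgue) + (\<integral>\<^sup>+y. b * indicator (ball c r) y \<partial>lebesgue)"
    by (rule nn_integral_add) measurable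
  also have "(\<integral>\<^sup>+y. b * indicator (ball c r) y \<partial>lebesgue) = b * emeasure lebesgue (ball c r)"
    by (rule nn_integral_cmult_indicator) simp
  finally show ?thesis using assms(2) by (simp only: emeasure_lebesgue_ball)
qed

text \<open>The term of the first dyadic ball containing y dominates. If its index j is positive,
  then |x - y| \<ge> 2^(j-1) t; the shift from j to j - 1 accounts for the factor 2^m.\<close>

lemma kernel_le_sum:
  assumes "0 < t" "0 < m"
  shows "ennreal ((1 + norm (x - y) / t) powr (- m)) \<le>
     (\<Sum>j. ennreal (2 powr m * (2 powr (- m)) ^ j) * indicator (ball x (2 ^ j * t)) (y::real^'n))"
proof -
  define F where "F j = ennreal (2 powr m * (2 powr (- m)) ^ j) * indicator (ball x (2 ^ j * t)) y" for j
  obtain k0 :: nat where "norm (x - y) / t < 2 ^ k0" using real_arch_pow[of 2] by auto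
  then have ex: "norm (x - y) < 2 ^ k0 * t" using assms by (simp add: field_simps)
  define j where "j = (LEAST j. norm (x - y) < 2 ^ j * t)"
  have j: "norm (x - y) < 2 ^ j * t" unfolding j_def by (rule LeastI[of _ k0]) (rule ex)
  have p: "(2 powr (- m)) ^ i = 2 powr (- m * real i)" for i
    by (subst powr_power) (auto simp: mult.commute)
  have "(1 + norm (x - y) / t) powr (- m) \<le> 2 powr m * (2 powr (- m)) ^ j"
  proof (cases j)
    case 0
    have "(1 + norm (x - y) / t) powr (- m) \<le> 1 powr (- m)"
      using assms by (intro powr_mono2') auto
    also have "\<dots> \<le> 2 powr m" using assms by (simp add: ge_one_powr_ge_zero)
    finally show ?thesis using 0 by simp
  next
    case (Suc i)
    then have "\<not> norm (x - y) < 2 ^ i * t" using not_less_Least[of i "\<lambda>j. norm (x - y) < 2 ^ j * t"] by (auto simp: j_def)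
    then have "2 ^ i \<le> norm (x - y) / t" using assms by (simp add: field_simps)
    then have "(1 + norm (x - y) / t) powr (- m) \<le> (2 ^ i) powr (- m)"
      using assms by (intro powr_mono2') auto
    also have "\<dots> = 2 powr (- m * real i)" by (simp add: powr_powr powr_realpow[symmetric] mult.commute)
    also have "\<dots> = 2 powr m * (2 powr (- m)) ^ j"
      using Suc by (simp add: p powr_add[symmetric] algebra_simps)
    finally show ?thesis .
  qed
  then have "ennreal ((1 + norm (x - y) / t) powr (- m)) \<le> F j"
    using j by (auto simp: dist_norm F_def intro!: ennreal_leI)
  also have "\<dots> \<le> (\<Sum>j. F j)"
    using sum_le_suminf[of F "{j}"] by simp
  finally show ?thesis by (simp only: F_def)
qed

text \<open>In the descent of \<open>poincare\<close>, 2^s comes from the diameter 2 R in the step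
  length, 2 from the two gradient values in the Hajlasz inequality, and 2^(2a) from writing the
  upper level as 2^(k+2) M.\<close>

definition poincare_const :: "real \<Rightarrow> real \<Rightarrow> real" where
  "poincare_const s a = 2 powr (s + 1 + 2 * a)"

text \<open>The factor 3 K is the cost of one ball in \<open>kernel_estimate\<close>, 2^m comes from
  \<open>kernel_le_sum\<close>, and the denominator is that of a geometric series with ratio 2^(n +
  s - m).\<close>

definition kernel_const :: "nat \<Rightarrow> real \<Rightarrow> real \<Rightarrow> real \<Rightarrow> real" where
  "kernel_const n s a m = 3 * poincare_const s a * 2 powr m * unit_ball_vol (real n) / (1 - 2 powr (real n + s - m))"

lemma kernel_const_pos:
  assumes "real n + s < m"
  shows "0 < kernel_const n s a m"
proof -
  have "2 powr (real n + s - m) < 1" using assms powr_less_cancel_iff[of 2 "real n + s - m" 0] by simp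
  then show ?thesis unfolding kernel_const_def poincare_const_def
    by (intro divide_pos_pos mult_pos_pos) (auto simp: unit_ball_vol_pos)
qed

text \<open>Here \<open>h\<close> plays the role of g^q for a gradient g, so that
  \<open>h powr a\<close> recovers g. Since \<open>h\<close> is a Borel function and the inequality
  holds only off the null set \<open>E\<close>, all chains of points have to be chosen outside
  \<open>E\<close>.\<close>

locale hajlasz_pair =
  fixes f :: "real^'n \<Rightarrow> complex" and h :: "real^'n \<Rightarrow> real" and E :: "(real^'n) set" and s a :: real
  assumes s: "0 < s" and a: "a = 1 + s / real CARD('n)"
    and E: "E \<in> null_sets lebesgue"
    and h: "h \<in> borel_measurable borel" and h0: "\<And>x. 0 \<le> h x"
    and holder: "\<And>x y. x \<notin> E \<Longrightarrow> y \<notin> E \<Longrightarrow>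
      norm (f x - f y) \<le> norm (x - y) powr s * (h x powr a + h y powr a)"
begin

lemma a_pos: "1 < a"
  using s by (simp add: a)

abbreviation K :: real where "K \<equiv> poincare_const s a"

lemma K_pos: "0 < K" by (simp add: poincare_const_def)

lemma holder_le:
  assumes "x \<notin> E" "y \<notin> E" "norm (x - y) \<le> r" "h x \<le> t" "h y \<le> t"
  shows "norm (f x - f y) \<le> r powr s * (2 * t powr a)"
proof -
  have "norm (f x - f y) \<le> norm (x - y) powr s * (h x powr a + h y powr a)"
    by (rule holder) fact+
  also have "\<dots> \<le> r powr s * (t powr a + t powr a)"
    using assms s a_pos h0 by (intro mult_mono add_mono powr_mono2) auto
  finally show ?thesis by simp
qed

text \<open>Chebyshev's inequality, by contradiction. The numerical hypothesis compares the total
  mass with the height \<open>t\<close> on a ball of half the permitted radius, because only such a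
  ball is sure to fit when x lies near the boundary of \<open>ball z R\<close>.\<close>

lemma exists_small:
  assumes "0 < r" "r \<le> 2 * R" "x \<in> ball z R"
    and "M * vball TYPE(real^'n) R < t * vball TYPE(real^'n) (r / 2)"
    and M: "(\<integral>\<^sup>+y\<in>ball z R. ennreal (h y) \<partial>lebesgue) \<le> ennreal (M * vball TYPE(real^'n) R)" and "0 < M" "0 < t"
  shows "\<exists>y\<in>ball z R - E. norm (x - y) < r \<and> h y \<le> t"
proof (rule ccontr)
  assume "\<not> ?thesis"
  then have *: "\<And>y. y \<in> ball z R \<Longrightarrow> y \<notin> E \<Longrightarrow> norm (x - y) < r \<Longrightarrow> t < h y" by force
  have R: "0 < R" using assms by linarith
  \<comment> \<open>Moving x towards z by the proportion r / (2 R) costs less than r/2 in distance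
    from x and frees a margin r/2 inside \<open>ball z R\<close>, so \<open>ball c (r / 2)\<close>
    lies in both balls.\<close>
  define c where "c = x - (r / (2 * R)) *\<^sub>R (x - z)"
  have xz: "norm (x - z) < R" using assms by (simp add: dist_norm norm_minus_commute)
  have sub: "y \<in> ball z R \<and> norm (x - y) < r" if "y \<in> ball c (r / 2)" for y
  proof
    have cy: "norm (c - y) < r / 2" using that by (simp add: dist_norm)
    have "norm (x - c) = r / (2 * R) * norm (x - z)" using assms R by (simp add: c_def)
    also have "\<dots> \<le> r / (2 * R) * R" using xz assms R by (intro mult_left_mono) auto
    finally have "norm (x - c) \<le> r / 2" using R by simp
    then show "norm (x - y) < r" using cy norm_triangle_ineq[of "x - c" "c - y"] by simp
    have "c - z = (1 - r / (2 * R)) *\<^sub>R (x - z)" by (simp add: c_def algebra_simps)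
    then have "norm (c - z) = (1 - r / (2 * R)) * norm (x - z)" using assms R by simp
    also have "\<dots> \<le> (1 - r / (2 * R)) * R" using xz assms R by (intro mult_left_mono) auto
    finally have "norm (c - z) \<le> R - r / 2" using R by (simp add: algebra_simps)
    then have "norm (y - z) < R" using cy norm_triangle_ineq[of "y - c" "c - z"] by (simp add: norm_minus_commute)
    then show "y \<in> ball z R" by (simp add: dist_norm norm_minus_commute)
  qed
  have "ennreal (t * vball TYPE(real^'n) (r / 2)) = ennreal t * emeasure lebesgue (ball c (r / 2))"
    using assms by (simp add: emeasure_lebesgue_ball ennreal_mult less_imp_le del: emeasure_completion)
  also have "\<dots> = (\<integral>\<^sup>+y. ennreal t * indicator (ball c (r / 2)) y \<partial>lebesgue)"
    by (rule nn_integral_cmult_indicator[symmetric]) simp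
  also have "\<dots> \<le> (\<integral>\<^sup>+y\<in>ball z R. ennreal (h y) \<partial>lebesgue)"
  proof (rule nn_integral_mono_AE)
    show "AE y in lebesgue. ennreal t * indicator (ball c (r / 2)) y \<le> ennreal (h y) * indicator (ball z R) y"
      using AE_not_in[OF E]
    proof eventually_elim
      case (elim y)
      show ?case
      proof (cases "y \<in> ball c (r / 2)")
        case True
        then show ?thesis using sub[OF True] *[of y] elim by (auto intro!: ennreal_leI)
      qed simp
    qed
  qed
  also have "\<dots> \<le> ennreal (M * vball TYPE(real^'n) R)" by (rule M)
  finally have "t * vball TYPE(real^'n) (r / 2) \<le> M * vball TYPE(real^'n) R"
    using assms R by (simp add: ennreal_le_iff less_imp_le)
  with assms(4) show False by simp
qed

text \<open>Induction over the levels 2^k (2 M) of \<open>h\<close>. The step from level k + 1 to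
  level k costs as much as the induction hypothesis allows for level k, so the bound merely doubles
  with the level. At the lowest level containing x it is therefore comparable to M + h x.\<close>

lemma poincare:
  assumes R: "0 < R" and M: "0 < M"
    and int: "(\<integral>\<^sup>+y\<in>ball z R. ennreal (h y) \<partial>lebesgue) \<le> ennreal (M * vball TYPE(real^'n) R)"
  obtains x0 where "x0 \<in> ball z R - E" "h x0 \<le> 2 * M"
    "\<And>x. x \<in> ball z R - E \<Longrightarrow> norm (f x - f x0) \<le> K * R powr s * M powr (a - 1) * (M + h x)"
proof -
  let ?n = "real CARD('n)"
  have vR: "0 < vball TYPE(real^'n) R" using R by simp
  obtain x0 where x0: "x0 \<in> ball z R - E" "h x0 \<le> 2 * M"
    using exists_small[of "2 * R" R z z M "2 * M"] R M int vR by auto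
  have step: "\<forall>x\<in>ball z R - E. h x \<le> 2 ^ k * (2 * M) \<longrightarrow> norm (f x - f x0) \<le> K * 2 ^ k * (R powr s * M powr a)" for k
  proof (induction k)
    case 0
    show ?case
    proof (intro ballI impI)
      fix x assume x: "x \<in> ball z R - E" "h x \<le> 2 ^ 0 * (2 * M)"
      have "norm (x - x0) \<le> 2 * R"
        using x x0 dist_triangle2[of x x0 z] by (simp add: dist_norm norm_minus_commute)
      then have "norm (f x - f x0) \<le> (2 * R) powr s * (2 * (2 * M) powr a)"
        using x x0 by (intro holder_le) auto
      also have "\<dots> = 2 powr (s + 1 + a) * (R powr s * M powr a)"
        by (simp add: powr_mult powr_add)
      also have "\<dots> \<le> K * (R powr s * M powr a)"
        unfolding poincare_const_def using a_pos by (intro mult_right_mono powr_mono) auto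
      finally show "norm (f x - f x0) \<le> K * 2 ^ 0 * (R powr s * M powr a)" by simp
    qed
  next
    case (Suc k)
    show ?case
    proof (intro ballI impI)
      fix x assume x: "x \<in> ball z R - E" "h x \<le> 2 ^ Suc k * (2 * M)"
      \<comment> \<open>Half of this radius gives 2^(-k) times the volume of
        \<open>ball z R\<close>. At height 2^k (2 M) Chebyshev then compares 2 M with M; the factor
        2 supplies the strict inequality.\<close>
      define r where "r = 2 * R * 2 powr (- real k / ?n)"
      have r: "0 < r" "r \<le> 2 * R" using R powr_mono[of "- real k / ?n" 0 2] by (auto simp: r_def)
      have "(2 powr (- real k / ?n)) ^ CARD('n) = 2 powr (- real k / ?n * ?n)"
        by (subst powr_power) (auto simp: mult.commute)
      also have "- real k / ?n * ?n = - real k" by simp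
      finally have "(2 powr (- real k / ?n)) ^ CARD('n) = 1 / 2 ^ k"
        by (simp add: powr_minus powr_realpow divide_inverse)
      then have v: "vball TYPE(real^'n) (r / 2) = vball TYPE(real^'n) R / 2 ^ k"
        using vball_mult[of "2 powr (- real k / ?n)" R, where 'n='n] by (simp add: r_def mult.commute)
      have "\<exists>y\<in>ball z R - E. norm (x - y) < r \<and> h y \<le> 2 ^ k * (2 * M)"
        using r x M vR int by (intro exists_small[where M=M]) (auto simp: v)
      then obtain y where y: "y \<in> ball z R - E" "norm (x - y) < r" "h y \<le> 2 ^ k * (2 * M)" by blast
      have "norm (f x - f y) \<le> r powr s * (2 * (2 ^ Suc k * (2 * M)) powr a)"
        using x y M by (intro holder_le) (auto intro: order_trans[OF y(3)])
      \<comment> \<open>With s/n = a - 1 the step length contributes 2^(-k(a-1)), which reduces the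
        gradient factor 2^(ka) to 2^k. This is the cancellation for which \<open>a\<close> is
        chosen.\<close>
      also have "r powr s = 2 powr s * R powr s * 2 powr (- real k * (a - 1))"
        using a by (simp add: r_def powr_mult powr_powr)
      also have "(2 ^ Suc k * (2 * M)) powr a = 2 powr ((real k + 2) * a) * M powr a"
      proof -
        have "2 ^ Suc k * (2 * M) = 2 powr (real k + 2) * M" by (simp add: powr_add powr_realpow)
        then show ?thesis by (simp only: powr_mult powr_powr)
      qed
      also have "2 powr s * R powr s * 2 powr (- real k * (a - 1)) * (2 * (2 powr ((real k + 2) * a) * M powr a))
        = 2 powr (s + 1 + (- real k * (a - 1)) + (real k + 2) * a) * (R powr s * M powr a)"
      proof -
        have "2 powr (s + 1 + X + Y) = 2 powr s * 2 * 2 powr X * 2 powr Y" for X Y :: real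
          unfolding powr_add by simp
        then show ?thesis by (simp only: mult_ac)
      qed
      also have "s + 1 + (- real k * (a - 1)) + (real k + 2) * a = (s + 1 + 2 * a) + real k"
        by (simp add: algebra_simps)
      also have "2 powr ((s + 1 + 2 * a) + real k) = K * 2 ^ k"
        unfolding powr_add[of 2 "s + 1 + 2 * a"] poincare_const_def by (simp add: powr_realpow)
      finally have 1: "norm (f x - f y) \<le> K * 2 ^ k * (R powr s * M powr a)" .
      have 2: "norm (f y - f x0) \<le> K * 2 ^ k * (R powr s * M powr a)"
        using Suc y by blast
      have "norm (f x - f x0) \<le> norm (f x - f y) + norm (f y - f x0)"
        using norm_triangle_ineq[of "f x - f y" "f y - f x0"] by simp
      with 1 2 show "norm (f x - f x0) \<le> K * 2 ^ Suc k * (R powr s * M powr a)" by simp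
    qed
  qed
  have Ma: "M powr a = M powr (a - 1) * M" using M powr_add[of M "a - 1" 1] by simp
  have bound: "norm (f x - f x0) \<le> K * R powr s * M powr (a - 1) * (M + h x)" if x: "x \<in> ball z R - E" for x
  proof -
    obtain k0 :: nat where "h x / (2 * M) < 2 ^ k0" using real_arch_pow[of 2] by auto
    then have ex: "h x \<le> 2 ^ k0 * (2 * M)" using M by (simp add: field_simps)
    define k where "k = (LEAST k. h x \<le> 2 ^ k * (2 * M))"
    have k: "h x \<le> 2 ^ k * (2 * M)" unfolding k_def by (rule LeastI[of _ k0]) (rule ex)
    have "2 ^ k * M \<le> M + h x"
    proof (cases k)
      case 0
      then show ?thesis using h0[of x] by simp
    next
      case (Suc j)
      then have "\<not> h x \<le> 2 ^ j * (2 * M)" using not_less_Least[of j "\<lambda>k. h x \<le> 2 ^ k * (2 * M)"] by (auto simp: k_def)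
      then show ?thesis using Suc M by simp
    qed
    then have "K * R powr s * M powr (a - 1) * (2 ^ k * M) \<le> K * R powr s * M powr (a - 1) * (M + h x)"
      using K_pos by (intro mult_left_mono) auto
    moreover have "norm (f x - f x0) \<le> K * 2 ^ k * (R powr s * M powr a)" using step k x by blast
    ultimately show ?thesis by (simp add: Ma mult_ac)
  qed
  show ?thesis by (rule that[OF x0(1,2)]) (rule bound)
qed

lemma poincare_integral:
  assumes R: "0 < R" and M: "0 < M"
    and int: "(\<integral>\<^sup>+y\<in>ball z R. ennreal (h y) \<partial>lebesgue) \<le> ennreal (M * vball TYPE(real^'n) R)"
  obtains x0 where "x0 \<in> ball z R - E" "h x0 \<le> 2 * M"
    "\<And>x. x \<in> ball z R - E \<Longrightarrow> norm (f x - f x0) \<le> K * R powr s * M powr (a - 1) * (M + h x)"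
    "(\<integral>\<^sup>+y\<in>ball z R. ennreal (norm (f y - f x0)) \<partial>lebesgue) \<le> ennreal (2 * K * R powr s * M powr a * vball TYPE(real^'n) R)"
proof -
  obtain x0 where x0: "x0 \<in> ball z R - E" "h x0 \<le> 2 * M"
    "\<And>x. x \<in> ball z R - E \<Longrightarrow> norm (f x - f x0) \<le> K * R powr s * M powr (a - 1) * (M + h x)"
    by (rule poincare[OF R M int]) (rule that, assumption+)
  let ?c = "K * R powr s * M powr (a - 1)"
  have c: "0 \<le> ?c" using K_pos by simp
  have [measurable]: "h \<in> borel_measurable lebesgue" by (rule measurable_completion) (simp add: h)
  have "(\<integral>\<^sup>+y\<in>ball z R. ennreal (norm (f y - f x0)) \<partial>lebesgue) \<le>
     (\<integral>\<^sup>+y. ennreal ?c * (ennreal M * indicator (ball z R) y + ennreal (h y) * indicator (ball z R) y) \<partial>lebesgue)"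
  proof (rule nn_integral_mono_AE)
    show "AE y in lebesgue. ennreal (norm (f y - f x0)) * indicator (ball z R) y \<le>
      ennreal ?c * (ennreal M * indicator (ball z R) y + ennreal (h y) * indicator (ball z R) y)"
      using AE_not_in[OF E]
    proof eventually_elim
      case (elim y)
      show ?case
      proof (cases "y \<in> ball z R")
        case True
        have "ennreal (norm (f y - f x0)) \<le> ennreal (?c * (M + h y))"
          using x0(3)[of y] True elim by (intro ennreal_leI) auto
        also have "\<dots> = ennreal ?c * (ennreal M + ennreal (h y))"
          using c M h0[of y] by (simp add: ennreal_mult ennreal_plus)
        finally show ?thesis using True by simp
      qed simp
    qed
  qed
  also have "\<dots> = ennreal ?c * (ennreal M * emeasure lebesgue (ball z R) + (\<integral>\<^sup>+y\<in>ball z R. ennreal (h y) \<partial>lebesgue))"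
  proof -
    have [measurable]: "ball z R \<in> sets lebesgue" by simp
    have "(\<integral>\<^sup>+y. ennreal M * indicator (ball z R) y + ennreal (h y) * indicator (ball z R) y \<partial>lebesgue)
       = ennreal M * emeasure lebesgue (ball z R) + (\<integral>\<^sup>+y\<in>ball z R. ennreal (h y) \<partial>lebesgue)"
      by (subst nn_integral_add) (auto simp: nn_integral_cmult_indicator simp del: emeasure_completion)
    moreover have "(\<integral>\<^sup>+y. ennreal ?c * (ennreal M * indicator (ball z R) y + ennreal (h y) * indicator (ball z R) y) \<partial>lebesgue)
       = ennreal ?c * (\<integral>\<^sup>+y. ennreal M * indicator (ball z R) y + ennreal (h y) * indicator (ball z R) y \<partial>lebesgue)"
      by (rule nn_integral_cmult) measurable
    ultimately show ?thesis by simp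
  qed
  also have "\<dots> \<le> ennreal ?c * (ennreal (M * vball TYPE(real^'n) R) + ennreal (M * vball TYPE(real^'n) R))"
    using R M by (intro mult_left_mono add_mono int)
       (auto simp: emeasure_lebesgue_ball ennreal_mult less_imp_le simp del: emeasure_completion)
  also have "\<dots> = ennreal (2 * K * R powr s * M powr a * vball TYPE(real^'n) R)"
  proof -
    have "M powr a = M powr (a - 1) * M" using M powr_add[of M "a - 1" 1] by simp
    moreover have "0 \<le> M * vball TYPE(real^'n) R" using M R by (simp add: less_imp_le)
    ultimately show ?thesis using c
      by (simp add: ennreal_mult[symmetric] ennreal_plus[symmetric] algebra_simps del: ennreal_plus)
  qed
  finally have bnd: "(\<integral>\<^sup>+y\<in>ball z R. ennreal (norm (f y - f x0)) \<partial>lebesgue)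
     \<le> ennreal (2 * K * R powr s * M powr a * vball TYPE(real^'n) R)" .
  show ?thesis by (rule that[OF x0(1,2) _ bnd]) (rule x0(3))
qed

text \<open>One anchor \<open>x0\<close> serves all scales. In each larger ball the anchor
  \<open>x1\<close> found there also satisfies h \<le> 2 M, so the Hajlasz inequality compares f x1
  with f x0 in a single step. This adds one K to the 2 K of
  \<open>poincare_integral\<close>.\<close>

lemma kernel_estimate:
  assumes f: "f \<in> borel_measurable lebesgue"
    and t: "0 < t" and M: "0 < M" and hl: "hl_max h x \<le> ennreal M" and m: "real CARD('n) + s < m"
  obtains x0 where "x0 \<in> ball x t - E" "h x0 \<le> 2 * M"
    "\<And>x'. x' \<in> ball x t - E \<Longrightarrow> norm (f x' - f x0) \<le> K * t powr s * M powr (a - 1) * (M + h x')"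
    "(\<integral>\<^sup>+y. ennreal (norm (f y - f x0) * (1 + norm (x - y) / t) powr (- m)) \<partial>lebesgue)
       \<le> ennreal (kernel_const CARD('n) s a m * t ^ CARD('n) * t powr s * M powr a)"
proof -
  let ?v = "vball TYPE(real^'n)" and ?n = "CARD('n)"
  have int: "(\<integral>\<^sup>+y\<in>ball x r. ennreal (h y) \<partial>lebesgue) \<le> ennreal (M * ?v r)" if "0 < r" for r
  proof -
    have "(\<integral>\<^sup>+y\<in>ball x r. ennreal (h y) \<partial>lebesgue) \<le> hl_max h x * ennreal (?v r)"
      using that by (intro integral_ball_le_hl_max) auto
    also have "\<dots> \<le> ennreal M * ennreal (?v r)" by (intro mult_right_mono hl) auto
    finally show ?thesis using M that by (simp add: ennreal_mult less_imp_le)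
  qed
  obtain x0 where x0: "x0 \<in> ball x t - E" "h x0 \<le> 2 * M"
    "\<And>x'. x' \<in> ball x t - E \<Longrightarrow> norm (f x' - f x0) \<le> K * t powr s * M powr (a - 1) * (M + h x')"
    by (rule poincare[OF t M int[OF t]]) (rule that, assumption+)
  have ball: "(\<integral>\<^sup>+y\<in>ball x R. ennreal (norm (f y - f x0)) \<partial>lebesgue)
      \<le> ennreal (3 * K * R powr s * M powr a * ?v R)" if tR: "t \<le> R" for R
  proof -
    have R: "0 < R" using t tR by linarith
    obtain x1 where x1: "x1 \<in> ball x R - E" "h x1 \<le> 2 * M"
      "(\<integral>\<^sup>+y\<in>ball x R. ennreal (norm (f y - f x1)) \<partial>lebesgue) \<le> ennreal (2 * K * R powr s * M powr a * ?v R)"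
      by (rule poincare_integral[OF R M int[OF R]]) (rule that, assumption+)
    have "norm (x1 - x0) \<le> 2 * R"
      using x1 x0 tR dist_triangle2[of x1 x0 x] by (simp add: dist_norm norm_minus_commute)
    then have "norm (f x1 - f x0) \<le> (2 * R) powr s * (2 * (2 * M) powr a)"
      using x1 x0 by (intro holder_le) auto
    also have "\<dots> = 2 powr (s + 1 + a) * (R powr s * M powr a)"
      by (simp add: powr_mult powr_add)
    also have "\<dots> \<le> K * (R powr s * M powr a)"
      unfolding poincare_const_def using a_pos by (intro mult_right_mono powr_mono) auto
    finally have d: "norm (f x1 - f x0) \<le> K * R powr s * M powr a" by (simp add: mult_ac)
    have "(\<integral>\<^sup>+y\<in>ball x R. ennreal (norm (f y - f x0)) \<partial>lebesgue) \<le>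
       (\<integral>\<^sup>+y. ennreal (norm (f y - f x1)) * indicator (ball x R) y + ennreal (K * R powr s * M powr a) * indicator (ball x R) y \<partial>lebesgue)"
    proof (rule nn_integral_mono)
      fix y
      have "norm (f y - f x0) \<le> norm (f y - f x1) + K * R powr s * M powr a"
        using norm_triangle_ineq[of "f y - f x1" "f x1 - f x0"] d by simp
      then show "ennreal (norm (f y - f x0)) * indicator (ball x R) y \<le>
        ennreal (norm (f y - f x1)) * indicator (ball x R) y + ennreal (K * R powr s * M powr a) * indicator (ball x R) y"
        using K_pos by (auto simp: indicator_def ennreal_plus[symmetric] simp del: ennreal_plus intro!: ennreal_leI)
    qed
    also have "\<dots> = (\<integral>\<^sup>+y\<in>ball x R. ennreal (norm (f y - f x1)) \<partial>lebesgue) + ennreal (K * R powr s * M powr a) * ennreal (?v R)"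
      by (rule nn_integral_ball_add_const) (use f R in auto)
    also have "\<dots> \<le> ennreal (2 * K * R powr s * M powr a * ?v R) + ennreal (K * R powr s * M powr a) * ennreal (?v R)"
      by (intro add_right_mono x1)
    also have "\<dots> = ennreal (3 * K * R powr s * M powr a * ?v R)"
    proof -
      have e: "ennreal (2 * X) + ennreal X = ennreal (3 * X)" if "0 \<le> X" for X
        using that by (simp add: ennreal_plus[symmetric] del: ennreal_plus)
      have "0 \<le> K * R powr s * M powr a" "0 \<le> ?v R" using K_pos R by (auto simp: less_imp_le)
      from e[OF mult_nonneg_nonneg[OF this]] this(2) show ?thesis
        by (simp add: ennreal_mult''[symmetric] mult.assoc)
    qed
    finally show ?thesis .
  qed
  \<comment> \<open>The ball of radius 2^j t brings 2^(jn) from its volume, 2^(js) from the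
    oscillation of f and 2^(-jm) from the kernel.\<close>
  let ?q = "2 powr (real ?n + s - m)"
  have q: "0 \<le> ?q" "?q < 1" using m powr_less_cancel_iff[of 2 "real CARD('n) + s - m" 0] by auto
  let ?c = "3 * K * 2 powr m * ?v t * t powr s * M powr a"
  have c: "0 \<le> ?c" using K_pos t by (simp add: less_imp_le)
  have m0: "0 < m" using m s of_nat_0_le_iff[of "CARD('n)", where 'a=real] by linarith
  have "(\<integral>\<^sup>+y. ennreal (norm (f y - f x0) * (1 + norm (x - y) / t) powr (- m)) \<partial>lebesgue)
     \<le> (\<integral>\<^sup>+y. (\<Sum>j. ennreal (2 powr m * (2 powr (- m)) ^ j) * (ennreal (norm (f y - f x0)) * indicator (ball x (2 ^ j * t)) y)) \<partial>lebesgue)"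
  proof (rule nn_integral_mono)
    fix y
    have "ennreal (norm (f y - f x0) * (1 + norm (x - y) / t) powr (- m)) = ennreal (norm (f y - f x0)) * ennreal ((1 + norm (x - y) / t) powr (- m))"
      by (simp add: ennreal_mult)
    also have "\<dots> \<le> ennreal (norm (f y - f x0)) * (\<Sum>j. ennreal (2 powr m * (2 powr (- m)) ^ j) * indicator (ball x (2 ^ j * t)) y)"
      by (intro mult_left_mono kernel_le_sum t m0) simp
    also have "\<dots> = (\<Sum>j. ennreal (2 powr m * (2 powr (- m)) ^ j) * (ennreal (norm (f y - f x0)) * indicator (ball x (2 ^ j * t)) y))"
      by (subst ennreal_suminf_cmult[symmetric]) (simp add: mult_ac)
    finally show "ennreal (norm (f y - f x0) * (1 + norm (x - y) / t) powr (- m)) \<le>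
      (\<Sum>j. ennreal (2 powr m * (2 powr (- m)) ^ j) * (ennreal (norm (f y - f x0)) * indicator (ball x (2 ^ j * t)) y))" .
  qed
  also have "\<dots> = (\<Sum>j. ennreal (2 powr m * (2 powr (- m)) ^ j) * (\<integral>\<^sup>+y\<in>ball x (2 ^ j * t). ennreal (norm (f y - f x0)) \<partial>lebesgue))"
  proof -
    have m: "(\<lambda>y. ennreal (norm (f y - f x0)) * indicator (ball x (2 ^ j * t)) y) \<in> borel_measurable lebesgue" for j
    proof -
      have [measurable]: "ball x (2 ^ j * t) \<in> sets lebesgue" by simp
      show ?thesis using f by measurable
    qed
    have "(\<integral>\<^sup>+y. (\<Sum>j. ennreal (2 powr m * (2 powr (- m)) ^ j) * (ennreal (norm (f y - f x0)) * indicator (ball x (2 ^ j * t)) y)) \<partial>lebesgue)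
      = (\<Sum>j. \<integral>\<^sup>+y. ennreal (2 powr m * (2 powr (- m)) ^ j) * (ennreal (norm (f y - f x0)) * indicator (ball x (2 ^ j * t)) y) \<partial>lebesgue)"
      by (intro nn_integral_suminf borel_measurable_times_ennreal borel_measurable_const m)
    then show ?thesis unfolding nn_integral_cmult[OF m] .
  qed
  also have "\<dots> \<le> (\<Sum>j. ennreal ?c * ennreal (?q ^ j))"
  proof (intro suminf_le allI)
    fix j
    have "ennreal (2 powr m * (2 powr (- m)) ^ j) * (\<integral>\<^sup>+y\<in>ball x (2 ^ j * t). ennreal (norm (f y - f x0)) \<partial>lebesgue)
      \<le> ennreal (2 powr m * (2 powr (- m)) ^ j) * ennreal (3 * K * (2 ^ j * t) powr s * M powr a * ?v (2 ^ j * t))"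
      by (intro mult_left_mono ball) (use t in simp_all)
    also have "\<dots> = ennreal (2 powr m * (2 powr (- m)) ^ j * (3 * K * (2 ^ j * t) powr s * M powr a * ?v (2 ^ j * t)))"
      by (rule ennreal_mult'[symmetric]) simp
    also have "2 powr m * (2 powr (- m)) ^ j * (3 * K * (2 ^ j * t) powr s * M powr a * ?v (2 ^ j * t)) = ?c * ?q ^ j"
    proof -
      have 1: "(2 ^ j * t) powr s = (2 powr s) ^ j * t powr s"
      proof -
        have "(2 ^ j) powr s = (2 powr s) ^ j"
          by (simp add: powr_realpow[symmetric] powr_powr mult.commute)
        then show ?thesis by (simp add: powr_mult)
      qed
      have 2: "?v (2 ^ j * t) = (2 powr real ?n) ^ j * ?v t"
        unfolding vball_mult by (simp add: powr_realpow power_mult[symmetric] mult.commute)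
      have 3: "?q ^ j = (2 powr real ?n) ^ j * (2 powr s) ^ j * (2 powr (- m)) ^ j"
        unfolding power_mult_distrib[symmetric] powr_add[symmetric] by simp
      show ?thesis unfolding 1 2 3 by (simp only: mult_ac)
    qed
    finally show "ennreal (2 powr m * (2 powr (- m)) ^ j) * (\<integral>\<^sup>+y\<in>ball x (2 ^ j * t). ennreal (norm (f y - f x0)) \<partial>lebesgue)
      \<le> ennreal ?c * ennreal (?q ^ j)"
      using c by (simp add: ennreal_mult)
  qed auto
  also have "\<dots> = ennreal ?c * ennreal (1 / (1 - ?q))"
    using q by (subst ennreal_suminf_cmult, subst suminf_ennreal_eq[OF _ geometric_sums]) auto
  also have "\<dots> = ennreal (?c * (1 / (1 - ?q)))"
    using c q by (subst ennreal_mult) auto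
  also have "?c * (1 / (1 - ?q)) = kernel_const CARD('n) s a m * t ^ ?n * t powr s * M powr a"
    using vball_mult[of t 1, where 'n='n] by (simp add: kernel_const_def vball_def mult_ac)
  finally have bnd: "(\<integral>\<^sup>+y. ennreal (norm (f y - f x0) * (1 + norm (x - y) / t) powr (- m)) \<partial>lebesgue)
     \<le> ennreal (kernel_const CARD('n) s a m * t ^ CARD('n) * t powr s * M powr a)" .
  show ?thesis by (rule that[OF x0(1,2) _ bnd]) (rule x0(3))
qed

end

section \<open>Tensor products and a smooth partition of unity\<close>

text \<open>\<open>E k\<close> is meant to be the k-th derivative of one function of a real
  variable, and \<open>\<kappa>\<close> counts the derivatives taken in each coordinate.
  Differentiating thus only increments an entry of \<open>\<kappa>\<close>.\<close>

definition tens :: "(nat \<Rightarrow> real \<Rightarrow> real) \<Rightarrow> ('n::finite \<Rightarrow> nat) \<Rightarrow> real^'n \<Rightarrow> complex" where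
  "tens E \<kappa> x = of_real (\<Prod>i\<in>UNIV. E (\<kappa> i) (x $ i))"

lemma tens_has_derivative:
  fixes x :: "real^'n"
  assumes E: "\<And>k t. (E k has_real_derivative E (Suc k) t) (at t)"
  shows "(tens E \<kappa> has_derivative
    (\<lambda>y. of_real (\<Sum>i\<in>UNIV. E (Suc (\<kappa> i)) (x $ i) * y $ i * (\<Prod>j\<in>UNIV - {i}. E (\<kappa> j) (x $ j))))) (at x)"
proof -
  have "((\<lambda>x. E (\<kappa> i) (x $ i)) has_derivative (\<lambda>y. E (Suc (\<kappa> i)) (x $ i) * y $ i)) (at x)" for i
    using has_derivative_compose[of "\<lambda>x::real^'n. x $ i" "\<lambda>x. x $ i" x UNIV "E (\<kappa> i)" "\<lambda>y. E (Suc (\<kappa> i)) (x $ i) * y"]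
      E[of "\<kappa> i" "x $ i"] bounded_linear.has_derivative[OF bounded_linear_vec_nth has_derivative_ident]
    by (auto simp: has_field_derivative_def mult_commute_abs)
  then show ?thesis unfolding tens_def
    by (intro has_derivative_of_real has_derivative_prod) auto
qed

lemma partial_tens:
  fixes \<kappa> :: "'n::finite \<Rightarrow> nat"
  assumes E: "\<And>k t. (E k has_real_derivative E (Suc k) t) (at t)"
  shows "partial i (tens E \<kappa>) = tens E (\<kappa>(i := Suc (\<kappa> i)))"
proof
  fix x :: "real^'n"
  have "(\<Sum>k\<in>UNIV. E (Suc (\<kappa> k)) (x $ k) * axis i 1 $ k * (\<Prod>j\<in>UNIV - {k}. E (\<kappa> j) (x $ j)))
     = (\<Sum>k\<in>UNIV. if k = i then E (Suc (\<kappa> i)) (x $ i) * (\<Prod>j\<in>UNIV - {i}. E (\<kappa> j) (x $ j)) else 0)"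
    by (intro sum.cong) (auto simp: axis_def)
  also have "\<dots> = E (Suc (\<kappa> i)) (x $ i) * (\<Prod>j\<in>UNIV - {i}. E (\<kappa> j) (x $ j))" by simp
  also have "\<dots> = (\<Prod>j\<in>UNIV. E ((\<kappa>(i := Suc (\<kappa> i))) j) (x $ j))"
    by (subst prod.remove[of UNIV i]) auto
  finally show "partial i (tens E \<kappa>) x = tens E (\<kappa>(i := Suc (\<kappa> i))) x"
    unfolding partial_eq[OF tens_has_derivative[of E, OF E]] tens_def by (simp only:)
qed

lemma pd_tens:
  assumes E: "\<And>k t. (E k has_real_derivative E (Suc k) t) (at t)"
  shows "pd ns (tens E \<kappa>) = tens E (\<lambda>i. \<kappa> i + count_list ns i)"
proof (induction ns)
  case (Cons i ns)
  have "(\<lambda>j. \<kappa> j + count_list ns j)(i := Suc (\<kappa> i + count_list ns i)) = (\<lambda>j. \<kappa> j + count_list (i # ns) j)"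
    by auto
  then show ?case by (simp add: Cons partial_tens[of E, OF E])
qed simp

lemma smooth_tens:
  assumes E: "\<And>k t. (E k has_real_derivative E (Suc k) t) (at t)"
  shows "smooth (tens E \<kappa>)"
  unfolding smooth_def pd_tens[of E, OF E] using tens_has_derivative[of E, OF E]
  by (auto simp: differentiable_def)

lemma one_plus_sum_le_prod:
  fixes a :: "'i \<Rightarrow> real"
  assumes "\<And>i. 0 \<le> a i"
  shows "finite I \<Longrightarrow> 1 + (\<Sum>i\<in>I. a i) \<le> (\<Prod>i\<in>I. 1 + a i)"
proof (induction I rule: finite_induct)
  case (insert i I)
  have "1 \<le> (\<Prod>i\<in>I. 1 + a i)" using assms by (intro prod_ge_1) simp
  then have "a i * 1 \<le> a i * (\<Prod>i\<in>I. 1 + a i)" using assms by (intro mult_left_mono) auto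
  with insert show ?case by (simp add: algebra_simps)
qed simp

text \<open>One-dimensional decay in every coordinate yields radial decay, because the product of
  the 1 + |x_i| dominates 1 + |x|.\<close>

lemma tens_schwartz:
  assumes E: "\<And>k t. (E k has_real_derivative E (Suc k) t) (at t)"
    and bd: "\<And>k m. 0 < m \<Longrightarrow> \<exists>C. \<forall>t. \<bar>E k t\<bar> \<le> C * (1 + \<bar>t\<bar>) powr (- m)"
  shows "(tens E (\<lambda>_. 0) :: real^'n \<Rightarrow> complex) \<in> schwartz"
  unfolding schwartz_iff
proof (intro conjI allI)
  show "smooth (tens E (\<lambda>_. 0) :: real^'n \<Rightarrow> complex)" by (rule smooth_tens) (rule E)
  fix k and m :: real
  define M where "M = max m 1"
  have M: "0 < M" "m \<le> M" by (auto simp: M_def)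
  obtain C where C: "\<And>k t. \<bar>E k t\<bar> \<le> C k * (1 + \<bar>t\<bar>) powr (- M)" using bd[OF M(1)] by metis
  define D where "D = (\<Sum>j\<le>k. \<bar>C j\<bar>)"
  have D: "C j \<le> D" if "j \<le> k" for j
  proof -
    have "\<bar>C j\<bar> \<le> D" unfolding D_def using that by (intro member_le_sum) auto
    then show ?thesis by simp
  qed
  have "sbound k M (D ^ CARD('n)) (tens E (\<lambda>_. 0) :: real^'n \<Rightarrow> complex)"
  proof (rule sboundI)
    fix ns :: "'n list" and x :: "real^'n" assume ns: "ns \<in> sorted_lists" "length ns \<le> k"
    have "norm (pd ns (tens E (\<lambda>_. 0)) x) = (\<Prod>i\<in>UNIV. \<bar>E (count_list ns i) (x $ i)\<bar>)"
      unfolding pd_tens[of E, OF E] by (simp add: tens_def prod_norm[symmetric])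
    also have "\<dots> \<le> (\<Prod>i\<in>UNIV. D * (1 + \<bar>x $ i\<bar>) powr (- M))"
    proof (intro prod_mono conjI)
      fix i
      have "\<bar>E (count_list ns i) (x $ i)\<bar> \<le> C (count_list ns i) * (1 + \<bar>x $ i\<bar>) powr (- M)" by (rule C)
      also have "\<dots> \<le> D * (1 + \<bar>x $ i\<bar>) powr (- M)"
        using ns(2) count_le_length[of ns i] by (intro mult_right_mono D) auto
      finally show "\<bar>E (count_list ns i) (x $ i)\<bar> \<le> D * (1 + \<bar>x $ i\<bar>) powr (- M)" .
    qed simp
    also have "\<dots> = D ^ CARD('n) * (\<Prod>i\<in>UNIV. 1 + \<bar>x $ i\<bar>) powr (- M)"
      by (simp add: prod.distrib prod_powr_distrib)
    also have "\<dots> \<le> D ^ CARD('n) * (1 + norm x) powr (- M)"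
    proof (intro mult_left_mono powr_mono2')
      have "1 + norm x \<le> 1 + (\<Sum>i\<in>UNIV. \<bar>x $ i\<bar>)" using norm_le_l1_cart[of x] by simp
      also have "\<dots> \<le> (\<Prod>i\<in>UNIV. 1 + \<bar>x $ i\<bar>)" by (rule one_plus_sum_le_prod) auto
      finally show "1 + norm x \<le> (\<Prod>i\<in>UNIV. 1 + \<bar>x $ i\<bar>)" .
      show "0 \<le> D ^ CARD('n)" by (simp add: D_def sum_nonneg)
    qed (use M in \<open>auto simp: add_pos_nonneg\<close>)
    finally show "norm (pd ns (tens E (\<lambda>_. 0)) x) \<le> D ^ CARD('n) * (1 + norm x) powr (- M)" .
  qed
  from sbound_mono[OF this order_refl M(2) order_refl]
  show "\<exists>C. sbound k m C (tens E (\<lambda>_. 0) :: real^'n \<Rightarrow> complex)" ..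
qed

text \<open>Products of differences of the logistic function replace compactly supported bumps: the
  derivatives of the logistic function are polynomials in it, and the sum over a box of integer
  translates telescopes.\<close>

definition sigm :: "real \<Rightarrow> real" where "sigm t = 1 / (1 + exp (- t))"

lemma exp_pos1: "0 < 1 + exp (t::real)" by (simp add: add_pos_pos)

lemma sigm_range: "0 < sigm t" "sigm t < 1" "0 \<le> sigm t" "sigm t \<le> 1"
  using exp_pos1[of "-t"] by (auto simp: sigm_def field_simps)

lemma sigm_mono: "s < t \<Longrightarrow> sigm s < sigm t"
  unfolding sigm_def using exp_pos1 by (intro divide_strict_left_mono mult_pos_pos) auto

lemma sigm_le_exp: "sigm t \<le> exp t"
proof -
  have "exp t * (1 + exp (- t)) = exp t + 1" by (simp add: distrib_left exp_minus)
  then show ?thesis unfolding sigm_def using exp_pos1[of "-t"] exp_gt_zero[of t] by (simp add: pos_divide_le_eq del: exp_gt_zero)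
qed

lemma sigm_minus: "1 - sigm t = sigm (- t)"
proof -
  have "1 + exp t \<noteq> 0" "1 + exp (- t) \<noteq> 0" using exp_pos1[of t] exp_pos1[of "-t"] by linarith+
  then show ?thesis by (simp add: sigm_def field_simps exp_minus)
qed

lemma sigm_deriv: "(sigm has_real_derivative sigm t * (1 - sigm t)) (at t)"
proof -
  have "1 + exp (- t) \<noteq> 0" using exp_pos1[of "-t"] by linarith
  then show ?thesis unfolding sigm_def [abs_def]
    by (auto intro!: derivative_eq_intros simp: field_simps power2_eq_square)
qed

text \<open>The recursion is the chain rule for sigm' = sigm - sigm^2, the polynomial
  \<open>[:0, 1, -1:]\<close> evaluated at \<open>sigm\<close>.\<close>

primrec sigm_poly :: "nat \<Rightarrow> real poly" where
  "sigm_poly 0 = [:0, 1:]"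
| "sigm_poly (Suc k) = pderiv (sigm_poly k) * [:0, 1, -1:]"

lemma sigm_poly_deriv:
  "((\<lambda>t. poly (sigm_poly k) (sigm (t + c))) has_real_derivative poly (sigm_poly (Suc k)) (sigm (t + c))) (at t)"
proof -
  have "((\<lambda>t. sigm (t + c)) has_real_derivative sigm (t + c) * (1 - sigm (t + c))) (at t)"
    using DERIV_shift[of sigm "sigm (t + c) * (1 - sigm (t + c))" t c] sigm_deriv[of "t + c"] by simp
  from DERIV_chain2[OF poly_DERIV this, of "sigm_poly k"]
  show ?thesis by (simp add: algebra_simps)
qed

text \<open>The values of these polynomials at 0 and 1 are the limits of the derivatives at minus
  and plus infinity. All derivatives of positive order carry the factor X - X^2, which vanishes at
  both ends.\<close>

lemma sigm_poly_0: "poly (sigm_poly k) 0 = 0"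
  by (cases k) auto

lemma sigm_poly_1: "poly (sigm_poly k) 1 = (if k = 0 then 1 else 0)"
  by (cases k) auto

lemma poly_lipschitz:
  fixes p :: "real poly"
  obtains L where "1 \<le> L" "\<And>u v. u \<in> {0..1} \<Longrightarrow> v \<in> {0..1} \<Longrightarrow> \<bar>poly p u - poly p v\<bar> \<le> L * \<bar>u - v\<bar>"
proof -
  have "compact (poly (pderiv p) ` {0..1})"
    by (intro compact_continuous_image continuous_intros) auto
  then have "bounded (poly (pderiv p) ` {0..1})" by (rule compact_imp_bounded)
  then obtain B where B: "\<And>x. x \<in> {0..1} \<Longrightarrow> \<bar>poly (pderiv p) x\<bar> \<le> B"
    unfolding bounded_iff real_norm_def ball_simps(10) by blast
  have *: "\<bar>poly p v - poly p u\<bar> \<le> max 1 B * \<bar>v - u\<bar>" if uv: "u \<in> {0..1}" "v \<in> {0..1}" "u < v" for u v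
  proof -
    obtain x where x: "u < x" "x < v" "poly p v - poly p u = (v - u) * poly (pderiv p) x"
      using poly_MVT[OF uv(3), of p] by blast
    have "\<bar>poly (pderiv p) x\<bar> \<le> B" using x uv by (intro B) auto
    then have "\<bar>poly (pderiv p) x\<bar> \<le> max 1 B" by simp
    then have "\<bar>v - u\<bar> * \<bar>poly (pderiv p) x\<bar> \<le> \<bar>v - u\<bar> * max 1 B" by (rule mult_left_mono) simp
    then show ?thesis unfolding x(3) abs_mult by (simp only: mult.commute)
  qed
  show ?thesis
  proof (rule that[of "max 1 B"])
    fix u v :: real assume uv: "u \<in> {0..1}" "v \<in> {0..1}"
    consider "u < v" | "u = v" | "v < u" by linarith
    then show "\<bar>poly p u - poly p v\<bar> \<le> max 1 B * \<bar>u - v\<bar>"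
      by cases (use *[of u v] *[of v u] uv in \<open>auto simp: abs_minus_commute\<close>)
  qed simp
qed

text \<open>A Lipschitz constant on the range of \<open>sigm\<close>. It reduces differences of
  derivatives to differences of the logistic function itself.\<close>

definition sigm_lip :: "nat \<Rightarrow> real" where
  "sigm_lip k = (SOME L. 1 \<le> L \<and> (\<forall>u\<in>{0..1}. \<forall>v\<in>{0..1}. \<bar>poly (sigm_poly k) u - poly (sigm_poly k) v\<bar> \<le> L * \<bar>u - v\<bar>))"

lemma sigm_lip:
  "1 \<le> sigm_lip k"
  "u \<in> {0..1} \<Longrightarrow> v \<in> {0..1} \<Longrightarrow> \<bar>poly (sigm_poly k) u - poly (sigm_poly k) v\<bar> \<le> sigm_lip k * \<bar>u - v\<bar>"
proof -
  have "\<exists>L. 1 \<le> L \<and> (\<forall>u\<in>{0..1}. \<forall>v\<in>{0..1}. \<bar>poly (sigm_poly k) u - poly (sigm_poly k) v\<bar> \<le> L * \<bar>u - v\<bar>)"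
    by (rule poly_lipschitz[of "sigm_poly k"]) blast
  from someI_ex[OF this, folded sigm_lip_def]
  show "1 \<le> sigm_lip k"
    "u \<in> {0..1} \<Longrightarrow> v \<in> {0..1} \<Longrightarrow> \<bar>poly (sigm_poly k) u - poly (sigm_poly k) v\<bar> \<le> sigm_lip k * \<bar>u - v\<bar>"
    by auto
qed

definition sigm_diff :: "real \<Rightarrow> real \<Rightarrow> nat \<Rightarrow> real \<Rightarrow> real" where
  "sigm_diff a b k t = poly (sigm_poly k) (sigm (t + a)) - poly (sigm_poly k) (sigm (t + b))"

lemma sigm_diff_0: "sigm_diff a b 0 t = sigm (t + a) - sigm (t + b)"
  by (simp add: sigm_diff_def)

lemma sigm_diff_deriv: "(sigm_diff a b k has_real_derivative sigm_diff a b (Suc k) t) (at t)"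
  unfolding sigm_diff_def [abs_def] by (intro DERIV_diff sigm_poly_deriv)

text \<open>The inequality ln y \<le> y - 1 at y = (1 + u) / m, with contact at u = m - 1, where (1
  + u)^m exp (- u) is stationary.\<close>

lemma exp_minus_le_powr:
  fixes m u :: real
  assumes "0 < m" "0 \<le> u"
  shows "exp (- u) \<le> exp (1 - m + m * ln m) * (1 + u) powr (- m)"
proof -
  have "ln ((1 + u) / m) \<le> (1 + u) / m - 1" using assms by (intro ln_le_minus_one) auto
  then have "m * ln ((1 + u) / m) \<le> m * ((1 + u) / m - 1)" using assms by (intro mult_left_mono) auto
  then have "m * (ln (1 + u) - ln m) \<le> 1 + u - m" using assms by (simp add: ln_div right_diff_distrib)
  then have "- u \<le> 1 - m + m * ln m + (- m) * ln (1 + u)" by (simp add: algebra_simps)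
  then have "exp (- u) \<le> exp (1 - m + m * ln m + (- m) * ln (1 + u))" by simp
  also have "\<dots> = exp (1 - m + m * ln m) * (1 + u) powr (- m)"
    using assms by (simp only: exp_add) (simp add: powr_def)
  finally show ?thesis .
qed

lemma sigm_diff_1_0_le: "sigm (t + 1) - sigm t \<le> exp 1 * exp (- \<bar>t\<bar>)"
proof (cases "0 \<le> t")
  case True
  have "sigm (t + 1) - sigm t \<le> sigm (- t)" using sigm_minus[of t] sigm_range[of "t + 1"] by simp
  also have "\<dots> \<le> 1 * exp (- t)" using sigm_le_exp[of "-t"] by simp
  also have "\<dots> \<le> exp 1 * exp (- t)" by (intro mult_right_mono) auto
  finally show ?thesis using True by simp
next
  case False
  have "sigm (t + 1) - sigm t \<le> sigm (t + 1)" using sigm_range[of t] by simp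
  also have "\<dots> \<le> exp (t + 1)" by (rule sigm_le_exp)
  finally show ?thesis using False by (simp add: exp_add mult.commute)
qed

definition bump :: "real^'n \<Rightarrow> complex" where
  "bump = tens (sigm_diff 1 0) (\<lambda>_. 0)"

lemma bump_schwartz: "bump \<in> schwartz"
  unfolding bump_def
proof (rule tens_schwartz)
  show "(sigm_diff 1 0 k has_real_derivative sigm_diff 1 0 (Suc k) t) (at t)" for k t
    by (rule sigm_diff_deriv)
  fix k and m :: real assume m: "0 < m"
  have "\<bar>sigm_diff 1 0 k t\<bar> \<le> (sigm_lip k * (exp 1 * exp (1 - m + m * ln m))) * (1 + \<bar>t\<bar>) powr (- m)" for t
  proof -
    have "\<bar>sigm_diff 1 0 k t\<bar> \<le> sigm_lip k * \<bar>sigm (t + 1) - sigm (t + 0)\<bar>"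
      unfolding sigm_diff_def using sigm_range by (intro sigm_lip) auto
    also have "\<bar>sigm (t + 1) - sigm (t + 0)\<bar> = sigm (t + 1) - sigm t" using sigm_mono[of t "t + 1"] by simp
    also have "sigm_lip k * \<dots> \<le> sigm_lip k * (exp 1 * (exp (1 - m + m * ln m) * (1 + \<bar>t\<bar>) powr (- m)))"
      using sigm_lip(1)[of k] order_trans[OF sigm_diff_1_0_le[of t] mult_left_mono[OF exp_minus_le_powr[OF m, of "\<bar>t\<bar>"], of "exp 1"]]
      by (intro mult_left_mono) auto
    finally show ?thesis by (simp only: mult.assoc)
  qed
  then show "\<exists>C. \<forall>t. \<bar>sigm_diff 1 0 k t\<bar> \<le> C * (1 + \<bar>t\<bar>) powr (- m)" by blast
qed

lemma bump_pos: "bump x = of_real (\<Prod>i\<in>UNIV. sigm (x $ i + 1) - sigm (x $ i))"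
    "0 < (\<Prod>i\<in>UNIV. sigm (x $ i + 1) - sigm (x $ i))"
  using sigm_mono by (auto simp: bump_def tens_def sigm_diff_0 intro!: prod_pos)

text \<open>What remains in each coordinate after telescoping: by \<open>sum_bump\<close> this is
  the sum of the translates of \<open>bump\<close> over the integer points of the box
  [-J, J]^n.\<close>

definition cutoff :: "nat \<Rightarrow> real^'n \<Rightarrow> complex" where
  "cutoff J = tens (sigm_diff (real J + 1) (- real J)) (\<lambda>_. 0)"

lemma sum_sigm:
  "(\<Sum>j\<in>{- int J..int J}. sigm (t - of_int j + 1) - sigm (t - of_int j)) = sigm (t + real J + 1) - sigm (t - real J)"
proof (induction J)
  case (Suc J)
  have "{- int (Suc J)..int (Suc J)} = insert (- int (Suc J)) (insert (int (Suc J)) {- int J..int J})"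
    by auto
  then show ?case using Suc by (simp add: algebra_simps)
qed (simp add: algebra_simps)

lemma sum_bump:
  fixes x :: "real^'n"
  shows "(\<Sum>j\<in>Pi\<^sub>E UNIV (\<lambda>_. {- int J..int J}). bump (x - (\<chi> i. of_int (j i)))) = cutoff J x"
proof -
  have "cutoff J x = of_real (\<Prod>i\<in>UNIV. \<Sum>j\<in>{- int J..int J}. sigm (x $ i - of_int j + 1) - sigm (x $ i - of_int j))"
    by (simp add: cutoff_def tens_def sigm_diff_0 sum_sigm add.assoc)
  also have "(\<Prod>i\<in>UNIV. \<Sum>j\<in>{- int J..int J}. sigm (x $ i - of_int j + 1) - sigm (x $ i - of_int j))
    = (\<Sum>j\<in>Pi\<^sub>E UNIV (\<lambda>_. {- int J..int J}). \<Prod>i\<in>UNIV. sigm (x $ i - of_int (j i) + 1) - sigm (x $ i - of_int (j i)))"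
    by (rule prod_sum_PiE) auto
  finally show ?thesis by (simp add: bump_pos(1))
qed

lemma smooth_cutoff: "smooth (cutoff J)"
  unfolding cutoff_def by (rule smooth_tens) (rule sigm_diff_deriv)

text \<open>Combines exponential smallness for u \<le> J with the trivial bound for u > J into one
  rational bound: decay 1 / (1 + J), paid for by linear growth in u.\<close>

lemma min_exp_le:
  fixes u J :: real
  assumes "0 \<le> u" "0 \<le> J" "y \<le> 1" "y \<le> exp (u - J)"
  shows "y \<le> (1 + u) / (1 + J)"
proof (cases "u \<le> J")
  case True
  have "exp (u - J) \<le> 1 / (1 + (J - u))"
    using exp_ge_add_one_self[of "J - u"] True exp_minus[of "J - u"]
    by (simp add: divide_inverse le_imp_inverse_le)
  also have "\<dots> \<le> (1 + u) / (1 + J)"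
  proof -
    have "1 + J \<le> (1 + u) * (1 + (J - u))" using mult_nonneg_nonneg[of u "J - u"] True assms by (simp add: algebra_simps)
    then show ?thesis using True assms by (simp add: field_simps)
  qed
  finally show ?thesis using assms by simp
next
  case False
  then have "1 \<le> (1 + u) / (1 + J)" using assms by simp
  with assms(3) show ?thesis by (rule order_trans)
qed

lemma abs_prod_diff_le:
  fixes a b :: "'i \<Rightarrow> real"
  assumes "1 \<le> L" "\<And>i. \<bar>a i\<bar> \<le> L" "\<And>i. \<bar>b i\<bar> \<le> L"
  shows "finite I \<Longrightarrow> \<bar>(\<Prod>i\<in>I. a i) - (\<Prod>i\<in>I. b i)\<bar> \<le> L ^ card I * (\<Sum>i\<in>I. \<bar>a i - b i\<bar>)"
proof (induction I rule: finite_induct)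
  case (insert i I)
  let ?A = "\<Prod>i\<in>I. a i" and ?B = "\<Prod>i\<in>I. b i"
  have B: "\<bar>?B\<bar> \<le> L ^ card I"
    using prod_mono[of I "\<lambda>i. \<bar>b i\<bar>" "\<lambda>_. L"] assms by (simp add: abs_prod)
  have 1: "\<bar>a i\<bar> * \<bar>?A - ?B\<bar> \<le> L * (L ^ card I * (\<Sum>i\<in>I. \<bar>a i - b i\<bar>))"
    using assms insert.IH by (intro mult_mono) auto
  have 2: "\<bar>a i - b i\<bar> * \<bar>?B\<bar> \<le> \<bar>a i - b i\<bar> * (L * L ^ card I)"
  proof (rule mult_left_mono)
    have "1 * L ^ card I \<le> L * L ^ card I" using assms(1) by (intro mult_right_mono) auto
    with B show "\<bar>?B\<bar> \<le> L * L ^ card I" by simp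
  qed simp
  have "a i * ?A - b i * ?B = a i * (?A - ?B) + (a i - b i) * ?B" by (simp add: algebra_simps)
  then have "\<bar>a i * ?A - b i * ?B\<bar> \<le> \<bar>a i\<bar> * \<bar>?A - ?B\<bar> + \<bar>a i - b i\<bar> * \<bar>?B\<bar>"
    using abs_triangle_ineq[of "a i * (?A - ?B)" "(a i - b i) * ?B"] by (simp add: abs_mult)
  also have "\<dots> \<le> L * (L ^ card I * (\<Sum>i\<in>I. \<bar>a i - b i\<bar>)) + \<bar>a i - b i\<bar> * (L * L ^ card I)"
    using 1 2 by (rule add_mono)
  finally show ?case using insert by (simp add: algebra_simps)
qed simp

text \<open>For large J the two arguments of the polynomial approach 1 and 0. The number subtracted
  is the difference of the end values, that is, the k-th derivative of the constant function
  1.\<close>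

lemma sigm_diff_cutoff:
  assumes "0 \<le> J"
  shows "\<bar>sigm_diff (J + 1) (- J) k t\<bar> \<le> sigm_lip k"
    and "\<bar>sigm_diff (J + 1) (- J) k t - (if k = 0 then 1 else 0)\<bar> \<le> 2 * sigm_lip k * ((1 + \<bar>t\<bar>) / (1 + J))"
proof -
  let ?p = "poly (sigm_poly k)" and ?u = "sigm (t + (J + 1))" and ?v = "sigm (t + - J)" and ?L = "sigm_lip k"
  have L: "1 \<le> ?L" by (rule sigm_lip)
  have "\<bar>?p ?u - ?p ?v\<bar> \<le> ?L * \<bar>?u - ?v\<bar>" using sigm_range by (intro sigm_lip) auto
  also have "\<dots> \<le> ?L * 1" using L sigm_range[of "t + (J + 1)"] sigm_range[of "t + - J"] by (intro mult_left_mono) auto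
  finally show "\<bar>sigm_diff (J + 1) (- J) k t\<bar> \<le> ?L" by (simp only: sigm_diff_def mult_1_right)
  have 1: "\<bar>?p ?u - ?p 1\<bar> \<le> ?L * \<bar>?u - 1\<bar>" using sigm_range by (intro sigm_lip) auto
  have "\<bar>?u - 1\<bar> = sigm (- (t + (J + 1)))" using sigm_minus[of "t + (J + 1)"] sigm_range[of "t + (J + 1)"] by simp
  also have "\<dots> \<le> (1 + \<bar>t\<bar>) / (1 + J)"
  proof (rule min_exp_le)
    have "exp (- (t + (J + 1))) \<le> exp (\<bar>t\<bar> - J)" by simp
    with sigm_le_exp[of "- (t + (J + 1))"] show "sigm (- (t + (J + 1))) \<le> exp (\<bar>t\<bar> - J)" by linarith
  qed (use assms sigm_range in auto)
  finally have "\<bar>?u - 1\<bar> \<le> (1 + \<bar>t\<bar>) / (1 + J)" .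
  with L have 1: "\<bar>?p ?u - ?p 1\<bar> \<le> ?L * ((1 + \<bar>t\<bar>) / (1 + J))"
    by (intro order_trans[OF 1] mult_left_mono) auto
  have 2: "\<bar>?p ?v - ?p 0\<bar> \<le> ?L * \<bar>?v - 0\<bar>" using sigm_range by (intro sigm_lip) auto
  have "\<bar>?v - 0\<bar> = ?v" using sigm_range[of "t + - J"] by simp
  also have "\<dots> \<le> (1 + \<bar>t\<bar>) / (1 + J)"
  proof (rule min_exp_le)
    have "exp (t + - J) \<le> exp (\<bar>t\<bar> - J)" by simp
    with sigm_le_exp[of "t + - J"] show "sigm (t + - J) \<le> exp (\<bar>t\<bar> - J)" by linarith
  qed (use assms sigm_range in auto)
  finally have "\<bar>?v - 0\<bar> \<le> (1 + \<bar>t\<bar>) / (1 + J)" .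
  with L have 2: "\<bar>?p ?v - ?p 0\<bar> \<le> ?L * ((1 + \<bar>t\<bar>) / (1 + J))"
    by (intro order_trans[OF 2] mult_left_mono) auto
  have "sigm_diff (J + 1) (- J) k t - (if k = 0 then 1 else 0) = (?p ?u - ?p 1) - (?p ?v - ?p 0)"
    by (simp add: sigm_diff_def sigm_poly_0 sigm_poly_1)
  with 1 2 show "\<bar>sigm_diff (J + 1) (- J) k t - (if k = 0 then 1 else 0)\<bar> \<le> 2 * sigm_lip k * ((1 + \<bar>t\<bar>) / (1 + J))"
    by linarith
qed

text \<open>Each cutoff decays at infinity, so convergence to 1 cannot be uniform. The weight -1
  tolerates an error growing linearly, and in exchange the error is of order 1 / (1 + J) for all
  derivatives.\<close>

lemma sbound_cutoff:
  "\<exists>C. \<forall>J. sbound k (-1) (C / (1 + real J)) (\<lambda>x :: real^'n. cutoff J x - 1)"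
proof -
  \<comment> \<open>The sequence of derivatives of the constant 1. It presents the constant as a
    tensor product, to be compared with the cutoff factor by factor.\<close>
  let ?\<delta> = "\<lambda>k (t::real). if k = 0 then 1 else (0::real)"
  have \<delta>: "(?\<delta> k has_real_derivative ?\<delta> (Suc k) t) (at t)" for k t by auto
  have one: "(\<lambda>x. 1) = (tens ?\<delta> (\<lambda>_. 0) :: real^'n \<Rightarrow> complex)" by (auto simp: tens_def)
  define L where "L = (\<Sum>j\<le>k. sigm_lip j)"
  have L: "sigm_lip j \<le> L" if "j \<le> k" for j
    unfolding L_def using that order_trans[OF zero_le_one sigm_lip(1)] by (intro member_le_sum) auto
  have L1: "1 \<le> L" using order_trans[OF sigm_lip(1) L[of 0]] by simp
  let ?n = "real CARD('n)"
  have "sbound k (-1) ((L ^ CARD('n) * (?n * (2 * L))) / (1 + real J)) (\<lambda>x :: real^'n. cutoff J x - 1)" for J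
  proof (rule sboundI)
    fix ns :: "'n list" and x :: "real^'n" assume ns: "ns \<in> sorted_lists" "length ns \<le> k"
    let ?E = "sigm_diff (real J + 1) (- real J)"
    have c: "count_list ns i \<le> k" for i using ns(2) count_le_length[of ns i] by simp
    have "pd ns (\<lambda>x::real^'n. cutoff J x + (-1) * 1) x = pd ns (cutoff J) x + (-1) * pd ns (\<lambda>x. 1) x"
    proof -
      have s: "smooth (\<lambda>x :: real^'n. 1 :: complex)" unfolding one by (rule smooth_tens) (rule \<delta>)
      have s': "smooth (\<lambda>x :: real^'n. (-1) * 1 :: complex)" by (rule smooth_const)
      show ?thesis unfolding pd_add[OF smooth_cutoff s'] pd_cmult[OF s] ..
    qed
    then have "pd ns (\<lambda>x. cutoff J x - 1) x = pd ns (cutoff J) x - pd ns (\<lambda>x. 1) x" by simp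
    also have "\<dots> = of_real ((\<Prod>i\<in>UNIV. ?E (count_list ns i) (x $ i)) - (\<Prod>i\<in>UNIV. ?\<delta> (count_list ns i) (x $ i)))"
      unfolding one cutoff_def pd_tens[of ?E, OF sigm_diff_deriv] pd_tens[of ?\<delta>, OF \<delta>] by (simp add: tens_def)
    finally have "norm (pd ns (\<lambda>x. cutoff J x - 1) x) = \<bar>(\<Prod>i\<in>UNIV. ?E (count_list ns i) (x $ i)) - (\<Prod>i\<in>UNIV. ?\<delta> (count_list ns i) (x $ i))\<bar>"
      by (simp only: norm_of_real real_norm_def)
    also have "\<dots> \<le> L ^ CARD('n) * (\<Sum>i\<in>UNIV. \<bar>?E (count_list ns i) (x $ i) - ?\<delta> (count_list ns i) (x $ i)\<bar>)"
      using L1 by (intro abs_prod_diff_le order_trans[OF sigm_diff_cutoff(1) L[OF c]]) auto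
    also have "\<dots> \<le> L ^ CARD('n) * (\<Sum>i\<in>(UNIV::'n set). 2 * L * ((1 + norm x) / (1 + real J)))"
    proof (intro mult_left_mono sum_mono)
      fix i
      have "\<bar>?E (count_list ns i) (x $ i) - ?\<delta> (count_list ns i) (x $ i)\<bar> \<le> 2 * sigm_lip (count_list ns i) * ((1 + \<bar>x $ i\<bar>) / (1 + real J))"
        by (rule sigm_diff_cutoff(2)) simp
      also have "\<dots> \<le> 2 * L * ((1 + norm x) / (1 + real J))"
        using L[OF c[of i]] component_le_norm_cart[of x i] L1 sigm_lip(1)[of "count_list ns i"]
        by (intro mult_mono divide_right_mono) auto
      finally show "\<bar>?E (count_list ns i) (x $ i) - ?\<delta> (count_list ns i) (x $ i)\<bar> \<le> 2 * L * ((1 + norm x) / (1 + real J))" .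
    qed (use L1 in auto)
    also have "\<dots> = (L ^ CARD('n) * (?n * (2 * L))) / (1 + real J) * (1 + norm x) powr - (- 1)"
      using norm_ge_zero[of x] by (simp add: add_nonneg_nonneg)
    finally show "norm (pd ns (\<lambda>x. cutoff J x - 1) x) \<le> (L ^ CARD('n) * (?n * (2 * L))) / (1 + real J) * (1 + norm x) powr - (- 1)" .
  qed
  then show ?thesis by blast
qed

lemma sbound_dilate_growth:
  fixes f :: "real^'n \<Rightarrow> complex"
  assumes "smooth f" "sbound k (-1) C f" "0 < b"
  shows "sbound k (-1) ((1 + b) ^ k * ((1 + b) * C)) (\<lambda>x. f (b *\<^sub>R x))"
proof (rule sboundI)
  fix ns :: "'n list" and x assume ns: "ns \<in> sorted_lists" "length ns \<le> k"
  have C: "0 \<le> C" using assms(2) by (rule sbound_nonneg)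
  have "norm (pd ns (\<lambda>x. f (b *\<^sub>R x)) x) = b ^ length ns * norm (pd ns f (b *\<^sub>R x))"
    using pd_affine[OF assms(1), of ns 1 0 b] assms(3) by (simp add: norm_mult norm_power)
  also have "\<dots> \<le> (1 + b) ^ k * (C * (1 + norm (b *\<^sub>R x)) powr (- (-1)))"
  proof (intro mult_mono sboundD'[OF assms(2) ns])
    have "b ^ length ns \<le> (1 + b) ^ length ns" using assms by (intro power_mono) auto
    also have "\<dots> \<le> (1 + b) ^ k" using assms ns by (intro power_increasing) auto
    finally show "b ^ length ns \<le> (1 + b) ^ k" .
  qed (use assms in auto)
  also have "\<dots> \<le> (1 + b) ^ k * (C * ((1 + b) * (1 + norm x) powr (- (-1))))"
  proof -
    have "1 + b * norm x \<le> (1 + b) * (1 + norm x)" using assms by (simp add: algebra_simps)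
    then show ?thesis using assms C norm_ge_zero[of x]
      by (intro mult_left_mono) (auto simp: add_nonneg_nonneg)
  qed
  finally show "norm (pd ns (\<lambda>x. f (b *\<^sub>R x)) x) \<le> (1 + b) ^ k * ((1 + b) * C) * (1 + norm x) powr - (- 1)"
    by (simp add: mult_ac)
qed

text \<open>Taking the decay of \<phi> with weight \<open>m + 1\<close> pays for the linear growth
  permitted to the cutoff error.\<close>

lemma cutoff_converges:
  fixes \<phi> :: "real^'n \<Rightarrow> complex"
  assumes "\<phi> \<in> schwartz" "0 < b"
  obtains C where "\<And>J. sbound k m (C / (1 + real J)) (\<lambda>x. \<phi> x * cutoff J (b *\<^sub>R x) - \<phi> x)"
proof -
  obtain C where C: "\<And>J. sbound k (-1) (C / (1 + real J)) (\<lambda>x :: real^'n. cutoff J x - 1)"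
    using sbound_cutoff by blast
  obtain D where D: "sbound k (m + 1) D \<phi>" using schwartzE[OF assms(1)] .
  have sm: "smooth (\<lambda>x :: real^'n. cutoff J x - 1)" for J
    using smooth_add[OF smooth_cutoff smooth_const[of "-1"], of J] by simp
  have sm': "smooth (\<lambda>x :: real^'n. cutoff J (b *\<^sub>R x) - 1)" for J
    using smooth_affine[OF sm, of 1 J 0 b] by simp
  have "sbound k m (2 ^ k * (D * ((1 + b) ^ k * ((1 + b) * C))) / (1 + real J)) (\<lambda>x. \<phi> x * cutoff J (b *\<^sub>R x) - \<phi> x)" for J
    using sbound_mult[OF schwartz_smooth[OF assms(1)] sm' D sbound_dilate_growth[OF sm C assms(2)], of J]
    by (simp add: right_diff_distrib)
  then show ?thesis by (rule that)
qed

section \<open>Quasi-norms and weighted integrals\<close>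

lemma epowr_ennreal: "0 \<le> x \<Longrightarrow> epowr (ennreal x) b = ennreal (x powr b)"
  by (simp add: epowr_def)

lemma epowr_top [simp]: "epowr top b = top"
  by (simp add: epowr_def)

lemma epowr_mono: "0 \<le> b \<Longrightarrow> x \<le> y \<Longrightarrow> epowr x b \<le> epowr y b"
  by (cases x; cases y) (auto simp: epowr_ennreal ennreal_le_iff top_unique intro!: ennreal_leI powr_mono2)

lemma epowr_epowr: "epowr (epowr x b) c = epowr x (b * c)"
  by (cases x) (auto simp: epowr_ennreal powr_powr)

lemma epowr_1 [simp]: "epowr x 1 = x"
  by (cases x) (auto simp: epowr_ennreal)

lemma epowr_cmult: "0 < c \<Longrightarrow> epowr (ennreal c * x) b = ennreal (c powr b) * epowr x b"
  by (cases x) (auto simp: epowr_ennreal ennreal_mult[symmetric] powr_mult ennreal_mult_top)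

lemma epowr_less_top_iff: "epowr x b < top \<longleftrightarrow> x < top"
  by (cases x) (auto simp: epowr_ennreal)

lemma measurable_epowr [measurable]:
  assumes "F \<in> borel_measurable M"
  shows "(\<lambda>x. epowr (F x) b) \<in> borel_measurable M"
proof -
  have "(\<lambda>x. epowr x b) \<in> borel_measurable borel" unfolding epowr_def by measurable
  from measurable_compose[OF assms this] show ?thesis .
qed

lemma epowr_add_le:
  assumes "0 \<le> b"
  shows "epowr (x + y) b \<le> ennreal (2 powr b) * (epowr x b + epowr y b)"
proof -
  have "x + y \<le> ennreal 2 * max x y"
    using add_mono[of x "max x y" y "max x y"] by (simp add: mult_2)
  then have "epowr (x + y) b \<le> epowr (ennreal 2 * max x y) b" by (rule epowr_mono[OF assms])
  also have "\<dots> = ennreal (2 powr b) * epowr (max x y) b" by (rule epowr_cmult) simp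
  also have "epowr (max x y) b \<le> epowr x b + epowr y b"
    by (cases "x \<le> y") (auto simp: max_def add_increasing add_increasing2)
  finally show ?thesis by (simp add: mult_left_mono)
qed

lemma Lp_norm_mono_AE:
  assumes "0 < p" "AE x in lebesgue. F x \<le> G x"
  shows "Lp_norm p F \<le> Lp_norm p G"
  unfolding Lp_norm_def
proof (intro epowr_mono nn_integral_mono_AE)
  show "AE x in lebesgue. epowr (F x) p \<le> epowr (G x) p"
    using assms(2) by eventually_elim (use assms(1) in \<open>simp add: epowr_mono\<close>)
qed (use assms in auto)

lemma Lp_norm_cmult:
  assumes "0 < p" "0 < c" "F \<in> borel_measurable lebesgue"
  shows "Lp_norm p (\<lambda>x. ennreal c * F x) = ennreal c * Lp_norm p F"
proof -
  have "(\<integral>\<^sup>+x. epowr (ennreal c * F x) p \<partial>lebesgue) = ennreal (c powr p) * (\<integral>\<^sup>+x. epowr (F x) p \<partial>lebesgue)"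
    unfolding epowr_cmult[OF assms(2)] using measurable_epowr[OF assms(3)] by (rule nn_integral_cmult)
  then show ?thesis using assms by (simp add: Lp_norm_def epowr_cmult powr_powr)
qed

lemma Lp_norm_finite_iff: "Lp_norm p F < top \<longleftrightarrow> (\<integral>\<^sup>+x. epowr (F x) p \<partial>lebesgue) < top"
  unfolding Lp_norm_def by (rule epowr_less_top_iff)

lemma Lp_norm_finite_AE:
  assumes "Lp_norm p F < top" "F \<in> borel_measurable lebesgue"
  shows "AE x in lebesgue. F x < top"
proof -
  have "AE x in lebesgue. epowr (F x) p \<noteq> \<infinity>"
    using assms measurable_epowr[OF assms(2)] by (intro nn_integral_PInf_AE) (auto simp: Lp_norm_finite_iff)
  then show ?thesis
    by eventually_elim (metis epowr_less_top_iff infinity_ennreal_def less_top)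
qed

lemma Lp_norm_add_finite:
  assumes "0 < p" "Lp_norm p F < top" "Lp_norm p G < top"
    and [measurable]: "F \<in> borel_measurable lebesgue" "G \<in> borel_measurable lebesgue"
  shows "Lp_norm p (\<lambda>x. F x + G x) < top"
proof -
  have "(\<integral>\<^sup>+x. epowr (F x + G x) p \<partial>lebesgue) \<le> (\<integral>\<^sup>+x. ennreal (2 powr p) * (epowr (F x) p + epowr (G x) p) \<partial>lebesgue)"
    using assms by (intro nn_integral_mono epowr_add_le) auto
  also have "\<dots> = ennreal (2 powr p) * ((\<integral>\<^sup>+x. epowr (F x) p \<partial>lebesgue) + (\<integral>\<^sup>+x. epowr (G x) p \<partial>lebesgue))"
    by (subst nn_integral_cmult, measurable, subst nn_integral_add) measurable
  also have "\<dots> < top" using assms by (simp add: Lp_norm_finite_iff ennreal_mult_less_top)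
  finally show ?thesis by (simp add: Lp_norm_finite_iff)
qed

lemma kernel_integrable:
  fixes x :: "real^'n"
  assumes m: "real CARD('n) < m"
  shows "(\<integral>\<^sup>+y. ennreal ((1 + norm (x - y)) powr (- m)) \<partial>lebesgue) < top"
proof -
  let ?q = "2 powr (real CARD('n) - m)" and ?v = "vball TYPE(real^'n)"
  have q: "0 \<le> ?q" "?q < 1" using m powr_less_cancel_iff[of 2 "real CARD('n) - m" 0] by auto
  have m0: "0 < m" using m of_nat_0_le_iff[of "CARD('n)", where 'a=real] by linarith
  have "(\<integral>\<^sup>+y. ennreal ((1 + norm (x - y)) powr (- m)) \<partial>lebesgue)
    \<le> (\<integral>\<^sup>+y. (\<Sum>j. ennreal (2 powr m * (2 powr (- m)) ^ j) * indicator (ball x (2 ^ j)) y) \<partial>lebesgue)"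
    using kernel_le_sum[of 1 m x] m0 by (intro nn_integral_mono) simp
  also have "\<dots> = (\<Sum>j. (\<integral>\<^sup>+y. ennreal (2 powr m * (2 powr (- m)) ^ j) * indicator (ball x (2 ^ j)) y \<partial>lebesgue))"
    by (rule nn_integral_suminf) (intro borel_measurable_times_ennreal borel_measurable_const borel_measurable_indicator, simp)
  also have "\<dots> = (\<Sum>j. ennreal (2 powr m * ?v 1 * ?q ^ j))"
  proof (rule suminf_cong)
    fix j
    have "(\<integral>\<^sup>+y. ennreal (2 powr m * (2 powr (- m)) ^ j) * indicator (ball x (2 ^ j)) y \<partial>lebesgue)
      = ennreal (2 powr m * (2 powr (- m)) ^ j) * emeasure lebesgue (ball x (2 ^ j))"
      by (rule nn_integral_cmult_indicator) simp
    also have "\<dots> = ennreal (2 powr m * (2 powr (- m)) ^ j * ?v (2 ^ j * 1))"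
      by (simp add: emeasure_lebesgue_ball ennreal_mult' del: emeasure_completion)
    also have "2 powr m * (2 powr (- m)) ^ j * ?v (2 ^ j * 1) = 2 powr m * ?v 1 * ?q ^ j"
    proof -
      have 2: "?v (2 ^ j * 1) = (2 powr real CARD('n)) ^ j * ?v 1"
        unfolding vball_mult by (simp add: powr_realpow power_mult[symmetric] mult.commute)
      have 3: "?q ^ j = (2 powr real CARD('n)) ^ j * (2 powr (- m)) ^ j"
        unfolding power_mult_distrib[symmetric] powr_add[symmetric] by simp
      show ?thesis unfolding 2 3 by (simp only: mult_ac)
    qed
    finally show "(\<integral>\<^sup>+y. ennreal (2 powr m * (2 powr (- m)) ^ j) * indicator (ball x (2 ^ j)) y \<partial>lebesgue) = ennreal (2 powr m * ?v 1 * ?q ^ j)" .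
  qed
  also have "\<dots> = ennreal (2 powr m * ?v 1 * (1 / (1 - ?q)))"
  proof (rule suminf_ennreal_eq)
    have "0 \<le> ?v 1" using vball_pos[of 1, where 'n='n] by linarith
    with q show "0 \<le> 2 powr m * ?v 1 * ?q ^ j" for j by simp
    show "(\<lambda>j. 2 powr m * ?v 1 * ?q ^ j) sums (2 powr m * ?v 1 * (1 / (1 - ?q)))"
      by (intro sums_mult geometric_sums) (use q in auto)
  qed
  finally show ?thesis using ennreal_less_top order_le_less_trans by blast
qed

lemma weight_measurable:
  fixes f :: "real^'n \<Rightarrow> complex"
  assumes "f \<in> borel_measurable lebesgue"
  shows "(\<lambda>y. ennreal (norm (f y) * (1 + norm y) powr (- m))) \<in> borel_measurable lebesgue"
proof -
  have "(\<lambda>y::real^'n. (1 + norm y) powr (- m)) \<in> borel_measurable lebesgue"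
    by (rule measurable_completion) measurable
  with assms show ?thesis
    by (intro measurable_compose[OF _ measurable_ennreal] borel_measurable_times borel_measurable_norm) auto
qed

definition kernel_mass :: "(real^'n) itself \<Rightarrow> real \<Rightarrow> real" where
  "kernel_mass _ m = enn2real (\<integral>\<^sup>+y. ennreal ((1 + norm (y::real^'n)) powr (- m)) \<partial>lebesgue)"

lemma kernel_mass:
  "real CARD('n) < m \<Longrightarrow> (\<integral>\<^sup>+y. ennreal ((1 + norm (y::real^'n)) powr (- m)) \<partial>lebesgue) = ennreal (kernel_mass TYPE(real^'n) m)"
  "0 \<le> kernel_mass TYPE(real^'n) m"
  using kernel_integrable[of m "0::real^'n"] by (auto simp: kernel_mass_def)

text \<open>Only the size of the test function enters, none of its derivatives. All later estimates
  for distributions given by functions inherit this, so that they apply to test classes of any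
  smoothness order.\<close>

lemma weighted_dist_of:
  fixes f :: "real^'n \<Rightarrow> complex"
  assumes fm [measurable]: "f \<in> borel_measurable lebesgue" and w0: "0 \<le> w"
    and w: "(\<integral>\<^sup>+y. ennreal (norm (f y) * (1 + norm y) powr (- m)) \<partial>lebesgue) \<le> ennreal w"
    and \<phi>: "\<phi> \<in> schwartz" and B: "\<And>x. norm (\<phi> x) \<le> B * (1 + norm x) powr (- m)"
  shows "integrable lebesgue (\<lambda>x. f x * \<phi> x)" "norm (dist_of f \<phi>) \<le> B * w"
proof -
  have [measurable]: "\<phi> \<in> borel_measurable lebesgue"
    by (rule measurable_completion) (use schwartz_borel[OF \<phi>] in simp)
  have B0: "0 \<le> B" using order_trans[OF norm_ge_zero B[of 0]] by simp
  have "(\<integral>\<^sup>+x. ennreal (norm (f x * \<phi> x)) \<partial>lebesgue) \<le> (\<integral>\<^sup>+y. ennreal B * ennreal (norm (f y) * (1 + norm y) powr (- m)) \<partial>lebesgue)"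
  proof (rule nn_integral_mono)
    fix y
    have "norm (f y * \<phi> y) \<le> B * (norm (f y) * (1 + norm y) powr (- m))"
      using mult_left_mono[OF B[of y], of "norm (f y)"] by (simp add: norm_mult mult_ac)
    then show "ennreal (norm (f y * \<phi> y)) \<le> ennreal B * ennreal (norm (f y) * (1 + norm y) powr (- m))"
      using B0 by (simp add: ennreal_mult[symmetric] ennreal_leI)
  qed
  also have "\<dots> = ennreal B * (\<integral>\<^sup>+y. ennreal (norm (f y) * (1 + norm y) powr (- m)) \<partial>lebesgue)"
    by (rule nn_integral_cmult) (rule weight_measurable[OF fm])
  also have "\<dots> \<le> ennreal B * ennreal w" by (intro mult_left_mono w) simp
  also have "\<dots> = ennreal (B * w)" using B0 w0 by (simp add: ennreal_mult)
  finally have le: "(\<integral>\<^sup>+x. ennreal (norm (f x * \<phi> x)) \<partial>lebesgue) \<le> ennreal (B * w)" .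
  then have "(\<integral>\<^sup>+x. ennreal (norm (f x * \<phi> x)) \<partial>lebesgue) < \<infinity>"
    unfolding infinity_ennreal_def using ennreal_less_top by (rule order_le_less_trans)
  then show int: "integrable lebesgue (\<lambda>x. f x * \<phi> x)"
    by (intro integrableI_bounded) measurable
  have "ennreal (norm (dist_of f \<phi>)) \<le> ennreal (B * w)"
    unfolding dist_of_def using integral_norm_bound_ennreal[OF int] le by (rule order_trans)
  then show "norm (dist_of f \<phi>) \<le> B * w" using B0 w0 by (simp add: ennreal_le_iff)
qed

lemma weighted_tempered:
  fixes f :: "real^'n \<Rightarrow> complex"
  assumes fm: "f \<in> borel_measurable lebesgue" and m: "0 < m"
    and w: "(\<integral>\<^sup>+y. ennreal (norm (f y) * (1 + norm y) powr (- m)) \<partial>lebesgue) < top"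
  shows "locally_integrable f" "defines_tempered f"
proof -
  obtain w where w: "(\<integral>\<^sup>+y. ennreal (norm (f y) * (1 + norm y) powr (- m)) \<partial>lebesgue) = ennreal w" "0 \<le> w"
    using assms(3) by (cases "\<integral>\<^sup>+y. ennreal (norm (f y) * (1 + norm y) powr (- m)) \<partial>lebesgue") auto
  show "locally_integrable f"
    unfolding locally_integrable_def
  proof (intro allI impI)
    fix K :: "(real^'n) set" assume K: "compact K"
    then obtain R where R: "\<And>x. x \<in> K \<Longrightarrow> norm x \<le> R" "0 < R"
      using compact_imp_bounded[OF K] unfolding bounded_pos by blast
    have Km[measurable]: "K \<in> sets lebesgue" using K by (simp add: borel_compact)
    have "(\<integral>\<^sup>+x. ennreal (norm (indicat_real K x *\<^sub>R f x)) \<partial>lebesgue)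
      \<le> (\<integral>\<^sup>+y. ennreal ((1 + R) powr m) * ennreal (norm (f y) * (1 + norm y) powr (- m)) \<partial>lebesgue)"
    proof (rule nn_integral_mono)
      fix y
      show "ennreal (norm (indicat_real K y *\<^sub>R f y)) \<le> ennreal ((1 + R) powr m) * ennreal (norm (f y) * (1 + norm y) powr (- m))"
      proof (cases "y \<in> K")
        case True
        have "(1 + norm y) powr m \<le> (1 + R) powr m" using R True m by (intro powr_mono2) auto
        then have "(1 + norm y) powr m * ((1 + norm y) powr (- m) * norm (f y)) \<le> (1 + R) powr m * ((1 + norm y) powr (- m) * norm (f y))"
          by (intro mult_right_mono) auto
        moreover have "(1 + norm y) powr m * (1 + norm y) powr (- m) = 1"
          unfolding powr_add[symmetric] using norm_ge_zero[of y] by (simp add: add_nonneg_eq_0_iff)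
        ultimately have "norm (f y) \<le> (1 + R) powr m * (norm (f y) * (1 + norm y) powr (- m))"
          by (simp only: mult.assoc[symmetric] mult_1_left mult.commute[of "norm (f y)"])
        then show ?thesis using True by (simp add: ennreal_mult[symmetric] ennreal_leI)
      qed simp
    qed
    also have "\<dots> = ennreal ((1 + R) powr m) * ennreal w"
      unfolding w(1)[symmetric] by (rule nn_integral_cmult) (rule weight_measurable[OF fm])
    also have "\<dots> < \<infinity>" by (simp add: ennreal_mult_less_top)
    finally have fin: "(\<integral>\<^sup>+x. ennreal (norm (indicat_real K x *\<^sub>R f x)) \<partial>lebesgue) < \<infinity>" .
    show "set_integrable lebesgue K f"
      unfolding set_integrable_def
      by (rule integrableI_bounded[OF _ fin]) (use fm in measurable)
  qed
  have int: "integrable lebesgue (\<lambda>x. f x * \<phi> x)" if \<phi>: "\<phi> \<in> schwartz" for \<phi>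
  proof -
    obtain C where C: "sbound 0 m C \<phi>" using schwartzE[OF \<phi>] .
    show ?thesis by (rule weighted_dist_of(1)[OF fm w(2) eq_refl[OF w(1)] \<phi>]) (rule sbound0[OF C])
  qed
  show "defines_tempered f"
    unfolding defines_tempered_def tempered_def
  proof (intro conjI ballI allI)
    fix \<phi> \<psi> :: "real^'n \<Rightarrow> complex" assume "\<phi> \<in> schwartz" "\<psi> \<in> schwartz"
    then show "dist_of f (\<lambda>x. \<phi> x + \<psi> x) = dist_of f \<phi> + dist_of f \<psi>"
      using int by (simp add: dist_of_def distrib_left)
  next
    fix c and \<phi> :: "real^'n \<Rightarrow> complex" assume "\<phi> \<in> schwartz"
    have "(\<lambda>x. f x * (c * \<phi> x)) = (\<lambda>x. c * (f x * \<phi> x))" by (simp add: mult_ac)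
    then show "dist_of f (\<lambda>x. c * \<phi> x) = c * dist_of f \<phi>" by (simp add: dist_of_def)
  next
    have "ennreal (norm (dist_of f \<phi>)) \<le> ennreal w * schwartz_norm 0 m \<phi>" if \<phi>: "\<phi> \<in> schwartz" for \<phi>
    proof -
      obtain C where C: "0 < C" "sbound 0 m C \<phi>" using schwartzE[OF \<phi>] .
      then have "schwartz_norm 0 m \<phi> \<le> ennreal C" by (simp add: schwartz_norm_le_iff)
      then have "schwartz_norm 0 m \<phi> < top" using ennreal_less_top by (rule order_le_less_trans)
      then obtain D where D: "schwartz_norm 0 m \<phi> = ennreal D" "0 \<le> D"
        by (cases "schwartz_norm 0 m \<phi>") auto
      then have Db: "sbound 0 m D \<phi>" using schwartz_norm_le_iff[of D 0 m \<phi>] by simp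
      have "norm (dist_of f \<phi>) \<le> D * w"
        by (rule weighted_dist_of(2)[OF fm w(2) eq_refl[OF w(1)] \<phi>]) (rule sbound0[OF Db])
      then show ?thesis using D w by (simp add: ennreal_mult[symmetric] ennreal_leI mult.commute)
    qed
    with m show "\<exists>C k m. 0 < m \<and> (\<forall>\<phi>\<in>schwartz. ennreal (norm (dist_of f \<phi>)) \<le> ennreal C * schwartz_norm k m \<phi>)"
      by blast
  qed (use int in auto)
qed

lemma const_weighted:
  assumes "real CARD('n) < m"
  shows "(\<integral>\<^sup>+y. ennreal (norm (c::complex) * (1 + norm (y::real^'n)) powr (- m)) \<partial>lebesgue) = ennreal (norm c * kernel_mass TYPE(real^'n) m)"
proof -
  have "(\<integral>\<^sup>+y. ennreal (norm c * (1 + norm (y::real^'n)) powr (- m)) \<partial>lebesgue)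
     = (\<integral>\<^sup>+y. ennreal (norm c) * ennreal ((1 + norm (y::real^'n)) powr (- m)) \<partial>lebesgue)"
    by (simp add: ennreal_mult)
  also have "\<dots> = ennreal (norm c) * (\<integral>\<^sup>+y. ennreal ((1 + norm (y::real^'n)) powr (- m)) \<partial>lebesgue)"
    using weight_measurable[of "\<lambda>_::real^'n. 1" m] by (intro nn_integral_cmult) simp
  also have "\<dots> = ennreal (norm c * kernel_mass TYPE(real^'n) m)"
    unfolding kernel_mass(1)[OF assms] by (simp add: ennreal_mult kernel_mass(2))
  finally show ?thesis .
qed

lemma schwartz_integral:
  fixes \<phi> :: "real^'n \<Rightarrow> complex"
  assumes \<phi>: "\<phi> \<in> schwartz"
  shows "integrable lebesgue \<phi>"
    and "real CARD('n) < m \<Longrightarrow> (\<And>x. norm (\<phi> x) \<le> B * (1 + norm x) powr (- m)) \<Longrightarrow>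
      norm (LINT y|lebesgue. \<phi> y) \<le> B * kernel_mass TYPE(real^'n) m"
proof -
  obtain C where C: "sbound 0 (real CARD('n) + 1) C \<phi>" using schwartzE[OF \<phi>] .
  have "integrable lebesgue (\<lambda>x. 1 * \<phi> x)"
    by (rule weighted_dist_of(1)[OF _ kernel_mass(2)[of "real CARD('n) + 1", where 'n='n] _ \<phi> sbound0[OF C]])
      (use const_weighted[of "real CARD('n) + 1" 1, where 'n='n] in simp_all)
  then show "integrable lebesgue \<phi>" by simp
  show "norm (LINT y|lebesgue. \<phi> y) \<le> B * kernel_mass TYPE(real^'n) m"
    if "real CARD('n) < m" "\<And>x. norm (\<phi> x) \<le> B * (1 + norm x) powr (- m)"
  proof -
    have "norm (dist_of (\<lambda>_. 1) \<phi>) \<le> B * kernel_mass TYPE(real^'n) m"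
      by (rule weighted_dist_of(2)[OF _ kernel_mass(2)[of m, where 'n='n] _ \<phi> that(2)])
        (use const_weighted[of m 1, where 'n='n] that(1) in simp_all)
    then show ?thesis by (simp add: dist_of_def)
  qed
qed

section \<open>Dilated test functions: membership, integral and size\<close>

lemma dilate_eq:
  fixes \<phi> :: "real^'n \<Rightarrow> complex"
  assumes "0 < t"
  shows "(\<lambda>y. dilate t \<phi> (x - y)) = (\<lambda>y. of_real (1 / t ^ CARD('n)) * \<phi> (x /\<^sub>R t + (- 1 / t) *\<^sub>R y))"
  by (rule ext) (simp add: dilate_def scaleR_conv_of_real[where 'a=complex] scaleR_diff_right divide_inverse)

lemma dilate_schwartz:
  assumes "\<phi> \<in> schwartz" "0 < t"
  shows "(\<lambda>y. dilate t \<phi> (x - y)) \<in> schwartz"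
  unfolding dilate_eq[OF assms(2)] using assms by (intro schwartz_affine) auto

lemma integral_affine:
  fixes \<phi> :: "real^'n \<Rightarrow> complex"
  assumes \<phi>: "\<phi> \<in> schwartz" and b: "b \<noteq> 0"
  shows "(LINT y|lebesgue. \<phi> y) = of_real (\<bar>b\<bar> ^ CARD('n)) * (LINT y|lebesgue. \<phi> (a + b *\<^sub>R y))"
proof -
  have m[measurable]: "\<phi> \<in> borel_measurable borel" using \<phi> by (rule schwartz_borel)
  let ?T = "\<lambda>y::real^'n. a + b *\<^sub>R y"
  have "(LINT y|lebesgue. \<phi> y) = (LINT y|lborel. \<phi> y)" by (rule integral_completion) simp
  also have "\<dots> = (LINT y|density (distr lborel borel ?T) (\<lambda>_. ennreal (\<bar>b\<bar> ^ DIM(real^'n))). \<phi> y)"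
    using lborel_affine[OF b, of a] by simp
  also have "\<dots> = (LINT y|distr lborel borel ?T. (\<bar>b\<bar> ^ DIM(real^'n)) *\<^sub>R \<phi> y)"
    by (subst integral_density) auto
  also have "\<dots> = (LINT y|lborel. (\<bar>b\<bar> ^ DIM(real^'n)) *\<^sub>R \<phi> (?T y))"
    by (subst integral_distr) auto
  also have "\<dots> = of_real (\<bar>b\<bar> ^ CARD('n)) * (LINT y|lborel. \<phi> (?T y))"
    by (simp add: scaleR_conv_of_real[where 'a=complex])
  also have "(LINT y|lborel. \<phi> (?T y)) = (LINT y|lebesgue. \<phi> (?T y))"
    by (intro integral_completion[symmetric]) measurable
  finally show ?thesis .
qed

lemma integral_dilate:
  fixes \<phi> :: "real^'n \<Rightarrow> complex"
  assumes \<phi>: "\<phi> \<in> schwartz" and t: "0 < t"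
  shows "(LINT y|lebesgue. dilate t \<phi> (x - y)) = (LINT y|lebesgue. \<phi> y)"
  unfolding dilate_eq[OF t] using t integral_affine[OF \<phi>, of "- 1 / t" "x /\<^sub>R t"]
  by (simp add: power_one_over)

lemma dilate_bound:
  fixes \<phi> :: "real^'n \<Rightarrow> complex"
  assumes "\<And>z. norm (\<phi> z) \<le> B * (1 + norm z) powr (- m)" "0 < t"
  shows "norm (dilate t \<phi> (x - y)) \<le> B / t ^ CARD('n) * (1 + norm (x - y) / t) powr (- m)"
proof -
  have "norm (dilate t \<phi> (x - y)) = (1 / t ^ CARD('n)) * norm (\<phi> ((x - y) /\<^sub>R t))"
    using assms(2) by (simp add: dilate_def)
  also have "\<dots> \<le> (1 / t ^ CARD('n)) * (B * (1 + norm ((x - y) /\<^sub>R t)) powr (- m))"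
    using assms(2) by (intro mult_left_mono assms(1)) simp
  also have "norm ((x - y) /\<^sub>R t) = norm (x - y) / t"
    using assms(2) by (simp add: divide_inverse mult.commute)
  finally have *: "norm (dilate t \<phi> (x - y)) \<le> (1 / t ^ CARD('n)) * (B * (1 + norm (x - y) / t) powr (- m))" .
  have "B / t ^ CARD('n) * X = (1 / t ^ CARD('n)) * (B * X)" for X :: real by simp
  with * show ?thesis by (simp only:)
qed

section \<open>Convolutions of Hajlasz functions\<close>

lemma AE_lebesgue_ex:
  assumes "AE x in (lebesgue :: (real^'n) measure). P x"
  shows "\<exists>x. P x"
proof (rule ccontr)
  assume n: "\<not> (\<exists>x. P x)"
  obtain N :: "(real^'n) set" where "N \<in> null_sets lebesgue" "{x \<in> space lebesgue. \<not> P x} \<subseteq> N"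
    using assms unfolding eventually_ae_filter by blast
  with n have "UNIV \<in> null_sets (lebesgue :: (real^'n) measure)" by (simp add: top.extremum_unique)
  then show False by (simp add: null_sets_def)
qed

locale hajlasz_fun = hajlasz_pair f h E s a
  for f :: "real^'n \<Rightarrow> complex" and h E s a +
  assumes fm: "f \<in> borel_measurable lebesgue"
begin

text \<open>One point with finite maximal function is enough: the kernel estimate at unit scale
  around it is recentred at the origin by 1 + |x - y| \<le> (1 + |x|) (1 + |y|), and the anchor
  value contributes an integrable constant multiple of the weight.\<close>

lemma weighted_finite:
  assumes hl: "hl_max h x < top" and m: "real CARD('n) + s < m"
  shows "(\<integral>\<^sup>+y. ennreal (norm (f y) * (1 + norm y) powr (- m)) \<partial>lebesgue) < top"
proof -
  obtain M0 where M0: "hl_max h x = ennreal M0" "0 \<le> M0" using hl by (cases "hl_max h x") auto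
  have hM: "hl_max h x \<le> ennreal (M0 + 1)" "0 < M0 + 1" using M0 by (auto intro!: ennreal_leI)
  have m0: "0 < m" and mn: "real CARD('n) < m" using m s of_nat_0_le_iff[of "CARD('n)", where 'a=real] by linarith+
  obtain x0 where x0:
    "(\<integral>\<^sup>+y. ennreal (norm (f y - f x0) * (1 + norm (x - y) / 1) powr (- m)) \<partial>lebesgue)
       \<le> ennreal (kernel_const CARD('n) s a m * 1 ^ CARD('n) * 1 powr s * (M0 + 1) powr a)"
    by (rule kernel_estimate[OF fm zero_less_one hM(2) hM(1) m]) (rule that, assumption)
  let ?c = "(1 + norm x) powr m"
  let ?F = "\<lambda>y. ennreal (norm (f y - f x0) * (1 + norm (x - y)) powr (- m))"
  let ?G = "\<lambda>y::real^'n. ennreal (norm (f x0) * (1 + norm y) powr (- m))"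
  have Fm: "?F \<in> borel_measurable lebesgue"
  proof -
    have "(\<lambda>y::real^'n. (1 + norm (x - y)) powr (- m)) \<in> borel_measurable lebesgue"
      by (rule measurable_completion) measurable
    with fm show ?thesis
      by (intro measurable_compose[OF _ measurable_ennreal] borel_measurable_times borel_measurable_norm borel_measurable_diff) auto
  qed
  have Gm: "?G \<in> borel_measurable lebesgue" by (rule weight_measurable[of "\<lambda>_::real^'n. f x0"]) simp
  have "(\<integral>\<^sup>+y. ennreal (norm (f y) * (1 + norm y) powr (- m)) \<partial>lebesgue) \<le> (\<integral>\<^sup>+y. ennreal ?c * ?F y + ?G y \<partial>lebesgue)"
  proof (rule nn_integral_mono)
    fix y
    have "1 + norm (x - y) \<le> 1 + norm x + norm y + norm x * norm y"
      using norm_triangle_ineq4[of x y] mult_nonneg_nonneg[OF norm_ge_zero norm_ge_zero, of x y] by linarith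
    also have "\<dots> = (1 + norm x) * (1 + norm y)" by (simp add: algebra_simps)
    finally have "((1 + norm x) * (1 + norm y)) powr (- m) \<le> (1 + norm (x - y)) powr (- m)"
      using m0 by (intro powr_mono2') (auto simp: add_pos_nonneg)
    then have "?c * (((1 + norm x) * (1 + norm y)) powr (- m)) \<le> ?c * (1 + norm (x - y)) powr (- m)"
      by (intro mult_left_mono) auto
    moreover have "?c * (((1 + norm x) * (1 + norm y)) powr (- m)) = (1 + norm y) powr (- m)"
    proof -
      have "?c * (1 + norm x) powr (- m) = 1"
        unfolding powr_add[symmetric] using norm_ge_zero[of x] by (simp add: add_nonneg_eq_0_iff)
      then show ?thesis unfolding powr_mult mult.assoc[symmetric] by simp
    qed
    ultimately have le: "(1 + norm y) powr (- m) \<le> ?c * (1 + norm (x - y)) powr (- m)" by simp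
    have "norm (f y) * (1 + norm y) powr (- m) \<le> (norm (f y - f x0) + norm (f x0)) * (1 + norm y) powr (- m)"
      using norm_triangle_ineq[of "f y - f x0" "f x0"] by (intro mult_right_mono) auto
    also have "\<dots> \<le> norm (f y - f x0) * (?c * (1 + norm (x - y)) powr (- m)) + norm (f x0) * (1 + norm y) powr (- m)"
      unfolding distrib_right by (intro add_right_mono mult_left_mono le) simp
    finally have "ennreal (norm (f y) * (1 + norm y) powr (- m)) \<le>
       ennreal (?c * (norm (f y - f x0) * (1 + norm (x - y)) powr (- m)) + norm (f x0) * (1 + norm y) powr (- m))"
      by (intro ennreal_leI) (simp only: mult_ac)
    then show "ennreal (norm (f y) * (1 + norm y) powr (- m)) \<le> ennreal ?c * ?F y + ?G y"
      by (simp add: ennreal_mult')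
  qed
  also have "\<dots> = ennreal ?c * integral\<^sup>N lebesgue ?F + integral\<^sup>N lebesgue ?G"
  proof -
    have "(\<integral>\<^sup>+y. ennreal ?c * ?F y + ?G y \<partial>lebesgue) = (\<integral>\<^sup>+y. ennreal ?c * ?F y \<partial>lebesgue) + integral\<^sup>N lebesgue ?G"
      by (rule nn_integral_add) (intro borel_measurable_times_ennreal borel_measurable_const Fm, rule Gm)
    then show ?thesis unfolding nn_integral_cmult[OF Fm] .
  qed
  also have "\<dots> < top"
  proof -
    have "integral\<^sup>N lebesgue ?F < top" using x0 ennreal_less_top order_le_less_trans by (simp only: div_by_1) blast
    then show ?thesis unfolding const_weighted[OF mn] by (simp add: ennreal_mult_less_top)
  qed
  finally show ?thesis .
qed

text \<open>Subtracting the constant \<open>f x0\<close> from f inside the pairing leaves a kernel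
  integral. The factor t^n of \<open>kernel_estimate\<close> cancels the normalisation of the
  dilation, leaving t^s.\<close>

lemma dist_of_dilate:
  assumes \<phi>: "\<phi> \<in> schwartz" and B: "\<And>z. norm (\<phi> z) \<le> B * (1 + norm z) powr (- m)"
    and m: "real CARD('n) + s < m" and t: "0 < t" and M: "0 < M" and hl: "hl_max h x \<le> ennreal M"
  obtains x0 where "\<And>x'. x' \<in> ball x t - E \<Longrightarrow> norm (f x' - f x0) \<le> poincare_const s a * t powr s * M powr (a - 1) * (M + h x')"
    "norm (dist_of f (\<lambda>y. dilate t \<phi> (x - y)) - f x0 * (LINT y|lebesgue. \<phi> y)) \<le> B * kernel_const CARD('n) s a m * t powr s * M powr a"
proof -
  let ?\<psi> = "\<lambda>y. dilate t \<phi> (x - y)" and ?n = "CARD('n)"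
  let ?k = "kernel_const CARD('n) s a m * t ^ CARD('n) * t powr s * M powr a"
  have \<psi>: "?\<psi> \<in> schwartz" using \<phi> t by (rule dilate_schwartz)
  have B0: "0 \<le> B" using order_trans[OF norm_ge_zero B[of 0]] by simp
  have k0: "0 \<le> ?k" using kernel_const_pos[OF m, of a] t by simp
  have hx: "hl_max h x < top" using hl ennreal_less_top order_le_less_trans by blast
  obtain x0 where x0: "\<And>x'. x' \<in> ball x t - E \<Longrightarrow> norm (f x' - f x0) \<le> poincare_const s a * t powr s * M powr (a - 1) * (M + h x')"
    "(\<integral>\<^sup>+y. ennreal (norm (f y - f x0) * (1 + norm (x - y) / t) powr (- m)) \<partial>lebesgue) \<le> ennreal ?k"
    by (rule kernel_estimate[OF fm t M hl m]) (rule that, assumption+)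
  obtain w where w: "(\<integral>\<^sup>+y. ennreal (norm (f y) * (1 + norm y) powr (- m)) \<partial>lebesgue) = ennreal w" "0 \<le> w"
    using weighted_finite[OF hx m] by (cases "\<integral>\<^sup>+y. ennreal (norm (f y) * (1 + norm y) powr (- m)) \<partial>lebesgue") auto
  have i1: "integrable lebesgue (\<lambda>y. f y * ?\<psi> y)"
  proof -
    obtain C where C: "sbound 0 m C ?\<psi>" using schwartzE[OF \<psi>] .
    show ?thesis by (rule weighted_dist_of(1)[OF fm w(2) eq_refl[OF w(1)] \<psi>]) (rule sbound0[OF C])
  qed
  have i2: "integrable lebesgue ?\<psi>" using \<psi> by (rule schwartz_integral(1))
  have i3: "integrable lebesgue (\<lambda>y. (f y - f x0) * ?\<psi> y)"
    using Bochner_Integration.integrable_diff[OF i1 integrable_mult_right[OF i2, of "f x0"]] by (simp add: left_diff_distrib)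
  have eq: "dist_of f ?\<psi> - f x0 * (LINT y|lebesgue. \<phi> y) = (LINT y|lebesgue. (f y - f x0) * ?\<psi> y)"
    unfolding dist_of_def left_diff_distrib integral_dilate[OF \<phi> t, symmetric, of x]
    using i1 i2 by (subst Bochner_Integration.integral_diff) auto
  have km: "(\<lambda>y. ennreal (norm (f y - f x0) * (1 + norm (x - y) / t) powr (- m))) \<in> borel_measurable lebesgue"
  proof -
    have "(\<lambda>y::real^'n. (1 + norm (x - y) / t) powr (- m)) \<in> borel_measurable lebesgue"
      by (rule measurable_completion) measurable
    with fm show ?thesis
      by (intro measurable_compose[OF _ measurable_ennreal] borel_measurable_times borel_measurable_norm borel_measurable_diff) auto
  qed
  have "(\<integral>\<^sup>+y. ennreal (norm ((f y - f x0) * ?\<psi> y)) \<partial>lebesgue) \<le>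
     (\<integral>\<^sup>+y. ennreal (B / t ^ ?n) * ennreal (norm (f y - f x0) * (1 + norm (x - y) / t) powr (- m)) \<partial>lebesgue)"
  proof (rule nn_integral_mono)
    fix y
    have "norm ((f y - f x0) * ?\<psi> y) \<le> norm (f y - f x0) * (B / t ^ ?n * (1 + norm (x - y) / t) powr (- m))"
      unfolding norm_mult by (intro mult_left_mono dilate_bound B t) simp
    also have "\<dots> = B / t ^ ?n * (norm (f y - f x0) * (1 + norm (x - y) / t) powr (- m))" by simp
    finally show "ennreal (norm ((f y - f x0) * ?\<psi> y)) \<le> ennreal (B / t ^ ?n) * ennreal (norm (f y - f x0) * (1 + norm (x - y) / t) powr (- m))"
      using B0 t by (subst ennreal_mult'[symmetric]) (auto intro: ennreal_leI)
  qed
  also have "\<dots> = ennreal (B / t ^ ?n) * (\<integral>\<^sup>+y. ennreal (norm (f y - f x0) * (1 + norm (x - y) / t) powr (- m)) \<partial>lebesgue)"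
    by (rule nn_integral_cmult) (rule km)
  also have "\<dots> \<le> ennreal (B / t ^ ?n) * ennreal ?k" by (intro mult_left_mono x0) simp
  also have "\<dots> = ennreal (B * kernel_const CARD('n) s a m * t powr s * M powr a)"
    using B0 t by (subst ennreal_mult'[symmetric]) (auto simp: mult.assoc)
  finally have "ennreal (norm (LINT y|lebesgue. (f y - f x0) * ?\<psi> y)) \<le> ennreal (B * kernel_const CARD('n) s a m * t powr s * M powr a)"
    using integral_norm_bound_ennreal[OF i3] order_trans by blast
  then have "norm (LINT y|lebesgue. (f y - f x0) * ?\<psi> y) \<le> B * kernel_const CARD('n) s a m * t powr s * M powr a"
    using B0 kernel_const_pos[OF m, of a] by (simp add: ennreal_le_iff)
  then show ?thesis unfolding eq[symmetric] by (intro that[OF x0(1)]) auto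
qed

end

lemma ennreal_pos_mult_top: "0 < c \<Longrightarrow> ennreal c * top = top"
  by (simp add: ennreal_mult_top)

text \<open>The Poincare argument runs with a positive \<open>M\<close>. Applying it to M + e and
  letting e tend to 0 also covers points where the maximal function vanishes.\<close>

lemma le_powr_limit:
  fixes X c M a :: real
  assumes "\<And>e. 0 < e \<Longrightarrow> X \<le> c * (M + e) powr a" "0 \<le> M" "0 < a"
  shows "X \<le> c * M powr a"
proof (rule tendsto_lowerbound)
  have "((\<lambda>e. M + e) \<longlongrightarrow> M + 0) (at_right 0)" by (intro tendsto_intros)
  then show "((\<lambda>e. c * (M + e) powr a) \<longlongrightarrow> c * M powr a) (at_right 0)"
    using assms by (intro tendsto_intros tendsto_powr') (auto simp: eventually_at_right_less intro!: eventually_mono[OF eventually_at_right_less[of 0]])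
  show "\<forall>\<^sub>F e in at_right 0. X \<le> c * (M + e) powr a"
    using eventually_at_right_less[of 0] by eventually_elim (rule assms(1))
qed simp

text \<open>The first summand is the error against the anchor value \<open>f x0\<close>. The second
  arises when \<open>f x\<close> replaces \<open>f x0\<close>: the pointwise Poincare bound, with M
  + h x \<le> 2 M, times the bound for the integral of the test function.\<close>

definition conv_const :: "(real^'n) itself \<Rightarrow> real \<Rightarrow> real \<Rightarrow> real \<Rightarrow> real" where
  "conv_const T s a m = kernel_const CARD('n) s a m + 2 * poincare_const s a * kernel_mass T m"

context hajlasz_fun
begin

lemma conv_const_ge:
  assumes "real CARD('n) + s < m"
  shows "kernel_const CARD('n) s a m \<le> conv_const TYPE(real^'n) s a m" "0 < conv_const TYPE(real^'n) s a m"
proof -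
  have "0 \<le> 2 * poincare_const s a * kernel_mass TYPE(real^'n) m"
    using K_pos kernel_mass(2)[of m, where 'n='n] by simp
  then show "kernel_const CARD('n) s a m \<le> conv_const TYPE(real^'n) s a m" "0 < conv_const TYPE(real^'n) s a m"
    unfolding conv_const_def using kernel_const_pos[OF assms, of a] by linarith+
qed

lemma dist_of_dilate_zero_mean:
  assumes \<phi>: "\<phi> \<in> schwartz" and B: "\<And>z. norm (\<phi> z) \<le> B * (1 + norm z) powr (- m)" and B0: "0 < B"
    and m: "real CARD('n) + s < m" and t: "0 < t" and z: "(LINT y|lebesgue. \<phi> y) = 0"
    and H: "hl_max h x \<le> H"
  shows "ennreal (norm (dist_of f (\<lambda>y. dilate t \<phi> (x - y))))
    \<le> ennreal (B * conv_const TYPE(real^'n) s a m * t powr s) * epowr H a"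
proof (cases H)
  case (real M)
  let ?c = "B * conv_const TYPE(real^'n) s a m * t powr s"
  have c: "0 < ?c" using conv_const_ge[OF m] B0 t by simp
  have lim: "norm (dist_of f (\<lambda>y. dilate t \<phi> (x - y))) \<le> ?c * (M + e) powr a" if e: "0 < e" for e
  proof -
    have hl: "hl_max h x \<le> ennreal (M + e)" "0 < M + e" using H real e order_trans[OF H] by (auto intro!: ennreal_leI)
    have "norm (dist_of f (\<lambda>y. dilate t \<phi> (x - y))) \<le> B * kernel_const CARD('n) s a m * t powr s * (M + e) powr a"
      by (rule dist_of_dilate[OF \<phi> B m t hl(2,1)]) (simp add: z)
    also have "\<dots> \<le> ?c * (M + e) powr a"
      using conv_const_ge[OF m] B0 by (intro mult_right_mono mult_left_mono) auto
    finally show ?thesis .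
  qed
  have "norm (dist_of f (\<lambda>y. dilate t \<phi> (x - y))) \<le> ?c * M powr a"
    by (rule le_powr_limit[OF lim]) (use real a_pos in simp_all)
  then show ?thesis using real c by (simp add: epowr_ennreal ennreal_mult'[symmetric] ennreal_leI less_imp_le)
next
  case top
  have "0 < B * conv_const TYPE(real^'n) s a m * t powr s" using conv_const_ge[OF m] B0 t by simp
  then show ?thesis unfolding top by (simp only: epowr_top ennreal_pos_mult_top top_greatest)
qed

text \<open>Besides the maximal function, the value \<open>h x\<close> has to be bounded by
  \<open>H\<close>, because x itself is now compared with the anchor and the Poincare bound there is
  proportional to M + h x.\<close>

lemma dist_of_dilate_approx:
  assumes \<phi>: "\<phi> \<in> schwartz" and B: "\<And>z. norm (\<phi> z) \<le> B * (1 + norm z) powr (- m)" and B0: "0 < B"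
    and m: "real CARD('n) + s < m" and t: "0 < t" and x: "x \<notin> E"
    and H: "hl_max h x \<le> H" "ennreal (h x) \<le> H"
  shows "ennreal (norm (dist_of f (\<lambda>y. dilate t \<phi> (x - y)) - f x * (LINT y|lebesgue. \<phi> y)))
    \<le> ennreal (B * conv_const TYPE(real^'n) s a m * t powr s) * epowr H a"
proof (cases H)
  case (real M)
  let ?c = "B * conv_const TYPE(real^'n) s a m * t powr s"
  let ?I = "LINT y|lebesgue. \<phi> y" and ?k = "kernel_mass TYPE(real^'n) m"
  let ?X = "norm (dist_of f (\<lambda>y. dilate t \<phi> (x - y)) - f x * ?I)"
  have c: "0 < ?c" using conv_const_ge[OF m] B0 t by simp
  have mn: "real CARD('n) < m" using m s by linarith
  have I: "norm ?I \<le> B * ?k" by (rule schwartz_integral(2)[OF \<phi> mn B])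
  have hM: "h x \<le> M" using H(2) real by (simp add: ennreal_le_iff)
  have lim: "?X \<le> ?c * (M + e) powr a" if e: "0 < e" for e
  proof -
    let ?M = "M + e"
    have hl: "hl_max h x \<le> ennreal ?M" "0 < ?M" using H real e order_trans[OF H(1)] by (auto intro!: ennreal_leI)
    obtain x0 where x0: "\<And>x'. x' \<in> ball x t - E \<Longrightarrow> norm (f x' - f x0) \<le> poincare_const s a * t powr s * ?M powr (a - 1) * (?M + h x')"
      "norm (dist_of f (\<lambda>y. dilate t \<phi> (x - y)) - f x0 * ?I) \<le> B * kernel_const CARD('n) s a m * t powr s * ?M powr a"
      by (rule dist_of_dilate[OF \<phi> B m t hl(2,1)]) (rule that, assumption+)
    have "norm (f x - f x0) \<le> poincare_const s a * t powr s * ?M powr (a - 1) * (?M + h x)"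
      using x t by (intro x0(1)) auto
    also have "\<dots> \<le> poincare_const s a * t powr s * ?M powr (a - 1) * (2 * ?M)"
      using hM e K_pos by (intro mult_left_mono) auto
    also have "\<dots> = 2 * poincare_const s a * t powr s * ?M powr a"
      using powr_add[of ?M "a - 1" 1] hl(2) by simp
    finally have d: "norm (f x - f x0) \<le> 2 * poincare_const s a * t powr s * ?M powr a" .
    have "dist_of f (\<lambda>y. dilate t \<phi> (x - y)) - f x * ?I =
      (dist_of f (\<lambda>y. dilate t \<phi> (x - y)) - f x0 * ?I) - (f x - f x0) * ?I"
      by (simp add: algebra_simps)
    then have "?X \<le> norm (dist_of f (\<lambda>y. dilate t \<phi> (x - y)) - f x0 * ?I) + norm (f x - f x0) * norm ?I"
      unfolding norm_mult[symmetric] by (simp only: norm_triangle_ineq4)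
    also have "\<dots> \<le> B * kernel_const CARD('n) s a m * t powr s * ?M powr a + (2 * poincare_const s a * t powr s * ?M powr a) * (B * ?k)"
      using K_pos by (intro add_mono x0(2) mult_mono d I) auto
    also have "\<dots> = ?c * ?M powr a" by (simp add: conv_const_def algebra_simps)
    finally show ?thesis .
  qed
  have "?X \<le> ?c * M powr a"
    by (rule le_powr_limit[OF lim]) (use real a_pos in simp_all)
  then show ?thesis using real c by (simp add: epowr_ennreal ennreal_mult'[symmetric] ennreal_leI less_imp_le)
next
  case top
  have "0 < B * conv_const TYPE(real^'n) s a m * t powr s" using conv_const_ge[OF m] B0 t by simp
  then show ?thesis unfolding top by (simp only: epowr_top ennreal_pos_mult_top top_greatest)
qed

end

text \<open>The maximal theorem is formulated for Borel functions, so \<open>g\<close> is replaced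
  by a Borel representative. The absolute value takes care of points where the representative is
  negative; they lie in the null set that is added to the exceptional set.\<close>

lemma hajlasz_fun_of_gradient:
  fixes f :: "real^'n \<Rightarrow> complex"
  assumes f: "f \<in> hajlasz_space s p" and g: "g \<in> hajlasz_gradients s p f" and s: "0 < s"
    and a: "a = 1 + s / real CARD('n)"
  obtains h E where "hajlasz_fun f h E s a" "\<And>x. x \<notin> E \<Longrightarrow> h x powr a = g x"
proof -
  have a0: "0 < a" using s a by (simp add: add_pos_nonneg)
  have gm: "g \<in> borel_measurable lebesgue" and g0: "\<And>x. 0 \<le> g x" using g by (auto simp: hajlasz_gradients_def)
  obtain E where E: "E \<in> null_sets lebesgue"
    "\<And>x y. x \<notin> E \<Longrightarrow> y \<notin> E \<Longrightarrow> norm (f x - f y) \<le> norm (x - y) powr s * (g x + g y)"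
    using g unfolding hajlasz_gradients_def by blast
  obtain g' where g': "g' \<in> borel_measurable lborel" "AE x in lborel. g x = g' x"
    using completion_ex_borel_measurable_real[OF gm] by blast
  have "AE x in lebesgue. g x = g' x" using g'(2) by (rule AE_completion)
  then obtain N where N: "N \<in> null_sets lebesgue" "{x. g x \<noteq> g' x} \<subseteq> N"
    unfolding eventually_ae_filter by auto
  define h where "h x = \<bar>g' x\<bar> powr (1 / a)" for x
  have eq: "h x powr a = g x" if "x \<notin> E \<union> N" for x
  proof -
    have "g' x = g x"
    proof (rule ccontr)
      assume "g' x \<noteq> g x"
      then have "x \<in> {x. g x \<noteq> g' x}" by simp
      with N(2) that show False by blast
    qed
    then show ?thesis using g0[of x] a0 by (simp add: h_def powr_powr)
  qed
  have "hajlasz_fun f h (E \<union> N) s a"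
  proof
    show "h \<in> borel_measurable borel" using g'(1) unfolding h_def by measurable
    show "E \<union> N \<in> null_sets lebesgue" using E(1) N(1) by blast
    show "f \<in> borel_measurable lebesgue" using f by (simp add: hajlasz_space_def Lp_loc_def)
    fix x y assume xy: "x \<notin> E \<union> N" "y \<notin> E \<union> N"
    then show "norm (f x - f y) \<le> norm (x - y) powr s * (h x powr a + h y powr a)"
      unfolding eq[OF xy(1)] eq[OF xy(2)] using E(2) by blast
  qed (use s a in \<open>auto simp: h_def\<close>)
  then show ?thesis using eq by (rule that)
qed

text \<open>The interface between the analysis of Hajlasz functions and the comparison of spaces.
  The zero-mean clause feeds the grand maximal function; the second clause, off \<open>E\<close>,
  identifies f with its distribution at small scales.\<close>

definition dominates_convolutions :: "real \<Rightarrow> real \<Rightarrow> (real^'n \<Rightarrow> complex) \<Rightarrow> (real^'n) set \<Rightarrow> (real^'n \<Rightarrow> ennreal) \<Rightarrow> bool" where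
  "dominates_convolutions s m f E T \<longleftrightarrow> T \<in> borel_measurable lebesgue \<and> E \<in> null_sets lebesgue \<and>
    (\<forall>\<phi>\<in>schwartz. \<forall>B>0. \<forall>t>0. \<forall>x. (\<forall>z. norm (\<phi> z) \<le> B * (1 + norm z) powr (- m)) \<longrightarrow>
      ((LINT y|lebesgue. \<phi> y) = 0 \<longrightarrow>
         ennreal (norm (dist_of f (\<lambda>y. dilate t \<phi> (x - y)))) \<le> ennreal (B * t powr s) * T x) \<and>
      (x \<notin> E \<longrightarrow>
         ennreal (norm (dist_of f (\<lambda>y. dilate t \<phi> (x - y)) - f x * (LINT y|lebesgue. \<phi> y))) \<le> ennreal (B * t powr s) * T x))"

lemma dominates_convolutionsD:
  assumes "dominates_convolutions s m f E T" "\<phi> \<in> schwartz" "0 < B" "0 < t"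
    and "\<And>z. norm (\<phi> z) \<le> B * (1 + norm z) powr (- m)"
  shows "(LINT y|lebesgue. \<phi> y) = 0 \<Longrightarrow>
      ennreal (norm (dist_of f (\<lambda>y. dilate t \<phi> (x - y)))) \<le> ennreal (B * t powr s) * T x"
    and "x \<notin> E \<Longrightarrow>
      ennreal (norm (dist_of f (\<lambda>y. dilate t \<phi> (x - y)) - f x * (LINT y|lebesgue. \<phi> y))) \<le> ennreal (B * t powr s) * T x"
  using assms unfolding dominates_convolutions_def by blast+

text \<open>The hypothesis on p says a p > 1, so the maximal operator is bounded on L^(ap). Since
  h^a = g almost everywhere, the norm of h in L^(ap) is a power of the norm of g in L^p.\<close>

theorem hajlasz_convolution:
  fixes s p m :: real
  assumes s: "0 < s" and p: "real CARD('n) / (real CARD('n) + s) < p" and m: "real CARD('n) + s < m"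
  shows "\<exists>C>0. \<forall>f\<in>hajlasz_space s p. \<forall>g\<in>hajlasz_gradients s p f.
    locally_integrable f \<and> defines_tempered f \<and>
    (\<exists>E T. dominates_convolutions s m (f :: real^'n \<Rightarrow> complex) E T \<and>
      Lp_norm p T \<le> ennreal C * Lp_norm p (\<lambda>x. ennreal (g x)))"
proof -
  let ?n = "real CARD('n)"
  define a where "a = 1 + s / ?n"
  have a1: "1 < a" using s by (simp add: a_def)
  have p0: "0 < p" using p s by (smt (verit) divide_nonneg_nonneg of_nat_0_le_iff)
  have r: "1 < a * p"
  proof -
    have "a = (?n + s) / ?n" by (simp add: a_def add_divide_distrib)
    have "?n < p * (?n + s)" using p s by (simp add: pos_divide_less_eq add_pos_pos)
    then have "?n / ?n < p * (?n + s) / ?n" by (rule divide_strict_right_mono) simp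
    with \<open>a = (?n + s) / ?n\<close> show ?thesis by (simp add: mult.commute)
  qed
  let ?r = "a * p"
  \<comment> \<open>The constant of \<open>hl_max_strong\<close> plus 1; the extra 1 accounts for
    \<open>h\<close> itself in the maximum \<open>H\<close> below.\<close>
  define D where "D = 2 * 5 ^ CARD('n) * ?r * 2 powr (?r - 1) / (?r - 1) + 1"
  have D: "0 < D" using r a1 p0 unfolding D_def by (intro add_nonneg_pos divide_nonneg_nonneg mult_nonneg_nonneg) auto
  let ?K = "conv_const TYPE(real^'n) s a m"
  have K: "0 < ?K"
  proof -
    have "0 \<le> 2 * poincare_const s a * kernel_mass TYPE(real^'n) m"
      using kernel_mass(2)[of m, where 'n='n] by (simp add: poincare_const_def)
    then show ?thesis unfolding conv_const_def using kernel_const_pos[OF m, of a] by linarith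
  qed
  have main: "locally_integrable f \<and> defines_tempered f \<and>
    (\<exists>E T. dominates_convolutions s m f E T \<and>
      Lp_norm p T \<le> ennreal (?K * D powr (1 / p)) * Lp_norm p (\<lambda>x. ennreal (g x)))"
    if f: "f \<in> hajlasz_space s p" and g: "g \<in> hajlasz_gradients s p f" for f :: "real^'n \<Rightarrow> complex" and g
  proof -
    obtain h E where hf: "hajlasz_fun f h E s a" and hg: "\<And>x. x \<notin> E \<Longrightarrow> h x powr a = g x"
      using hajlasz_fun_of_gradient[OF f g s a_def] by blast
    interpret hajlasz_fun f h E s a by (rule hf)
    \<comment> \<open>Joining \<open>h\<close> to its maximal function secures both bounds required
      by \<open>dist_of_dilate_approx\<close> at every point.\<close>
    define H where "H x = max (hl_max h x) (ennreal (h x))" for x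
    have Hm[measurable]: "H \<in> borel_measurable borel" using h unfolding H_def by measurable
    have H: "hl_max h x \<le> H x" "ennreal (h x) \<le> H x" for x by (auto simp: H_def)
    have "(\<integral>\<^sup>+x. epowr (H x) ?r \<partial>lebesgue) \<le> (\<integral>\<^sup>+x. epowr (hl_max h x) ?r + ennreal (h x powr ?r) \<partial>lebesgue)"
    proof (rule nn_integral_mono)
      fix x
      show "epowr (H x) ?r \<le> epowr (hl_max h x) ?r + ennreal (h x powr ?r)"
        using epowr_ennreal[OF h0, of x ?r] by (auto simp: H_def max_def)
    qed
    also have "\<dots> = (\<integral>\<^sup>+x. epowr (hl_max h x) ?r \<partial>lebesgue) + (\<integral>\<^sup>+x. ennreal (h x powr ?r) \<partial>lebesgue)"
      unfolding nn_integral_completion using h by (intro nn_integral_add) measurable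
    also have "\<dots> \<le> ennreal (D - 1) * (\<integral>\<^sup>+x. ennreal (h x powr ?r) \<partial>lebesgue) + (\<integral>\<^sup>+x. ennreal (h x powr ?r) \<partial>lebesgue)"
      using hl_max_strong[OF h h0 r] by (intro add_right_mono) (simp add: D_def)
    also have "\<dots> = ennreal D * (\<integral>\<^sup>+x. ennreal (h x powr ?r) \<partial>lebesgue)"
    proof -
      have "0 \<le> D - 1" using r unfolding D_def by (simp add: divide_nonneg_nonneg)
      then have "ennreal D = ennreal (D - 1) + 1" by (metis diff_add_cancel ennreal_1 ennreal_plus zero_le_one)
      then show ?thesis by (simp add: distrib_right)
    qed
    also have "(\<integral>\<^sup>+x. ennreal (h x powr ?r) \<partial>lebesgue) = (\<integral>\<^sup>+x. epowr (ennreal (g x)) p \<partial>lebesgue)"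
    proof (rule nn_integral_cong_AE)
      show "AE x in lebesgue. ennreal (h x powr ?r) = epowr (ennreal (g x)) p"
        using AE_not_in[OF E] by eventually_elim (simp add: hg[symmetric] epowr_ennreal powr_powr)
    qed
    finally have Hint: "(\<integral>\<^sup>+x. epowr (H x) ?r \<partial>lebesgue) \<le> ennreal D * (\<integral>\<^sup>+x. epowr (ennreal (g x)) p \<partial>lebesgue)" .
    define T where "T x = ennreal ?K * epowr (H x) a" for x
    have T0m: "(\<lambda>x. epowr (H x) a) \<in> borel_measurable lebesgue" by (rule measurable_completion) measurable
    have Tm: "T \<in> borel_measurable lebesgue" unfolding T_def using T0m by measurable
    have "Lp_norm p (\<lambda>x. epowr (H x) a) = epowr (\<integral>\<^sup>+x. epowr (H x) ?r \<partial>lebesgue) (1 / p)"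
      by (simp add: Lp_norm_def epowr_epowr)
    also have "\<dots> \<le> epowr (ennreal D * (\<integral>\<^sup>+x. epowr (ennreal (g x)) p \<partial>lebesgue)) (1 / p)"
      using p0 by (intro epowr_mono Hint) auto
    also have "\<dots> = ennreal (D powr (1 / p)) * Lp_norm p (\<lambda>x. ennreal (g x))"
      unfolding Lp_norm_def by (rule epowr_cmult[OF D])
    finally have "ennreal ?K * Lp_norm p (\<lambda>x. epowr (H x) a) \<le> ennreal ?K * (ennreal (D powr (1 / p)) * Lp_norm p (\<lambda>x. ennreal (g x)))"
      by (rule mult_left_mono) simp
    then have TL: "Lp_norm p T \<le> ennreal (?K * D powr (1 / p)) * Lp_norm p (\<lambda>x. ennreal (g x))"
      unfolding T_def Lp_norm_cmult[OF p0 K T0m] using K by (simp add: ennreal_mult' mult.assoc)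
    have fin: "Lp_norm p (\<lambda>x. ennreal (g x)) < top" using g by (simp add: hajlasz_gradients_def)
    then have "Lp_norm p (\<lambda>x. epowr (H x) a) < top"
    proof -
      have "(\<integral>\<^sup>+x. epowr (H x) ?r \<partial>lebesgue) < top"
        using le_less_trans[OF Hint] fin by (simp add: Lp_norm_finite_iff ennreal_mult_less_top)
      then show ?thesis by (simp add: Lp_norm_finite_iff epowr_epowr)
    qed
    then have "AE x in lebesgue. epowr (H x) a < top" using T0m by (rule Lp_norm_finite_AE)
    then have "\<exists>x. epowr (H x) a < top"
      by (rule AE_lebesgue_ex)
    then obtain x where "H x < top" by (auto simp: epowr_less_top_iff)
    then have hx: "hl_max h x < top" using H(1)[of x] by (rule le_less_trans[rotated])
    have m0: "0 < m" using m s of_nat_0_le_iff[of "CARD('n)", where 'a=real] by linarith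
    note wt = weighted_tempered[OF fm m0 weighted_finite[OF hx m]]
    have split: "ennreal (B * ?K * t powr s) * epowr (H x) a = ennreal (B * t powr s) * T x" if "0 < B" for B t x
      unfolding T_def mult.assoc[symmetric] using that by (subst ennreal_mult'[symmetric]) (auto simp: mult_ac)
    have "dominates_convolutions s m f E T"
      unfolding dominates_convolutions_def
    proof (intro conjI Tm E ballI allI impI)
      fix \<phi> :: "real^'n \<Rightarrow> complex" and B t :: real and x
      assume *: "\<phi> \<in> schwartz" "0 < B" "0 < t" "\<forall>z. norm (\<phi> z) \<le> B * (1 + norm z) powr (- m)"
      show "ennreal (norm (dist_of f (\<lambda>y. dilate t \<phi> (x - y)))) \<le> ennreal (B * t powr s) * T x"
        if "(LINT y|lebesgue. \<phi> y) = 0"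
        using dist_of_dilate_zero_mean[OF _ _ _ m _ _ H(1), of \<phi> B t x] split * that by simp
      show "ennreal (norm (dist_of f (\<lambda>y. dilate t \<phi> (x - y)) - f x * (LINT y|lebesgue. \<phi> y))) \<le> ennreal (B * t powr s) * T x"
        if "x \<notin> E"
        using dist_of_dilate_approx[OF _ _ _ m _ _ H, of \<phi> B t x] split * that by simp
    qed
    with wt TL show ?thesis by blast
  qed
  have C: "0 < ?K * D powr (1 / p)" using K D by simp
  show ?thesis
    by (rule exI, rule conjI[OF C], intro ballI) (rule main)
qed

section \<open>Tempered distributions\<close>

lemma temperedE:
  fixes u :: "(real^'n \<Rightarrow> complex) \<Rightarrow> complex"
  assumes "tempered u"
  obtains C k m where "0 \<le> C" "0 < m"
    "\<And>\<phi> D. \<phi> \<in> schwartz \<Longrightarrow> sbound k m D \<phi> \<Longrightarrow> norm (u \<phi>) \<le> C * D"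
proof -
  obtain C k m where m: "0 < m" and C: "\<And>\<phi>. \<phi> \<in> schwartz \<Longrightarrow> ennreal (norm (u \<phi>)) \<le> ennreal C * schwartz_norm k m \<phi>"
    using assms unfolding tempered_def by blast
  show ?thesis
  proof (rule that[of "max C 0" m k])
    fix \<phi> :: "real^'n \<Rightarrow> complex" and D assume \<phi>: "\<phi> \<in> schwartz" and D: "sbound k m D \<phi>"
    have D0: "0 \<le> D" using D by (rule sbound_nonneg)
    have "ennreal (norm (u \<phi>)) \<le> ennreal C * schwartz_norm k m \<phi>" by (rule C[OF \<phi>])
    also have "\<dots> \<le> ennreal (max C 0) * ennreal D"
      using D D0 by (intro mult_mono) (auto simp: schwartz_norm_le_iff intro: ennreal_leI)
    also have "\<dots> = ennreal (max C 0 * D)" using D0 by (simp add: ennreal_mult)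
    finally show "norm (u \<phi>) \<le> max C 0 * D" using D0 by (simp add: ennreal_le_iff)
  qed (use m in auto)
qed

lemma tempered_linear:
  assumes "tempered u"
  shows "\<phi> \<in> schwartz \<Longrightarrow> \<psi> \<in> schwartz \<Longrightarrow> u (\<lambda>x. \<phi> x + \<psi> x) = u \<phi> + u \<psi>"
    and "\<phi> \<in> schwartz \<Longrightarrow> u (\<lambda>x. c * \<phi> x) = c * u \<phi>"
    and "\<phi> \<in> schwartz \<Longrightarrow> \<psi> \<in> schwartz \<Longrightarrow> u (\<lambda>x. \<phi> x - \<psi> x) = u \<phi> - u \<psi>"
proof -
  show add: "u (\<lambda>x. \<phi> x + \<psi> x) = u \<phi> + u \<psi>" if "\<phi> \<in> schwartz" "\<psi> \<in> schwartz" for \<phi> \<psi>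
    using assms that unfolding tempered_def by blast
  show mult: "u (\<lambda>x. c * \<phi> x) = c * u \<phi>" if "\<phi> \<in> schwartz" for \<phi> c
    using assms that unfolding tempered_def by blast
  show "u (\<lambda>x. \<phi> x - \<psi> x) = u \<phi> - u \<psi>" if "\<phi> \<in> schwartz" "\<psi> \<in> schwartz" for \<phi> \<psi>
    using add[OF that(1) schwartz_cmult[OF that(2), of "-1"]] mult[OF that(2), of "-1"] by simp
qed

lemma schwartz_mult:
  fixes \<phi> \<psi> :: "real^'n \<Rightarrow> complex"
  assumes "\<phi> \<in> schwartz" "\<psi> \<in> schwartz"
  shows "(\<lambda>x. \<phi> x * \<psi> x) \<in> schwartz"
  unfolding schwartz_iff
proof (intro conjI allI)
  show "smooth (\<lambda>x. \<phi> x * \<psi> x)" by (intro smooth_mult schwartz_smooth assms)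
  fix k m
  obtain C where C: "sbound k m C \<phi>" using schwartzE[OF assms(1)] .
  obtain D where D: "sbound k 0 D \<psi>" using schwartzE[OF assms(2)] .
  from sbound_mult[OF schwartz_smooth[OF assms(1)] schwartz_smooth[OF assms(2)] C D]
  have "sbound k m (2 ^ k * (C * D)) (\<lambda>x. \<phi> x * \<psi> x)" by simp
  then show "\<exists>C. sbound k m C (\<lambda>x. \<phi> x * \<psi> x)" ..
qed

lemma schwartz_zero: "(\<lambda>x. 0) \<in> schwartz"
  using schwartz_cmult[OF bump_schwartz, of 0] by simp

lemma schwartz_sum:
  "finite S \<Longrightarrow> (\<And>j. j \<in> S \<Longrightarrow> F j \<in> schwartz) \<Longrightarrow> (\<lambda>x. \<Sum>j\<in>S. F j x) \<in> schwartz"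
  by (induction S rule: finite_induct) (auto intro: schwartz_zero schwartz_add)

lemma tempered_sum:
  assumes "tempered u"
  shows "finite S \<Longrightarrow> (\<And>j. j \<in> S \<Longrightarrow> F j \<in> schwartz) \<Longrightarrow> u (\<lambda>x. \<Sum>j\<in>S. F j x) = (\<Sum>j\<in>S. u (F j))"
proof (induction S rule: finite_induct)
  case empty
  show ?case using tempered_linear(2)[OF assms schwartz_zero, of 0] by simp
next
  case (insert j S)
  then show ?case
    using tempered_linear(1)[OF assms, of "F j" "\<lambda>x. \<Sum>j\<in>S. F j x"] schwartz_sum[of S F] by simp
qed

text \<open>The functional is controlled by one Schwartz seminorm, in which translation is
  continuous. Continuity in x makes the superlevel sets of the grand maximal function open.\<close>

lemma conv_continuous:
  fixes u :: "(real^'n \<Rightarrow> complex) \<Rightarrow> complex"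
  assumes u: "tempered u" and \<psi>: "\<psi> \<in> schwartz"
  shows "continuous_on UNIV (conv \<psi> u)"
  unfolding continuous_on_eq_continuous_at[OF open_UNIV]
proof
  fix x :: "real^'n"
  obtain C k m where C: "0 \<le> C" "0 < m" "\<And>\<phi> D. \<phi> \<in> schwartz \<Longrightarrow> sbound k m D \<phi> \<Longrightarrow> norm (u \<phi>) \<le> C * D"
    by (rule temperedE[OF u]) (rule that, assumption+)
  let ?K = "(1 + \<bar>-1 :: real\<bar>) ^ k * ((1 + norm x) * (1 + 1 / \<bar>-1 :: real\<bar>)) powr m"
  have ev: "\<forall>\<^sub>F h in nhds 0. norm (conv \<psi> u (x + h) - conv \<psi> u x) \<le> C * (e * ?K)" if e: "0 < e" for e
    using schwartz_translation_continuous[OF \<psi> e less_imp_le[OF C(2)], of k]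
  proof eventually_elim
    case (elim h)
    have s: "(\<lambda>z. \<psi> (z + h)) \<in> schwartz" using schwartz_affine[OF \<psi>, of 1 1 h] by (simp add: add.commute)
    then have d: "(\<lambda>z. \<psi> (z + h) - \<psi> z) \<in> schwartz" using \<psi> by (rule schwartz_diff)
    have b: "sbound k m (e * ?K) (\<lambda>y. \<psi> (x + (-1) *\<^sub>R y + h) - \<psi> (x + (-1) *\<^sub>R y))"
      using sbound_affine[OF schwartz_smooth[OF d] elim, of "-1" 1 x] C(2) by (simp add: mult.assoc)
    have s1: "(\<lambda>y. \<psi> (x + (-1) *\<^sub>R y + h)) \<in> schwartz" using schwartz_affine[OF s, of "-1" 1 x] by simp
    have s2: "(\<lambda>y. \<psi> (x + (-1) *\<^sub>R y)) \<in> schwartz" using schwartz_affine[OF \<psi>, of "-1" 1 x] by simp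
    have "conv \<psi> u (x + h) - conv \<psi> u x = u (\<lambda>y. \<psi> (x + (-1) *\<^sub>R y + h) - \<psi> (x + (-1) *\<^sub>R y))"
      unfolding tempered_linear(3)[OF u s1 s2] by (simp add: conv_def algebra_simps)
    then show ?case using C(3)[OF schwartz_diff[OF s1 s2] b] by simp
  qed
  have "((\<lambda>h. conv \<psi> u (x + h) - conv \<psi> u x) \<longlongrightarrow> 0) (nhds 0)"
    unfolding tendsto_iff
  proof (intro allI impI)
    fix e :: real assume e: "0 < e"
    have "1 + norm x \<noteq> 0" using norm_ge_zero[of x] by linarith
    then have K: "0 < ?K" by (intro mult_pos_pos zero_less_power) simp_all
    define X where "X = (C + 1) * ?K"
    have X: "0 < X" unfolding X_def using K C(1) by (intro mult_pos_pos) auto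
    define e' where "e' = e / (2 * X)"
    have e': "0 < e'" using e X by (simp add: e'_def)
    have "C * (e' * ?K) \<le> (C + 1) * (e' * ?K)" using e' K by (intro mult_right_mono) auto
    also have "\<dots> = e' * X" by (simp only: X_def mult_ac)
    also have "\<dots> = e / 2" using X by (simp add: e'_def)
    also have "\<dots> < e" using e by simp
    finally have lt: "C * (e' * ?K) < e" .
    show "\<forall>\<^sub>F h in nhds 0. dist (conv \<psi> u (x + h) - conv \<psi> u x) 0 < e"
      using ev[OF e']
    proof eventually_elim
      case (elim h)
      then show ?case unfolding dist_norm diff_0_right using lt by (rule le_less_trans)
    qed
  qed
  then have "((\<lambda>h. conv \<psi> u (x + h) - conv \<psi> u x) \<longlongrightarrow> 0) (at 0)"
    by (rule tendsto_mono[OF at_within_le_nhds])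
  then show "isCont (conv \<psi> u) x" by (simp add: isCont_iff LIM_zero_iff)
qed

lemma dilate_schwartz': "\<phi> \<in> schwartz \<Longrightarrow> 0 < t \<Longrightarrow> dilate t \<phi> \<in> schwartz"
  for \<phi> :: "real^'n \<Rightarrow> complex"
proof -
  assume \<phi>: "\<phi> \<in> schwartz" and t: "0 < t"
  have "dilate t \<phi> = (\<lambda>x. of_real (1 / t ^ CARD('n)) * \<phi> (0 + (1 / t) *\<^sub>R x))"
    by (rule ext) (simp add: dilate_def scaleR_conv_of_real[where 'a=complex] divide_inverse)
  also have "\<dots> \<in> schwartz" using \<phi> by (rule schwartz_affine) (use t in simp)
  finally show ?thesis .
qed

lemma powr_sum_le:
  fixes a :: "'i \<Rightarrow> real"
  assumes r: "0 < r" "r \<le> 1" and a: "\<And>i. 0 \<le> a i"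
  shows "finite S \<Longrightarrow> (\<Sum>i\<in>S. a i) powr r \<le> (\<Sum>i\<in>S. a i powr r)"
proof (induction S rule: finite_induct)
  case (insert i S)
  have two: "(x + y) powr r \<le> x powr r + y powr r" if "0 \<le> x" "0 \<le> y" for x y :: real
  proof (cases "x + y = 0")
    case False
    then have c: "0 < x + y" using that by linarith
    have frac: "z / (x + y) \<le> z powr r / (x + y) powr r" if "0 \<le> z" "z \<le> x + y" for z
    proof -
      have "(z / (x + y)) powr 1 \<le> (z / (x + y)) powr r"
        using that c r by (intro powr_mono') auto
      then show ?thesis using that c by (simp add: powr_divide)
    qed
    have "1 = x / (x + y) + y / (x + y)" using c by (simp add: add_divide_distrib[symmetric])
    also have "\<dots> \<le> x powr r / (x + y) powr r + y powr r / (x + y) powr r"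
      using that by (intro add_mono frac) auto
    also have "\<dots> = (x powr r + y powr r) / (x + y) powr r" by (simp add: add_divide_distrib)
    finally show ?thesis using c by (simp add: pos_le_divide_eq)
  next
    case True
    then show ?thesis by (simp only: powr_zero_eq_one) simp
  qed
  have "(\<Sum>i\<in>insert i S. a i) powr r \<le> a i powr r + (\<Sum>i\<in>S. a i) powr r"
    using insert a by (simp add: two sum_nonneg)
  with insert show ?case by simp
qed simp

lemma emeasure_lebesgue_cube:
  fixes v :: "real^'n"
  assumes "0 \<le> t"
  shows "emeasure lebesgue (box v (\<chi> i. v $ i + t)) = ennreal (t ^ CARD('n))"
proof -
  have d: "(\<chi> i. v $ i + t) - v = (\<chi> i. t)" by (simp add: vec_eq_iff)
  have "(\<chi> i. t) \<bullet> b = t" if "b \<in> Basis" for b :: "real^'n"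
    using that by (auto simp: Basis_vec_def inner_axis)
  then have p: "(\<Prod>b\<in>Basis. ((\<chi> i. v $ i + t) - v) \<bullet> b) = t ^ DIM(real^'n)" unfolding d by simp
  have "emeasure lborel (box v (\<chi> i. v $ i + t)) = ennreal (\<Prod>b\<in>Basis. ((\<chi> i. v $ i + t) - v) \<bullet> b)"
  proof (rule emeasure_lborel_box)
    fix b :: "real^'n" assume "b \<in> Basis"
    then show "v \<bullet> b \<le> (\<chi> i. v $ i + t) \<bullet> b"
      using assms by (auto simp: Basis_vec_def inner_axis)
  qed
  then show ?thesis unfolding p by simp
qed

lemma two_powi_powr: "((2::real) powi k) powr s = 2 powr (of_int k * s)"
  by (simp add: powr_real_of_int'[symmetric] powr_powr)

lemma two_powi_minus: "0 < (2::real) powi (- int k)" "(2::real) powi (- int k) \<le> 1"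
  by (simp_all add: power_int_minus inverse_le_1_iff)

text \<open>A distribution that is too small at fine scales vanishes. Cut a test function into pieces
  living on the cubes of a grid of mesh t. Every piece is t^n times the dilation to scale t of a
  normalised test function centred at an arbitrary point of its cube, so it is bounded by the
  average of T over that cube.\<close>

theorem tempered_vanishes:
  fixes v :: "(real^'n \<Rightarrow> complex) \<Rightarrow> complex" and s p m :: real and K :: nat
  assumes v: "tempered v" and Tm: "T \<in> borel_measurable lebesgue"
    and fin: "(\<integral>\<^sup>+x. epowr (T x) p \<partial>lebesgue) < top"
    and s: "0 < s" and p: "real CARD('n) / (real CARD('n) + s) < p" and m: "0 \<le> m"
    and E: "E \<in> null_sets lebesgue"
    and bound: "\<And>\<phi> B k x. \<phi> \<in> schwartz \<Longrightarrow> 0 < B \<Longrightarrow> sbound K m B \<phi> \<Longrightarrow> x \<notin> E \<Longrightarrow>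
      ennreal (norm (v (\<lambda>y. dilate (2 powi (- int k)) \<phi> (x - y)))) \<le> ennreal (B * (2 powi (- int k)) powr s) * T x"
    and \<phi>: "\<phi> \<in> schwartz"
  shows "v \<phi> = 0"
proof -
  let ?n = "CARD('n)"
  \<comment> \<open>At most 1, so that r-th powers are subadditive over the pieces; at most p, so
    that \<open>T\<close> times a decaying weight has an integrable r-th power.\<close>
  define r where "r = min 1 p"
  have p0: "0 < p" using p s by (smt (verit) divide_nonneg_nonneg of_nat_0_le_iff)
  have r: "0 < r" "r \<le> 1" "r \<le> p" using p0 by (auto simp: r_def)
  \<comment> \<open>The exponent of t that survives: each piece is of order t^(n+s), its r-th power
    is summed, and averaging over the cubes divides by t^n.\<close>
  have rn: "0 < (real ?n + s) * r - real ?n"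
  proof -
    have "real ?n / (real ?n + s) < r"
      using p s by (auto simp: r_def pos_divide_less_eq add_nonneg_pos)
    then show ?thesis using s by (simp add: pos_divide_less_eq add_nonneg_pos mult.commute)
  qed
  \<comment> \<open>The decay spent from \<phi> on the position x. The value n + 1 makes the weight
    itself integrable, which is used when p > 1.\<close>
  define M where "M = real ?n + 1"
  define w where "w x = ennreal ((1 + norm x) powr (- M)) * T x" for x :: "real^'n"
  have kerm: "(\<lambda>x::real^'n. ennreal ((1 + norm x) powr (- M))) \<in> borel_measurable lebesgue"
    by (rule measurable_completion) measurable
  have wm[measurable]: "w \<in> borel_measurable lebesgue"
    unfolding w_def using kerm Tm by (rule borel_measurable_times_ennreal)
  have ker1: "(1 + norm x) powr (- M) \<le> 1" for x :: "real^'n"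
    using powr_mono2'[of "- M" 1 "1 + norm x"] by (simp add: M_def)
  have "(\<integral>\<^sup>+x. epowr (w x) r \<partial>lebesgue) \<le> (\<integral>\<^sup>+x. epowr (T x) p + ennreal ((1 + norm x) powr (- M)) \<partial>lebesgue)"
  proof (rule nn_integral_mono)
    fix x :: "real^'n"
    have wT: "w x \<le> T x"
      using mult_right_mono[OF ennreal_leI[OF ker1[of x]], of "T x"] by (simp add: w_def)
    show "epowr (w x) r \<le> epowr (T x) p + ennreal ((1 + norm x) powr (- M))"
    proof (cases "p \<le> 1")
      case True
      then have "r = p" by (simp add: r_def)
      then show ?thesis using epowr_mono[OF _ wT, of p] p0 by (simp add: add_increasing2)
    next
      case False
      then have r1: "r = 1" by (simp add: r_def)
      show ?thesis
      \<comment> \<open>For p > 1 the power is r = 1: where T \<le> 1 the weight is integrable, and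
        where T > 1 the bound T \<le> T^p applies.\<close>
      proof (cases "T x \<le> 1")
        case True
        then have "w x \<le> ennreal ((1 + norm x) powr (- M)) * 1" unfolding w_def by (intro mult_left_mono) auto
        then show ?thesis by (simp add: r1 add_increasing)
      next
        case F: False
        have "T x \<le> epowr (T x) p"
        proof (cases "T x")
          case (real b)
          then have "1 < b" using F by (simp add: not_le ennreal_less_iff[of 1, simplified])
          then have "b powr 1 \<le> b powr p" using False by (intro powr_mono) auto
          then show ?thesis using real \<open>1 < b\<close> by (simp add: epowr_ennreal ennreal_leI)
        qed simp
        with wT have "w x \<le> epowr (T x) p" by (rule order_trans)
        then show ?thesis by (simp add: r1 add_increasing2)
      qed
    qed
  qed
  also have "\<dots> = (\<integral>\<^sup>+x. epowr (T x) p \<partial>lebesgue) + (\<integral>\<^sup>+x. ennreal ((1 + norm (x::real^'n)) powr (- M)) \<partial>lebesgue)"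
    by (rule nn_integral_add) (intro measurable_epowr Tm, rule kerm)
  also have "\<dots> < top" using fin kernel_mass(1)[of M, where 'n='n] by (simp add: M_def)
  finally obtain W where W: "(\<integral>\<^sup>+x. epowr (w x) r \<partial>lebesgue) = ennreal W" "0 \<le> W"
    by (cases "\<integral>\<^sup>+x. epowr (w x) r \<partial>lebesgue") auto
  obtain B1 where B1: "0 < B1" "sbound K M B1 \<phi>" using schwartzE[OF \<phi>] .
  obtain B2 where B2: "0 < B2" "sbound K (m + M) B2 (bump :: real^'n \<Rightarrow> complex)" using schwartzE[OF bump_schwartz] .
  \<comment> \<open>The Leibniz factor, the decay constants of \<phi> and of the bump, and the loss
    from shifting the bump by a vector of norm at most n.\<close>
  define D where "D = 2 ^ K * (B1 * (B2 * (1 + real ?n) powr (m + M)))"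
  have D0: "0 < D" using B1 B2 by (simp add: D_def)
  have piece: "ennreal (norm (v (\<lambda>y. \<phi> y * bump (y /\<^sub>R t - j)))) \<le> ennreal (t ^ ?n * D * t powr s) * w x"
    if t: "t = 2 powi (- int k)" and x: "x \<in> box (t *\<^sub>R j) (\<chi> i. (t *\<^sub>R j) $ i + t)" "x \<notin> E"
    for t k x and j :: "real^'n"
  proof -
    have t0: "0 < t" "t \<le> 1" unfolding t by (rule two_powi_minus)+
    \<comment> \<open>The position of x within its cube in units of t; its coordinates lie in [0, 1]
      whatever x is chosen, which keeps all bounds uniform over the cube.\<close>
    define w0 where "w0 = x /\<^sub>R t - j"
    have w0: "\<bar>w0 $ i\<bar> \<le> 1" for i
      using x(1) t0 by (auto simp: mem_box_cart w0_def field_simps abs_le_iff dest!: spec[of _ i])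
    have "norm w0 \<le> (\<Sum>i\<in>UNIV. \<bar>w0 $ i\<bar>)" by (rule norm_le_l1_cart)
    also have "\<dots> \<le> (\<Sum>i\<in>(UNIV::'n set). 1)" by (intro sum_mono w0)
    finally have nw0: "norm w0 \<le> real ?n" by simp
    \<comment> \<open>The piece as seen from x at scale t: with z = (x - y) / t the argument of
      \<open>f1\<close> becomes y and that of \<open>f2\<close> becomes y / t - j. The factors 1 put
      both in the form required by the affine lemmas.\<close>
    define f1 where "f1 z = 1 * \<phi> (x + (- t) *\<^sub>R z)" for z
    define f2 where "f2 z = 1 * bump (w0 + (- 1) *\<^sub>R z)" for z :: "real^'n"
    define \<psi> where "\<psi> z = f1 z * f2 z" for z
    have f: "f1 \<in> schwartz" "f2 \<in> schwartz"
      unfolding f1_def f2_def using t0 by (intro schwartz_affine \<phi> bump_schwartz; simp)+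
    have \<psi>: "\<psi> \<in> schwartz" unfolding \<psi>_def using f by (rule schwartz_mult)
    let ?B = "D * (1 + norm x) powr (- M)"
    have B0: "0 < ?B" using D0 add_pos_nonneg[OF zero_less_one norm_ge_zero, of x] by simp
    have sb: "sbound K m ?B \<psi>"
    proof (rule sboundI)
      fix ns :: "'n list" and z :: "real^'n" assume ns: "ns \<in> sorted_lists" "length ns \<le> K"
      let ?X = "1 + norm x" and ?Z = "1 + norm z" and ?Y = "1 + norm (x + (- t) *\<^sub>R z)" and ?U = "1 + norm (w0 + (- 1) *\<^sub>R z)"
      have pos: "0 < ?X" "0 < ?Z" "0 < ?Y" "0 < ?U" by (simp_all add: add_pos_nonneg)
      have M0: "0 \<le> M" "0 \<le> m + M" using m by (auto simp: M_def)
      \<comment> \<open>Derivatives bring powers of t \<le> 1, and 1 + |x| \<le> (1 + |x - t z|) (1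
        + |z|) transfers the decay of \<phi> to x. The resulting growth in z is absorbed by the
        surplus decay \<open>M\<close> of the bump.\<close>
      have b1: "norm (pd js f1 z) \<le> B1 * (?X powr (- M) * ?Z powr M)" if js: "js \<in> sorted_lists" "length js \<le> K" for js
      proof -
        have "norm (pd js f1 z) = t ^ length js * norm (pd js \<phi> (x + (- t) *\<^sub>R z))"
          unfolding f1_def pd_affine[OF schwartz_smooth[OF \<phi>]] using t0 by (simp add: norm_mult norm_power)
        also have "\<dots> \<le> 1 * (B1 * ?Y powr (- M))"
          using t0 B1 by (intro mult_mono sboundD'[OF B1(2) js] power_le_one) auto
        also have "?Y powr (- M) \<le> ?X powr (- M) * ?Z powr M"
        proof -
          have "norm x \<le> norm (x + (- t) *\<^sub>R z) + norm (t *\<^sub>R z)"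
            using norm_triangle_ineq[of "x + (- t) *\<^sub>R z" "t *\<^sub>R z"] by simp
          also have "norm (t *\<^sub>R z) \<le> norm z" using t0 by (simp add: mult_left_le_one_le)
          finally have "?X \<le> ?Y + norm z" by simp
          also have "\<dots> \<le> ?Y + ?Y * norm z"
            using mult_right_mono[of 1 ?Y "norm z"] by simp
          also have "\<dots> = ?Y * ?Z" by (simp add: distrib_left)
          finally have "?X powr M \<le> (?Y * ?Z) powr M" using M0 pos by (intro powr_mono2) auto
          then have "?X powr M \<le> ?Y powr M * ?Z powr M" by (simp only: powr_mult)
          then show ?thesis using pos by (simp add: powr_minus field_simps)
        qed
        finally show ?thesis using B1 by simp
      qed
      have b2: "norm (pd js f2 z) \<le> B2 * (1 + real ?n) powr (m + M) * ?Z powr (- (m + M))" if js: "js \<in> sorted_lists" "length js \<le> K" for js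
      proof -
        have "norm (pd js f2 z) = norm (pd js bump (w0 + (- 1) *\<^sub>R z))"
          unfolding f2_def pd_affine[OF schwartz_smooth[OF bump_schwartz]] by (simp add: norm_mult norm_power)
        also have "\<dots> \<le> B2 * ?U powr (- (m + M))" by (rule sboundD'[OF B2(2) js])
        also have "?U powr (- (m + M)) \<le> (1 + real ?n) powr (m + M) * ?Z powr (- (m + M))"
        proof -
          have "norm z \<le> norm w0 + norm (w0 + (- 1) *\<^sub>R z)"
            using norm_triangle_ineq4[of w0 "w0 + (- 1) *\<^sub>R z"] by simp
          then have "?Z \<le> real ?n + ?U" using nw0 by simp
          also have "\<dots> \<le> real ?n * ?U + ?U" using mult_left_mono[of 1 ?U "real ?n"] by simp
          also have "\<dots> = (1 + real ?n) * ?U" by (simp add: distrib_right)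
          finally have "?Z powr (m + M) \<le> ((1 + real ?n) * ?U) powr (m + M)" using M0 pos by (intro powr_mono2) auto
          then have "?Z powr (m + M) \<le> (1 + real ?n) powr (m + M) * ?U powr (m + M)" by (simp only: powr_mult)
          then have "1 / ?U powr (m + M) \<le> (1 + real ?n) powr (m + M) / ?Z powr (m + M)"
            using pos by (simp add: field_simps)
          then show ?thesis unfolding powr_minus by (simp only: divide_inverse mult_1_left)
        qed
        finally show ?thesis using B2 by simp
      qed
      have "norm (pd ns \<psi> z) \<le> 2 ^ K * ((B1 * (?X powr (- M) * ?Z powr M)) * (B2 * (1 + real ?n) powr (m + M) * ?Z powr (- (m + M))))"
        unfolding \<psi>_def by (rule leibniz_bound[OF schwartz_smooth[OF f(1)] schwartz_smooth[OF f(2)] ns b1 b2])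
      also have "\<dots> = ?B * (?Z powr M * ?Z powr (- (m + M)))" by (simp only: D_def mult_ac)
      also have "?Z powr M * ?Z powr (- (m + M)) = ?Z powr (- m)" unfolding powr_add[symmetric] by simp
      finally show "norm (pd ns \<psi> z) \<le> ?B * ?Z powr (- m)" .
    qed
    have eq: "(\<lambda>y. of_real (t ^ ?n) * dilate t \<psi> (x - y)) = (\<lambda>y. \<phi> y * bump (y /\<^sub>R t - j))"
    proof
      fix y
      have "x + (- t) *\<^sub>R ((x - y) /\<^sub>R t) = y" using t0 by simp
      moreover have "w0 + (- 1) *\<^sub>R ((x - y) /\<^sub>R t) = y /\<^sub>R t - j" by (simp add: w0_def algebra_simps)
      ultimately have "\<psi> ((x - y) /\<^sub>R t) = \<phi> y * bump (y /\<^sub>R t - j)" by (simp add: \<psi>_def f1_def f2_def)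
      then show "of_real (t ^ ?n) * dilate t \<psi> (x - y) = \<phi> y * bump (y /\<^sub>R t - j)"
        using t0 by (simp add: dilate_def scaleR_conv_of_real[where 'a=complex])
    qed
    have "v (\<lambda>y. \<phi> y * bump (y /\<^sub>R t - j)) = of_real (t ^ ?n) * v (\<lambda>y. dilate t \<psi> (x - y))"
      unfolding eq[symmetric] by (rule tempered_linear(2)[OF v dilate_schwartz[OF \<psi> t0(1)]])
    then have "ennreal (norm (v (\<lambda>y. \<phi> y * bump (y /\<^sub>R t - j)))) = ennreal (t ^ ?n) * ennreal (norm (v (\<lambda>y. dilate t \<psi> (x - y))))"
      using t0 by (simp add: norm_mult norm_power ennreal_mult)
    also have "\<dots> \<le> ennreal (t ^ ?n) * (ennreal (?B * t powr s) * T x)"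
      using bound[OF \<psi> B0 sb x(2), of k] unfolding t[symmetric] by (rule mult_left_mono) simp
    also have "\<dots> = ennreal (t ^ ?n * D * t powr s) * w x"
      unfolding w_def mult.assoc[symmetric] using t0 D0 by (simp add: ennreal_mult'[symmetric] mult_ac)
    finally show ?thesis .
  qed
  have scale: "norm (v \<phi>) powr r \<le> t powr ((real ?n + s) * r - real ?n) * (D powr r * W)" if t: "t = 2 powi (- int k)" for t k
  proof -
    have t0: "0 < t" "t \<le> 1" unfolding t by (rule two_powi_minus)+
    let ?R = "t powr ((real ?n + s) * r - real ?n) * (D powr r * W)"
    let ?c = "t ^ ?n * D * t powr s"
    have c0: "0 < ?c" using t0 D0 by simp
    define S :: "nat \<Rightarrow> ('n \<Rightarrow> int) set" where "S J = Pi\<^sub>E UNIV (\<lambda>_. {- int J..int J})" for J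
    have finS: "finite (S J)" for J unfolding S_def by (intro finite_PiE) auto
    define jv :: "('n \<Rightarrow> int) \<Rightarrow> real^'n" where "jv j = (\<chi> i. of_int (j i))" for j
    define F where "F j y = \<phi> y * bump (y /\<^sub>R t - jv j)" for j y
    have Fs: "F j \<in> schwartz" for j
    proof -
      have "(\<lambda>y. 1 * bump (- jv j + (1 / t) *\<^sub>R y)) \<in> schwartz" using t0 by (intro schwartz_affine bump_schwartz) simp
      from schwartz_mult[OF \<phi> this] show ?thesis
        unfolding F_def[abs_def] by (simp add: divide_inverse)
    qed
    define Q where "Q j = box (t *\<^sub>R jv j) (\<chi> i. (t *\<^sub>R jv j) $ i + t)" for j
    have Qm[measurable]: "Q j \<in> sets lebesgue" for j by (simp add: Q_def)
    have disj: "i = j" if "x \<in> Q i" "x \<in> Q j" for x i j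
    proof
      fix k
      have "t * of_int (i k) < x $ k" "x $ k < t * of_int (i k) + t" "t * of_int (j k) < x $ k" "x $ k < t * of_int (j k) + t"
        using that by (auto simp: Q_def mem_box_cart jv_def)
      then have "t * of_int (i k) < t * (of_int (j k) + 1)" "t * of_int (j k) < t * (of_int (i k) + 1)"
        by (simp_all add: distrib_left)
      then have "of_int (i k) < (of_int (j k) + 1 :: real)" "of_int (j k) < (of_int (i k) + 1 :: real)"
        using t0 by (simp_all add: mult_less_cancel_left_pos)
      then show "i k = j k" by linarith
    qed
    let ?a = "\<lambda>j. norm (v (F j))"
    \<comment> \<open>The left-hand value does not depend on the point x of the cube, so the
      pointwise bound may be integrated over the cube, whose volume is t^n.\<close>
    have local_bound: "ennreal (t ^ ?n) * ennreal (?a j powr r) \<le> ennreal (?c powr r) * (\<integral>\<^sup>+x\<in>Q j. epowr (w x) r \<partial>lebesgue)" for j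
    proof -
      have "ennreal (t ^ ?n) * ennreal (?a j powr r) = (\<integral>\<^sup>+x. ennreal (?a j powr r) * indicator (Q j) x \<partial>lebesgue)"
        using emeasure_lebesgue_cube[of t "t *\<^sub>R jv j"] t0
        by (subst nn_integral_cmult_indicator) (auto simp: Q_def mult.commute)
      also have "\<dots> \<le> (\<integral>\<^sup>+x. ennreal (?c powr r) * (epowr (w x) r * indicator (Q j) x) \<partial>lebesgue)"
      proof (rule nn_integral_mono_AE)
        show "AE x in lebesgue. ennreal (?a j powr r) * indicator (Q j) x \<le> ennreal (?c powr r) * (epowr (w x) r * indicator (Q j) x)"
          using AE_not_in[OF E]
        proof eventually_elim
          case (elim x)
          show ?case
          proof (cases "x \<in> Q j")
            case True
            have "ennreal (?a j) \<le> ennreal ?c * w x"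
              using piece[OF t, of x "jv j"] True elim unfolding F_def[abs_def] Q_def by blast
            then have "epowr (ennreal (?a j)) r \<le> epowr (ennreal ?c * w x) r" using r by (intro epowr_mono) auto
            then have "ennreal (?a j powr r) \<le> ennreal (?c powr r) * epowr (w x) r"
              unfolding epowr_cmult[OF c0] by (simp add: epowr_ennreal)
            then show ?thesis using True by simp
          qed simp
        qed
      qed
      also have "\<dots> = ennreal (?c powr r) * (\<integral>\<^sup>+x\<in>Q j. epowr (w x) r \<partial>lebesgue)"
        by (rule nn_integral_cmult) measurable
      finally show ?thesis .
    qed
    have cut: "norm (v (\<lambda>y. \<phi> y * cutoff J ((1 / t) *\<^sub>R y))) powr r \<le> ?R" for J
    proof -
      have "(\<lambda>y. \<phi> y * cutoff J ((1 / t) *\<^sub>R y)) = (\<lambda>y. \<Sum>j\<in>S J. F j y)"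
        unfolding sum_bump[symmetric] F_def S_def jv_def by (simp add: sum_distrib_left divide_inverse)
      then have "norm (v (\<lambda>y. \<phi> y * cutoff J ((1 / t) *\<^sub>R y))) = norm (\<Sum>j\<in>S J. v (F j))"
        using tempered_sum[OF v finS Fs] by simp
      also have "\<dots> \<le> (\<Sum>j\<in>S J. ?a j)" by (rule norm_sum)
      finally have "norm (v (\<lambda>y. \<phi> y * cutoff J ((1 / t) *\<^sub>R y))) powr r \<le> (\<Sum>j\<in>S J. ?a j) powr r"
        using r by (intro powr_mono2) auto
      also have "\<dots> \<le> (\<Sum>j\<in>S J. ?a j powr r)" using r finS by (intro powr_sum_le) auto
      finally have 1: "norm (v (\<lambda>y. \<phi> y * cutoff J ((1 / t) *\<^sub>R y))) powr r \<le> (\<Sum>j\<in>S J. ?a j powr r)" .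
      have "ennreal (t ^ ?n * (\<Sum>j\<in>S J. ?a j powr r)) = (\<Sum>j\<in>S J. ennreal (t ^ ?n) * ennreal (?a j powr r))"
        using t0 by (simp add: sum_distrib_left[symmetric] ennreal_mult sum_nonneg)
      also have "\<dots> \<le> (\<Sum>j\<in>S J. ennreal (?c powr r) * (\<integral>\<^sup>+x\<in>Q j. epowr (w x) r \<partial>lebesgue))"
        by (intro sum_mono local_bound)
      also have "\<dots> = ennreal (?c powr r) * (\<integral>\<^sup>+x. (\<Sum>j\<in>S J. epowr (w x) r * indicator (Q j) x) \<partial>lebesgue)"
        by (subst nn_integral_sum) (auto simp: sum_distrib_left)
      also have "\<dots> \<le> ennreal (?c powr r) * (\<integral>\<^sup>+x. epowr (w x) r \<partial>lebesgue)"
      proof (intro mult_left_mono nn_integral_mono)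
        fix x
        show "(\<Sum>j\<in>S J. epowr (w x) r * indicator (Q j) x) \<le> epowr (w x) r"
        proof (cases "\<exists>i\<in>S J. x \<in> Q i")
          case True
          then obtain i where i: "i \<in> S J" "x \<in> Q i" by blast
          have "(\<Sum>j\<in>S J. epowr (w x) r * indicator (Q j) x) = (\<Sum>j\<in>S J. if j = i then epowr (w x) r else 0)"
          proof (rule sum.cong[OF refl])
            fix j
            have "x \<in> Q j \<longleftrightarrow> j = i" using disj[of x j i] i(2) by blast
            then show "epowr (w x) r * indicator (Q j) x = (if j = i then epowr (w x) r else 0)"
              by (simp only: indicator_def) simp
          qed
          then show ?thesis using i finS by simp
        next
          case False
          then have "(\<Sum>j\<in>S J. epowr (w x) r * indicator (Q j) x) = 0" by (intro sum.neutral) auto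
          then show ?thesis by simp
        qed
      qed simp
      also have "\<dots> = ennreal (?c powr r * W)" unfolding W(1) by (simp add: ennreal_mult W(2))
      finally have "t ^ ?n * (\<Sum>j\<in>S J. ?a j powr r) \<le> ?c powr r * W" using W(2) by (simp add: ennreal_le_iff)
      then have "(\<Sum>j\<in>S J. ?a j powr r) \<le> ?c powr r * W / t ^ ?n" using t0 by (simp add: pos_le_divide_eq mult.commute)
      also have "\<dots> = ?R"
      proof -
        have tn: "t ^ ?n = t powr real ?n" using t0 by (simp add: powr_realpow)
        have "?c powr r = t powr ((real ?n + s) * r) * D powr r"
          unfolding tn using t0 by (simp add: powr_mult powr_powr powr_add distrib_right)
        then show ?thesis unfolding tn using t0 by (simp add: powr_diff)
      qed
      finally show ?thesis using 1 by (rule order_trans[rotated])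
    qed
    \<comment> \<open>For fixed t the sums over growing boxes are cutoffs of \<phi>, and these
      converge in the single seminorm that controls \<open>v\<close>; the bound of
      \<open>cut\<close> is uniform in J.\<close>
    have lim: "(\<lambda>J. v (\<lambda>y. \<phi> y * cutoff J ((1 / t) *\<^sub>R y))) \<longlonglongrightarrow> v \<phi>"
    proof -
      obtain C' k' m' where C: "0 \<le> C'" "\<And>\<phi> D. \<phi> \<in> schwartz \<Longrightarrow> sbound k' m' D \<phi> \<Longrightarrow> norm (v \<phi>) \<le> C' * D"
        by (rule temperedE[OF v]) (rule that, assumption+)
      obtain D' where D': "\<And>J. sbound k' m' (D' / (1 + real J)) (\<lambda>x. \<phi> x * cutoff J ((1 / t) *\<^sub>R x) - \<phi> x)"
        by (rule cutoff_converges[OF \<phi>, of "1 / t" k' m']) (use t0 in auto)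
      have cs: "(\<lambda>y. \<phi> y * cutoff J ((1 / t) *\<^sub>R y)) \<in> schwartz" for J
      proof -
        have "(\<lambda>y. \<Sum>j\<in>S J. F j y) \<in> schwartz" by (intro schwartz_sum finS Fs)
        then show ?thesis
          unfolding sum_bump[symmetric] F_def S_def jv_def by (simp add: sum_distrib_left divide_inverse)
      qed
      have le: "norm (v (\<lambda>y. \<phi> y * cutoff J ((1 / t) *\<^sub>R y)) - v \<phi>) \<le> C' * D' * inverse (real (Suc J))" for J
        using C(2)[OF schwartz_diff[OF cs \<phi>] D'] unfolding tempered_linear(3)[OF v cs \<phi>]
        by (simp add: divide_inverse add.commute mult.assoc)
      have z: "(\<lambda>J. C' * D' * inverse (real (Suc J))) \<longlonglongrightarrow> 0"
        using tendsto_mult_right_zero[OF LIMSEQ_inverse_real_of_nat] by blast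
      have "(\<lambda>J. v (\<lambda>y. \<phi> y * cutoff J ((1 / t) *\<^sub>R y)) - v \<phi>) \<longlonglongrightarrow> 0"
        by (rule Lim_null_comparison[OF always_eventually z]) (rule allI, rule le)
      then show ?thesis by (rule LIM_zero_cancel)
    qed
    have "(\<lambda>J. norm (v (\<lambda>y. \<phi> y * cutoff J ((1 / t) *\<^sub>R y))) powr r) \<longlonglongrightarrow> norm (v \<phi>) powr r"
      using r by (intro tendsto_powr' tendsto_norm lim tendsto_const) auto
    then show ?thesis by (rule LIMSEQ_le_const2) (use cut in blast)
  qed
  let ?e = "(real ?n + s) * r - real ?n"
  have "(\<lambda>k. (2 powi (- int k)) powr ?e * (D powr r * W)) \<longlonglongrightarrow> 0 * (D powr r * W)"
  proof (rule tendsto_mult_right)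
    have "(2 powi (- int k)) powr ?e = (2 powr (- ?e)) ^ k" for k
      by (simp only: two_powi_powr powr_power) (simp add: algebra_simps)
    moreover have "(\<lambda>k. (2 powr (- ?e)) ^ k) \<longlonglongrightarrow> 0"
      using rn powr_less_cancel_iff[of 2 "- ?e" 0] by (intro LIMSEQ_power_zero) simp
    ultimately show "(\<lambda>k. (2 powi (- int k)) powr ?e) \<longlonglongrightarrow> 0" by simp
  qed
  then have "norm (v \<phi>) powr r \<le> 0 * (D powr r * W)"
    by (rule LIMSEQ_le_const) (use scale in blast)
  then have "norm (v \<phi>) powr r = 0" using powr_ge_zero[of "norm (v \<phi>)" r] by simp
  then show ?thesis by simp
qed

section \<open>From grand maximal functions to Hajlasz gradients\<close>

lemma exists_mollifier:
  obtains \<phi> :: "real^'n \<Rightarrow> complex" where "\<phi> \<in> schwartz" "(LINT y|lebesgue. \<phi> y) = 1"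
proof -
  define b where "b x = (\<Prod>i\<in>UNIV. sigm (x $ i + 1) - sigm (x $ i))" for x :: "real^'n"
  have eq: "bump = (\<lambda>x. complex_of_real (b x))" by (rule ext) (simp only: bump_pos(1) b_def)
  have pos: "0 < b x" for x unfolding b_def by (rule bump_pos(2))
  have "integrable lebesgue (bump :: real^'n \<Rightarrow> complex)" by (rule schwartz_integral(1)[OF bump_schwartz])
  then have int: "integrable lebesgue b" unfolding eq by (simp only: complex_of_real_integrable_eq)
  have "(LINT y|lebesgue. b y) \<noteq> 0"
  proof
    assume "(LINT y|lebesgue. b y) = 0"
    then have "AE y in lebesgue. b y = 0"
      using integral_nonneg_eq_0_iff_AE[OF int] pos by (simp add: less_imp_le)
    then have "\<exists>y. b y = 0" by (rule AE_lebesgue_ex)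
    then show False using pos by (metis less_irrefl)
  qed
  moreover have "(LINT y|lebesgue. (bump :: real^'n \<Rightarrow> complex) y) = of_real (LINT y|lebesgue. b y)"
    unfolding eq by (rule integral_complex_of_real)
  ultimately have nz: "(LINT y|lebesgue. (bump :: real^'n \<Rightarrow> complex) y) \<noteq> 0" by simp
  show ?thesis
  proof (rule that[of "\<lambda>x. inverse (LINT y|lebesgue. (bump :: real^'n \<Rightarrow> complex) y) * bump x"])
    show "(\<lambda>x. inverse (LINT y|lebesgue. (bump :: real^'n \<Rightarrow> complex) y) * bump x) \<in> schwartz"
      by (intro schwartz_cmult bump_schwartz)
    show "(LINT x|lebesgue. inverse (LINT y|lebesgue. (bump :: real^'n \<Rightarrow> complex) y) * (bump :: real^'n \<Rightarrow> complex) x) = 1"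
      unfolding integral_mult_right_zero by (rule left_inverse[OF nz])
  qed
qed

section \<open>The pointwise grand maximal function\<close>

definition grand_sup :: "(real^'n \<Rightarrow> complex) set \<Rightarrow> real \<Rightarrow> ((real^'n \<Rightarrow> complex) \<Rightarrow> complex) \<Rightarrow> real^'n \<Rightarrow> ennreal" where
  "grand_sup A s u x = (SUP k::int. ennreal (2 powr (of_int k * s)) *
        (SUP \<phi>\<in>A. ennreal (norm (conv (dilate (2 powi (- k)) \<phi>) u x))))"

lemma grand_TL_norm_eq: "grand_TL_norm A s p u = Lp_norm p (grand_sup A s u)"
  by (simp add: grand_TL_norm_def grand_sup_def [abs_def])

lemma grand_sup_le:
  assumes "\<And>\<phi> k. \<phi> \<in> A \<Longrightarrow> ennreal (norm (conv (dilate (2 powi (- k)) \<phi>) u x)) \<le> ennreal ((2 powi (- k)) powr s) * T"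
  shows "grand_sup A s u x \<le> T"
  unfolding grand_sup_def
proof (rule SUP_least)
  fix k :: int
  have "ennreal (2 powr (of_int k * s)) * (SUP \<phi>\<in>A. ennreal (norm (conv (dilate (2 powi (- k)) \<phi>) u x)))
    \<le> ennreal (2 powr (of_int k * s)) * (ennreal ((2 powi (- k)) powr s) * T)"
    by (intro mult_left_mono SUP_least assms) auto
  also have "\<dots> = ennreal (2 powr (of_int k * s) * (2 powi (- k)) powr s) * T"
    by (simp add: ennreal_mult mult.assoc)
  also have "2 powr (of_int k * s) * (2 powi (- k)) powr s = 1"
    unfolding two_powi_powr powr_add[symmetric] by simp
  finally show "ennreal (2 powr (of_int k * s)) * (SUP \<phi>\<in>A. ennreal (norm (conv (dilate (2 powi (- k)) \<phi>) u x))) \<le> T"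
    by simp
qed

lemma le_grand_sup:
  assumes "\<phi> \<in> A"
  shows "ennreal (norm (conv (dilate (2 powi (- k)) \<phi>) u x)) \<le> ennreal ((2 powi (- k)) powr s) * grand_sup A s u x"
proof -
  let ?X = "ennreal (norm (conv (dilate (2 powi (- k)) \<phi>) u x))"
  have "ennreal (2 powr (of_int k * s)) * ?X \<le> ennreal (2 powr (of_int k * s)) * (SUP \<phi>\<in>A. ennreal (norm (conv (dilate (2 powi (- k)) \<phi>) u x)))"
    by (intro mult_left_mono SUP_upper assms) auto
  also have "\<dots> \<le> grand_sup A s u x" unfolding grand_sup_def by (rule SUP_upper) simp
  finally have "ennreal ((2 powi (- k)) powr s) * (ennreal (2 powr (of_int k * s)) * ?X) \<le> ennreal ((2 powi (- k)) powr s) * grand_sup A s u x"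
    by (rule mult_left_mono) simp
  also have "ennreal ((2 powi (- k)) powr s) * (ennreal (2 powr (of_int k * s)) * ?X) = ennreal ((2 powi (- k)) powr s * 2 powr (of_int k * s)) * ?X"
    by (simp add: ennreal_mult mult.assoc)
  also have "(2 powi (- k)) powr s * 2 powr (of_int k * s) = 1"
    unfolding two_powi_powr powr_add[symmetric] by simp
  finally show ?thesis by simp
qed

lemma two_powi_pos: "0 < (2::real) powi k"
  by simp

text \<open>The supremum runs over an uncountable class, so measurability comes from lower
  semicontinuity: every convolution is continuous in x.\<close>

lemma grand_sup_measurable:
  fixes u :: "(real^'n \<Rightarrow> complex) \<Rightarrow> complex"
  assumes u: "tempered u" and A: "A \<subseteq> schwartz"
  shows "grand_sup A s u \<in> borel_measurable borel"
proof (rule borel_measurableI_greater)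
  fix t :: ennreal
  have "{x. t < grand_sup A s u x} =
    (\<Union>k. \<Union>\<phi>\<in>A. {x. t < ennreal (2 powr (of_int k * s) * norm (conv (dilate (2 powi (- k)) \<phi>) u x))})"
    unfolding grand_sup_def SUP_mult_left_ennreal less_SUP_iff by (auto simp: ennreal_mult)
  also have "open \<dots>"
  proof (intro open_UN ballI)
    fix k :: int and \<phi> assume "\<phi> \<in> A"
    then have "dilate (2 powi (- k)) \<phi> \<in> schwartz" using A by (intro dilate_schwartz') auto
    from conv_continuous[OF u this]
    show "open {x. t < ennreal (2 powr (of_int k * s) * norm (conv (dilate (2 powi (- k)) \<phi>) u x))}"
      by (intro open_Collect_less continuous_on_ennreal continuous_intros)
  qed
  finally show "{x \<in> space borel. t < grand_sup A s u x} \<in> sets borel" by simp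
qed

lemma test_class_schwartz: "test_class l N m \<subseteq> schwartz"
  by (auto simp: test_class_def schwartz_vanishing_def)

text \<open>For N = 0 the only multi-index tested is zero, where the monomial is 1, and the seminorm
  has order N + l + 1 = l + 1.\<close>

lemma test_class_0_iff:
  fixes \<phi> :: "real^'n \<Rightarrow> complex"
  shows "\<phi> \<in> test_class l 0 m \<longleftrightarrow> \<phi> \<in> schwartz \<and> (LINT y|lebesgue. \<phi> y) = 0 \<and> sbound (l + 1) m 1 \<phi>"
proof -
  have "multi_order \<alpha> \<le> 0 \<longleftrightarrow> \<alpha> = (\<lambda>_. 0)" for \<alpha> :: "'n \<Rightarrow> nat"
    by (auto simp: multi_order_def)
  then have "(\<forall>\<alpha>. multi_order \<alpha> \<le> 0 \<longrightarrow> (LINT x|lebesgue. monomial \<alpha> x *\<^sub>R \<phi> x) = 0) \<longleftrightarrow> (LINT y|lebesgue. \<phi> y) = 0"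
    by (simp add: monomial_def)
  then show ?thesis
    using schwartz_norm_le_iff[of 1 "l + 1" m \<phi>] by (auto simp: test_class_def schwartz_vanishing_def)
qed

lemma conv_dilate_cmult:
  assumes "tempered u" "\<phi> \<in> schwartz" "0 < t"
  shows "conv (dilate t (\<lambda>z. c * \<phi> z)) u x = c * conv (dilate t \<phi>) u x"
proof -
  have "(\<lambda>y. dilate t (\<lambda>z. c * \<phi> z) (x - y)) = (\<lambda>y. c * dilate t \<phi> (x - y))"
    by (simp add: dilate_def)
  then show ?thesis using tempered_linear(2)[OF assms(1) dilate_schwartz[OF assms(2,3)]] by (simp add: conv_def)
qed

lemma conv_dilate_diff:
  assumes "tempered u" "\<phi> \<in> schwartz" "\<psi> \<in> schwartz" "0 < t"
  shows "conv (dilate t (\<lambda>z. \<phi> z - \<psi> z)) u x = conv (dilate t \<phi>) u x - conv (dilate t \<psi>) u x"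
proof -
  have "(\<lambda>y. dilate t (\<lambda>z. \<phi> z - \<psi> z) (x - y)) = (\<lambda>y. dilate t \<phi> (x - y) - dilate t \<psi> (x - y))"
    by (simp add: dilate_def scaleR_diff_right)
  then show ?thesis
    using tempered_linear(3)[OF assms(1) dilate_schwartz[OF assms(2,4)] dilate_schwartz[OF assms(3,4)]] by (simp add: conv_def)
qed

lemma conv_le_grand_sup:
  assumes u: "tempered u" and \<psi>: "\<psi> \<in> schwartz" and z: "(LINT y|lebesgue. \<psi> y) = 0"
    and B: "0 < B" "sbound (l + 1) m B \<psi>" and x: "grand_sup (test_class l 0 m) s u x = ennreal \<gamma>" "0 \<le> \<gamma>"
  shows "norm (conv (dilate (2 powi (- k)) \<psi>) u x) \<le> B * (2 powi (- k)) powr s * \<gamma>"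
proof -
  let ?c = "complex_of_real (1 / B)"
  have "sbound (l + 1) m (norm ?c * B) (\<lambda>z. ?c * \<psi> z)" by (rule sbound_cmult[OF schwartz_smooth[OF \<psi>] B(2)])
  moreover have "norm ?c * B = 1" using B(1) by (simp add: norm_divide)
  ultimately have "sbound (l + 1) m 1 (\<lambda>z. ?c * \<psi> z)" by (simp only:)
  moreover have "(LINT y|lebesgue. ?c * \<psi> y) = 0" unfolding integral_mult_right_zero z by simp
  ultimately have "(\<lambda>z. ?c * \<psi> z) \<in> test_class l 0 m"
    unfolding test_class_0_iff using schwartz_cmult[OF \<psi>] by blast
  from le_grand_sup[OF this, of k u x s]
  have "ennreal (norm (conv (dilate (2 powi (- k)) (\<lambda>z. ?c * \<psi> z)) u x)) \<le> ennreal ((2 powi (- k)) powr s * \<gamma>)"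
    unfolding x(1) using x(2) by (simp add: ennreal_mult)
  then have "norm (conv (dilate (2 powi (- k)) (\<lambda>z. ?c * \<psi> z)) u x) \<le> (2 powi (- k)) powr s * \<gamma>"
    using x(2) by (simp add: ennreal_le_iff)
  then have "(1 / B) * norm (conv (dilate (2 powi (- k)) \<psi>) u x) \<le> (2 powi (- k)) powr s * \<gamma>"
    unfolding conv_dilate_cmult[OF u \<psi> two_powi_pos] using B(1) by (simp add: norm_mult norm_divide)
  then show ?thesis using B(1) by (simp add: pos_divide_le_eq mult_ac)
qed

lemma geometric_convergent:
  fixes a :: "nat \<Rightarrow> complex"
  assumes d: "\<And>j. norm (a (Suc j) - a j) \<le> c * q ^ j" and q: "0 \<le> q" "q < 1"
  obtains L where "a \<longlonglongrightarrow> L" "norm (L - a 0) \<le> c / (1 - q)"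
proof -
  have g: "(\<lambda>j. c * q ^ j) sums (c * (1 / (1 - q)))" by (intro sums_mult geometric_sums) (use q in auto)
  have s: "summable (\<lambda>j. a (Suc j) - a j)"
    by (rule summable_comparison_test[OF _ sums_summable[OF g]]) (use d in auto)
  have "(\<lambda>n. \<Sum>j<n. a (Suc j) - a j) \<longlonglongrightarrow> (\<Sum>j. a (Suc j) - a j)" by (rule summable_LIMSEQ[OF s])
  then have "(\<lambda>n. a n - a 0) \<longlonglongrightarrow> (\<Sum>j. a (Suc j) - a j)" by (simp only: sum_lessThan_telescope)
  then have "(\<lambda>n. a n - a 0 + a 0) \<longlonglongrightarrow> (\<Sum>j. a (Suc j) - a j) + a 0" by (intro tendsto_add tendsto_const)
  then have "a \<longlonglongrightarrow> (\<Sum>j. a (Suc j) - a j) + a 0" by simp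
  moreover have "norm (\<Sum>j. a (Suc j) - a j) \<le> c / (1 - q)"
    using norm_suminf_le[OF d sums_summable[OF g]] sums_unique[OF g] by simp
  ultimately show ?thesis using that by force
qed

lemma dilate_dilate:
  fixes \<phi> :: "real^'n \<Rightarrow> complex"
  shows "dilate t (dilate r \<phi>) = dilate (t * r) \<phi>"
  by (rule ext) (simp add: dilate_def power_mult_distrib mult.commute)

lemma integral_dilate':
  fixes \<phi> :: "real^'n \<Rightarrow> complex"
  assumes \<phi>: "\<phi> \<in> schwartz" and t: "0 < t"
  shows "(LINT y|lebesgue. dilate t \<phi> y) = (LINT y|lebesgue. \<phi> y)"
proof -
  have "(LINT y|lebesgue. dilate t \<phi> y) = of_real (\<bar>-1\<bar> ^ CARD('n)) * (LINT y|lebesgue. dilate t \<phi> (0 + (-1) *\<^sub>R y))"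
    by (rule integral_affine[OF dilate_schwartz'[OF \<phi> t]]) simp
  then show ?thesis using integral_dilate[OF \<phi> t, of 0] by simp
qed

text \<open>For zero-mean test functions this is the definition of the grand maximal function. It
  extends to all test functions once the limit F of the mollifications is subtracted.\<close>

theorem grand_limit:
  fixes s m :: real and l :: nat
  assumes s: "0 < s" and m: "real CARD('n) < m"
  shows "\<exists>C>0. \<forall>u :: (real^'n \<Rightarrow> complex) \<Rightarrow> complex. tempered u \<longrightarrow> (\<exists>F\<in>borel_measurable borel.
    \<forall>\<phi>\<in>schwartz. \<forall>B>0. sbound (l + 1) m B \<phi> \<longrightarrow> (\<forall>k x \<gamma>. 0 \<le> \<gamma> \<longrightarrow> grand_sup (test_class l 0 m) s u x = ennreal \<gamma> \<longrightarrow>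
      norm (conv (dilate (2 powi (- k)) \<phi>) u x - (LINT y|lebesgue. \<phi> y) * F x) \<le> C * B * (2 powi (- k)) powr s * \<gamma>))"
proof -
  obtain \<eta> :: "real^'n \<Rightarrow> complex" where \<eta>: "\<eta> \<in> schwartz" "(LINT y|lebesgue. \<eta> y) = 1" by (rule exists_mollifier)
  \<comment> \<open>The difference of two consecutive mollifiers has mean zero; dilated to scale
    2^(-k) it produces the increment of the mollifications from k to k + 1.\<close>
  let ?\<psi> = "\<lambda>z. dilate (1 / 2) \<eta> z - \<eta> z"
  have h\<eta>: "dilate (1 / 2) \<eta> \<in> schwartz" using \<eta>(1) by (rule dilate_schwartz') simp
  have \<psi>: "?\<psi> \<in> schwartz" using h\<eta> \<eta>(1) by (rule schwartz_diff)
  have \<psi>0: "(LINT y|lebesgue. ?\<psi> y) = 0"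
    using integral_dilate'[OF \<eta>(1), of "1 / 2"]
    by (subst Bochner_Integration.integral_diff[OF schwartz_integral(1)[OF h\<eta>] schwartz_integral(1)[OF \<eta>(1)]]) simp
  obtain B0 where B0: "0 < B0" "sbound (l + 1) m B0 \<eta>" using schwartzE[OF \<eta>(1)] .
  obtain b where b: "0 < b" "sbound (l + 1) m b ?\<psi>" using schwartzE[OF \<psi>] .
  let ?k = "kernel_mass TYPE(real^'n) m"
  have k0: "0 \<le> ?k" by (rule kernel_mass(2))
  define q where "q = 2 powr (- s)"
  have q: "0 \<le> q" "q < 1" using s powr_less_cancel_iff[of 2 "- s" 0] by (auto simp: q_def)
  have m0: "0 \<le> m" using m of_nat_0_le_iff[of "CARD('n)", where 'a=real] by linarith
  \<comment> \<open>The first two summands come from the seminorm of the zero-mean part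
    \<open>?\<chi>\<close> below; the last is the mean of \<phi> times the distance from a
    mollification to its limit.\<close>
  define C where "C = 1 + ?k * B0 + ?k * (b / (1 - q))"
  have C: "0 < C" unfolding C_def using k0 B0 b q by (intro add_pos_nonneg mult_nonneg_nonneg divide_nonneg_nonneg) auto
  have "\<exists>F\<in>borel_measurable borel.
    \<forall>\<phi>\<in>schwartz. \<forall>B>0. sbound (l + 1) m B \<phi> \<longrightarrow> (\<forall>k x \<gamma>. 0 \<le> \<gamma> \<longrightarrow> grand_sup (test_class l 0 m) s u x = ennreal \<gamma> \<longrightarrow>
      norm (conv (dilate (2 powi (- k)) \<phi>) u x - (LINT y|lebesgue. \<phi> y) * F x) \<le> C * B * (2 powi (- k)) powr s * \<gamma>)"
    if u: "tempered u" for u :: "(real^'n \<Rightarrow> complex) \<Rightarrow> complex"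
  proof -
    define P where "P k x = conv (dilate (2 powi (- k)) \<eta>) u x" for k :: int and x
    \<comment> \<open>Where the mollifications diverge this value is a mere default of
      \<open>lim\<close>; the estimates concern points with finite grand maximal function, and F is
      Borel in any case.\<close>
    define F where "F x = lim (\<lambda>j. P (int j) x)" for x
    have Fm: "F \<in> borel_measurable borel"
      unfolding F_def P_def
      by (intro borel_measurable_lim_metric borel_measurable_continuous_onI conv_continuous[OF u] dilate_schwartz'[OF \<eta>(1)] two_powi_pos)
    have lim: "norm (F x - P k x) \<le> b / (1 - q) * (2 powi (- k)) powr s * \<gamma>"
      if x: "grand_sup (test_class l 0 m) s u x = ennreal \<gamma>" "0 \<le> \<gamma>" for k x \<gamma>
    proof -
      have conv: "\<exists>L. (\<lambda>j. P (k + int j) x) \<longlonglongrightarrow> L \<and> norm (L - P k x) \<le> b / (1 - q) * (2 powi (- k)) powr s * \<gamma>" for k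
      proof -
        have "norm (P (k + int (Suc j)) x - P (k + int j) x) \<le> (b * (2 powi (- k)) powr s * \<gamma>) * q ^ j" for j
        proof -
          let ?t = "2 powi (- (k + int j)) :: real"
          have "(2::real) powi (- (k + int (Suc j))) = ?t * (1 / 2)"
          proof -
            have e: "- (k + int (Suc j)) = - (k + int j) - 1" by simp
            have "(2::real) powi (i - 1) = 2 powi i * (1 / 2)" for i by (subst power_int_diff) auto
            then show ?thesis unfolding e .
          qed
          then have "P (k + int (Suc j)) x = conv (dilate ?t (dilate (1 / 2) \<eta>)) u x"
            by (simp only: P_def dilate_dilate)
          then have "P (k + int (Suc j)) x - P (k + int j) x = conv (dilate ?t ?\<psi>) u x"
            unfolding conv_dilate_diff[OF u h\<eta> \<eta>(1) two_powi_pos] by (simp add: P_def)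
          then have "norm (P (k + int (Suc j)) x - P (k + int j) x) \<le> b * ?t powr s * \<gamma>"
            using conv_le_grand_sup[OF u \<psi> \<psi>0 b x, of "k + int j"] by (simp only:)
          also have "?t powr s = (2 powi (- k)) powr s * q ^ j"
            unfolding two_powi_powr q_def powr_power by (simp add: powr_power powr_add[symmetric] algebra_simps)
          finally show ?thesis by (simp only: mult_ac)
        qed
        from geometric_convergent[of "\<lambda>j. P (k + int j) x", OF this q]
        show ?thesis by (metis (no_types, lifting) add.right_neutral of_nat_0 times_divide_eq_left mult.assoc)
      qed
      obtain L0 where L0: "(\<lambda>j. P (int j) x) \<longlonglongrightarrow> L0" using conv[of 0] by auto
      then have FL: "F x = L0" unfolding F_def by (rule limI)
      obtain L where L: "(\<lambda>j. P (k + int j) x) \<longlonglongrightarrow> L" "norm (L - P k x) \<le> b / (1 - q) * (2 powi (- k)) powr s * \<gamma>"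
        using conv[of k] by blast
      \<comment> \<open>The limit is defined along k = 0, 1, 2, ..., while the estimate starts at an
        arbitrary integer k, possibly negative. Both sequences agree after a shift.\<close>
      have "L = L0"
      proof (cases "0 \<le> k")
        case True
        have "(\<lambda>j. P (int (j + nat k)) x) \<longlonglongrightarrow> L0" using L0 by (rule LIMSEQ_ignore_initial_segment)
        then have "(\<lambda>j. P (k + int j) x) \<longlonglongrightarrow> L0" using True by (simp add: add.commute)
        then show ?thesis using L(1) LIMSEQ_unique by blast
      next
        case False
        have "(\<lambda>j. P (k + int (j + nat (- k))) x) \<longlonglongrightarrow> L" using L(1) by (rule LIMSEQ_ignore_initial_segment)
        then have "(\<lambda>j. P (int j) x) \<longlonglongrightarrow> L" using False by simp
        then show ?thesis using L0 LIMSEQ_unique by blast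
      qed
      with L(2) FL show ?thesis by simp
    qed
    show ?thesis
    proof (intro bexI[of _ F] Fm ballI allI impI)
      fix \<phi> :: "real^'n \<Rightarrow> complex" and B and k :: int and x \<gamma>
      assume \<phi>: "\<phi> \<in> schwartz" and B: "0 < B" "sbound (l + 1) m B \<phi>"
        and \<gamma>: "0 \<le> \<gamma>" and x: "grand_sup (test_class l 0 m) s u x = ennreal \<gamma>"
      let ?I = "LINT y|lebesgue. \<phi> y" and ?t = "2 powi (- k) :: real"
      \<comment> \<open>Removing the right multiple of the mollifier makes the mean zero, so the
        grand maximal function applies to the remainder; the removed part is compared with
        \<open>F\<close> through \<open>lim\<close>.\<close>
      let ?\<chi> = "\<lambda>z. \<phi> z - ?I * \<eta> z"
      have I: "norm ?I \<le> B * ?k" by (rule schwartz_integral(2)[OF \<phi> m sbound0[OF B(2)]])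
      have I\<eta>: "(\<lambda>z. ?I * \<eta> z) \<in> schwartz" using \<eta>(1) by (rule schwartz_cmult)
      have \<chi>: "?\<chi> \<in> schwartz" using \<phi> I\<eta> by (rule schwartz_diff)
      have \<chi>0: "(LINT y|lebesgue. ?\<chi> y) = 0"
        by (subst Bochner_Integration.integral_diff[OF schwartz_integral(1)[OF \<phi>] schwartz_integral(1)[OF I\<eta>]]) (simp add: \<eta>(2))
      have "sbound (l + 1) m (B + norm ?I * B0) ?\<chi>"
        by (rule sbound_diff[OF schwartz_smooth[OF \<phi>] schwartz_smooth[OF I\<eta>] B(2) sbound_cmult[OF schwartz_smooth[OF \<eta>(1)] B0(2)]])
      moreover have "B + norm ?I * B0 \<le> B * (1 + ?k * B0)"
        using mult_right_mono[OF I, of B0] B0 by (simp add: algebra_simps)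
      ultimately have sb: "sbound (l + 1) m (B * (1 + ?k * B0)) ?\<chi>"
        using sbound_mono[OF _ order_refl order_refl] by blast
      have pos: "0 < B * (1 + ?k * B0)" using B(1) B0(1) k0 by (intro mult_pos_pos add_pos_nonneg) auto
      have 1: "norm (conv (dilate ?t ?\<chi>) u x) \<le> B * (1 + ?k * B0) * ?t powr s * \<gamma>"
        by (rule conv_le_grand_sup[OF u \<chi> \<chi>0 pos sb x \<gamma>])
      have 2: "norm ?I * norm (F x - P k x) \<le> (B * ?k) * (b / (1 - q) * ?t powr s * \<gamma>)"
        using I lim[OF x \<gamma>, of k] B(1) k0 by (intro mult_mono) auto
      have "conv (dilate ?t \<phi>) u x - ?I * F x = conv (dilate ?t ?\<chi>) u x - ?I * (F x - P k x)"
        unfolding conv_dilate_diff[OF u \<phi> I\<eta> two_powi_pos] conv_dilate_cmult[OF u \<eta>(1) two_powi_pos] P_def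
        by (simp add: algebra_simps)
      then have "norm (conv (dilate ?t \<phi>) u x - ?I * F x) \<le> norm (conv (dilate ?t ?\<chi>) u x) + norm ?I * norm (F x - P k x)"
        unfolding norm_mult[symmetric] by (simp only: norm_triangle_ineq4)
      also have "\<dots> \<le> B * (1 + ?k * B0) * ?t powr s * \<gamma> + (B * ?k) * (b / (1 - q) * ?t powr s * \<gamma>)"
        using 1 2 by (rule add_mono)
      also have "\<dots> = C * B * ?t powr s * \<gamma>" unfolding C_def by (simp only: distrib_left distrib_right mult_ac mult_1_left)
      finally show "norm (conv (dilate ?t \<phi>) u x - ?I * F x) \<le> C * B * ?t powr s * \<gamma>" .
    qed
  qed
  with C show ?thesis by blast
qed

section \<open>Comparison of the two spaces\<close>

lemma exists_dyadic_scale: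
  fixes d :: real
  assumes "0 < d"
  obtains k :: int where "d \<le> 2 powi (- k)" "2 powi (- k) \<le> 2 * d"
proof -
  define k where "k = \<lfloor>- log 2 d\<rfloor>"
  have k: "of_int k \<le> - log 2 d" "- log 2 d < of_int k + 1" unfolding k_def by linarith+
  have d: "d = 2 powr (log 2 d)" using assms by simp
  have e: "2 powi (- k) = (2::real) powr (- of_int k)" using two_powi_powr[of "- k" 1] by simp
  have "d \<le> 2 powi (- k)" unfolding e by (subst d, rule powr_mono) (use k in auto)
  moreover have "2 powi (- k) \<le> 2 * d"
  proof -
    have "(2::real) powr (- of_int k) \<le> 2 powr (log 2 d + 1)" using k by (intro powr_mono) auto
    also have "\<dots> = 2 * d" using assms by (simp add: powr_add)
    finally show ?thesis unfolding e .
  qed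
  ultimately show ?thesis by (rule that)
qed

text \<open>Anchoring the Hajlasz inequality at one point y outside the exceptional set bounds |F|
  on a bounded set by a constant plus a multiple of the gradient.\<close>

lemma Lp_loc_of_gradient:
  fixes F :: "real^'n \<Rightarrow> complex"
  assumes p: "0 < p" and s: "0 < s" and Fm: "F \<in> borel_measurable lebesgue" and g: "g \<in> hajlasz_gradients s p F"
  shows "F \<in> Lp_loc p"
  unfolding Lp_loc_def
proof (intro CollectI conjI Fm allI impI)
  fix K :: "(real^'n) set" assume K: "compact K"
  have gm[measurable]: "g \<in> borel_measurable lebesgue" and g0: "\<And>x. 0 \<le> g x"
    and gf: "Lp_norm p (\<lambda>x. ennreal (g x)) < top" using g by (auto simp: hajlasz_gradients_def)
  obtain E where E: "E \<in> null_sets lebesgue"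
    "\<And>x y. x \<notin> E \<Longrightarrow> y \<notin> E \<Longrightarrow> norm (F x - F y) \<le> norm (x - y) powr s * (g x + g y)"
    using g unfolding hajlasz_gradients_def by blast
  obtain y where y: "y \<notin> E" using AE_lebesgue_ex[OF AE_not_in[OF E(1)]] by blast
  obtain R where R: "0 < R" "\<And>x. x \<in> K \<Longrightarrow> norm x \<le> R"
    using compact_imp_bounded[OF K] unfolding bounded_pos by blast
  have Km[measurable]: "K \<in> sets lebesgue" using K by (simp add: borel_compact)
  define b where "b = (R + norm y) powr s"
  define a where "a = norm (F y) + b * g y"
  have b: "0 < b" using R(1) add_pos_nonneg[OF R(1) norm_ge_zero, of y] by (simp add: b_def)
  have a: "0 \<le> a" using b g0[of y] by (simp add: a_def)
  have pw: "norm (F x) \<le> a + b * g x" if x: "x \<in> K" "x \<notin> E" for x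
  proof -
    have "norm (x - y) \<le> R + norm y" using norm_triangle_ineq4[of x y] R(2)[OF x(1)] by linarith
    then have "norm (x - y) powr s \<le> b" unfolding b_def using s by (intro powr_mono2) auto
    then have "norm (x - y) powr s * (g x + g y) \<le> b * (g x + g y)"
      using g0[of x] g0[of y] by (intro mult_right_mono) auto
    then have "norm (F x - F y) \<le> b * (g x + g y)" using E(2)[OF x(2) y] by linarith
    then show ?thesis using norm_triangle_ineq[of "F x - F y" "F y"] by (simp add: a_def algebra_simps)
  qed
  \<comment> \<open>The coefficient a + 1 in place of a is strictly positive, as
    \<open>Lp_norm_cmult\<close> requires.\<close>
  have "Lp_norm p (\<lambda>x. ennreal (norm (F x)) * indicator K x) \<le> Lp_norm p (\<lambda>x. ennreal (a + 1) * indicator K x + ennreal b * ennreal (g x))"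
  proof (rule Lp_norm_mono_AE[OF p])
    show "AE x in lebesgue. ennreal (norm (F x)) * indicator K x \<le> ennreal (a + 1) * indicator K x + ennreal b * ennreal (g x)"
      using AE_not_in[OF E(1)]
    proof eventually_elim
      case (elim x)
      show ?case
      proof (cases "x \<in> K")
        case True
        have "ennreal (norm (F x)) \<le> ennreal ((a + 1) + b * g x)" using pw[OF True elim] by (intro ennreal_leI) simp
        also have "\<dots> = ennreal (a + 1) + ennreal b * ennreal (g x)"
          using a b g0[of x] by (subst ennreal_plus) (auto simp: ennreal_mult)
        finally show ?thesis using True by simp
      qed simp
    qed
  qed
  also have "\<dots> < top"
  proof (rule Lp_norm_add_finite[OF p])
    have im: "indicator K \<in> borel_measurable lebesgue" by measurable
    have "(\<integral>\<^sup>+x. epowr (indicator K x) p \<partial>lebesgue) \<le> (\<integral>\<^sup>+x. indicator K x \<partial>lebesgue)"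
      using p by (intro nn_integral_mono) (auto simp: indicator_def epowr_def)
    also have "\<dots> = emeasure lebesgue K" by (rule nn_integral_indicator) measurable
    also have "\<dots> < top" using emeasure_bounded_finite[OF compact_imp_bounded[OF K]] K by (simp add: borel_compact)
    finally have "Lp_norm p (\<lambda>x. indicator K x :: ennreal) < top" by (simp only: Lp_norm_finite_iff)
    then show "Lp_norm p (\<lambda>x. ennreal (a + 1) * indicator K x) < top"
      using a by (subst Lp_norm_cmult[OF p _ im]) (auto simp: ennreal_mult_less_top)
    show "Lp_norm p (\<lambda>x. ennreal b * ennreal (g x)) < top"
      using gf by (subst Lp_norm_cmult[OF p b]) (auto simp: ennreal_mult_less_top)
  qed measurable
  finally show "Lp_norm p (\<lambda>x. ennreal (norm (F x)) * indicator K x) < \<infinity>" by simp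
qed

lemma tempered_diff:
  assumes u: "tempered u" and w: "tempered w"
  shows "tempered (\<lambda>\<phi> :: real^'n \<Rightarrow> complex. u \<phi> - w \<phi>)"
  unfolding tempered_def
proof (intro conjI ballI allI)
  obtain C1 k1 m1 where 1: "0 \<le> C1" "0 < m1"
    "\<And>\<phi> D. \<phi> \<in> schwartz \<Longrightarrow> sbound k1 m1 D \<phi> \<Longrightarrow> norm (u \<phi>) \<le> C1 * D"
    by (rule temperedE[OF u]) (rule that, assumption+)
  obtain C2 k2 m2 where 2: "0 \<le> C2" "0 < m2"
    "\<And>\<phi> D. \<phi> \<in> schwartz \<Longrightarrow> sbound k2 m2 D \<phi> \<Longrightarrow> norm (w \<phi>) \<le> C2 * D"
    by (rule temperedE[OF w]) (rule that, assumption+)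
  let ?k = "max k1 k2" and ?m = "max m1 m2"
  have "ennreal (norm (u \<phi> - w \<phi>)) \<le> ennreal (C1 + C2) * schwartz_norm ?k ?m \<phi>" if \<phi>: "\<phi> \<in> schwartz" for \<phi>
  proof -
    have "schwartz_norm ?k ?m \<phi> < \<infinity>" using \<phi> 1(2) by (auto simp: schwartz_def)
    then obtain D where D: "schwartz_norm ?k ?m \<phi> = ennreal D" "0 \<le> D"
      by (cases "schwartz_norm ?k ?m \<phi>") auto
    then have sb: "sbound ?k ?m D \<phi>" using schwartz_norm_le_iff[of D ?k ?m \<phi>] by simp
    have "norm (u \<phi>) \<le> C1 * D" by (rule 1(3)[OF \<phi> sbound_mono[OF sb]]) auto
    moreover have "norm (w \<phi>) \<le> C2 * D" by (rule 2(3)[OF \<phi> sbound_mono[OF sb]]) auto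
    ultimately have "norm (u \<phi> - w \<phi>) \<le> (C1 + C2) * D"
      using norm_triangle_ineq4[of "u \<phi>" "w \<phi>"] by (simp add: distrib_right)
    then show ?thesis
      unfolding D(1) using D(2) by (subst ennreal_mult''[symmetric]) (auto intro: ennreal_leI)
  qed
  then show "\<exists>C k m. 0 < m \<and> (\<forall>\<phi>\<in>schwartz. ennreal (norm (u \<phi> - w \<phi>)) \<le> ennreal C * schwartz_norm k m \<phi>)"
    using 1(2) less_max_iff_disj by blast
qed (simp_all add: tempered_linear[OF u] tempered_linear[OF w] right_diff_distrib)

theorem grand_TL_to_hajlasz:
  fixes s p m :: real and l :: nat
  assumes s: "0 < s" "s \<le> 1" and p: "real CARD('n) / (real CARD('n) + s) < p" and m: "real CARD('n) + 1 < m"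
  shows "\<exists>C>0. \<forall>u\<in>grand_TL_space (test_class l 0 m) s p. \<exists>F\<in>hajlasz_space s p. \<exists>g\<in>hajlasz_gradients s p F.
    Lp_norm p (\<lambda>x. ennreal (g x)) \<le> ennreal C * grand_TL_norm (test_class l 0 m) s p u \<and>
    (\<forall>\<phi>\<in>schwartz. u \<phi> = dist_of (F :: real^'n \<Rightarrow> complex) \<phi>)"
proof -
  let ?A = "test_class l 0 m :: (real^'n \<Rightarrow> complex) set"
  have p0: "0 < p" using p s by (smt (verit) divide_nonneg_nonneg of_nat_0_le_iff)
  have mn: "real CARD('n) < m" and ms: "real CARD('n) + s < m" and m0: "0 \<le> m"
    using m s of_nat_0_le_iff[of "CARD('n)", where 'a=real] by linarith+
  obtain \<eta> :: "real^'n \<Rightarrow> complex" where \<eta>: "\<eta> \<in> schwartz" "(LINT y|lebesgue. \<eta> y) = 1" by (rule exists_mollifier)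
  obtain B0 where B0: "0 < B0" "sbound (l + 1) m B0 \<eta>" using schwartzE[OF \<eta>(1)] .
  obtain C1 where C1: "0 < C1" and lim: "\<And>u :: (real^'n \<Rightarrow> complex) \<Rightarrow> complex. tempered u \<Longrightarrow> \<exists>F\<in>borel_measurable borel.
    \<forall>\<phi>\<in>schwartz. \<forall>B>0. sbound (l + 1) m B \<phi> \<longrightarrow> (\<forall>k x \<gamma>. 0 \<le> \<gamma> \<longrightarrow> grand_sup ?A s u x = ennreal \<gamma> \<longrightarrow>
      norm (conv (dilate (2 powi (- k)) \<phi>) u x - (LINT y|lebesgue. \<phi> y) * F x) \<le> C1 * B * (2 powi (- k)) powr s * \<gamma>)"
    using grand_limit[OF s(1) mn, of l] by blast
  from hajlasz_convolution[OF s(1) p ms] obtain C2 where C2: "\<forall>f\<in>hajlasz_space s p. \<forall>g\<in>hajlasz_gradients s p f.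
    locally_integrable f \<and> defines_tempered f \<and>
    (\<exists>E T. dominates_convolutions s m (f :: real^'n \<Rightarrow> complex) E T \<and>
      Lp_norm p T \<le> ennreal C2 * Lp_norm p (\<lambda>x. ennreal (g x)))"
    by (elim exE conjE) (rule that)
  \<comment> \<open>The factor in \<open>sbound_affine\<close> for a translation by a vector of norm
    at most 1, where 1 + |h| \<le> 2.\<close>
  let ?K = "(1 + \<bar>1 :: real\<bar>) ^ (l + 1) * (2 * (1 + 1 / \<bar>1 :: real\<bar>)) powr m"
  \<comment> \<open>The factor 2^s arises because the dyadic scale may be as large as 2 |x - y|; the
    two summands in the bracket belong to the translated and to the original mollifier.\<close>
  define Ch where "Ch = 2 powr s * (C1 * (B0 * ?K + B0))"
  have Ch: "0 < Ch" using C1 B0 by (simp add: Ch_def add_pos_nonneg)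
  have main: "\<exists>F\<in>hajlasz_space s p. \<exists>g\<in>hajlasz_gradients s p F.
    Lp_norm p (\<lambda>x. ennreal (g x)) \<le> ennreal Ch * grand_TL_norm ?A s p u \<and>
    (\<forall>\<phi>\<in>schwartz. u \<phi> = dist_of F \<phi>)" if "u \<in> grand_TL_space ?A s p" for u
  proof -
    have u: "tempered u" and fin: "Lp_norm p (grand_sup ?A s u) < top"
      using that by (auto simp: grand_TL_space_def grand_TL_norm_eq)
    let ?G = "grand_sup ?A s u"
    have Gb[measurable]: "?G \<in> borel_measurable borel" by (rule grand_sup_measurable[OF u test_class_schwartz])
    have Gm[measurable]: "?G \<in> borel_measurable lebesgue" by (rule measurable_completion) (use Gb in simp)
    have "AE x in lebesgue. ?G x < top" using fin Gm by (rule Lp_norm_finite_AE)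
    then obtain N where N: "N \<in> null_sets lebesgue" "{x. \<not> ?G x < top} \<subseteq> N"
      unfolding eventually_ae_filter by auto
    define \<gamma> where "\<gamma> x = enn2real (?G x)" for x
    have \<gamma>: "?G x = ennreal (\<gamma> x)" "0 \<le> \<gamma> x" if "x \<notin> N" for x
    proof -
      have "?G x < top" using N(2) that by blast
      then show "?G x = ennreal (\<gamma> x)" "0 \<le> \<gamma> x" by (auto simp: \<gamma>_def)
    qed
    obtain F where Fb: "F \<in> borel_measurable borel" and F: "\<And>\<phi> B k x \<gamma>. \<phi> \<in> schwartz \<Longrightarrow> 0 < B \<Longrightarrow> sbound (l + 1) m B \<phi> \<Longrightarrow>
      0 \<le> \<gamma> \<Longrightarrow> ?G x = ennreal \<gamma> \<Longrightarrow>
      norm (conv (dilate (2 powi (- k)) \<phi>) u x - (LINT y|lebesgue. \<phi> y) * F x) \<le> C1 * B * (2 powi (- k)) powr s * \<gamma>"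
      using lim[OF u] by blast
    have Fm: "F \<in> borel_measurable lebesgue" by (rule measurable_completion) (use Fb in simp)
    define g where "g x = Ch * \<gamma> x" for x
    have gm: "g \<in> borel_measurable lebesgue" unfolding g_def \<gamma>_def by measurable
    have holder: "norm (F x - F y) \<le> norm (x - y) powr s * (g x + g y)" if x: "x \<notin> N" and y: "y \<notin> N" for x y
    proof (cases "x = y")
      case True
      then show ?thesis by simp
    next
      case False
      then have d: "0 < norm (x - y)" by simp
      obtain k where k: "norm (x - y) \<le> 2 powi (- k)" "2 powi (- k) \<le> 2 * norm (x - y)"
        using exists_dyadic_scale[OF d] by blast
      let ?t = "2 powi (- k) :: real"
      have t: "0 < ?t" by simp
      \<comment> \<open>The translate \<eta> (h + z), dilated to scale t and centred at x, is \<eta>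
        dilated and centred at y. Hence one and the same average of u is close to F x and to F
        y.\<close>
      define h where "h = (y - x) /\<^sub>R ?t"
      have "norm h = norm (x - y) / ?t" using t by (simp add: h_def norm_minus_commute divide_inverse mult.commute)
      also have "\<dots> \<le> 1" using k(1) t by (simp only: pos_divide_le_eq mult_1_left)
      finally have h1: "norm h \<le> 1" .
      let ?\<phi> = "\<lambda>z. 1 * \<eta> (h + 1 *\<^sub>R z)"
      have \<phi>: "?\<phi> \<in> schwartz" by (rule schwartz_affine[OF \<eta>(1)]) simp
      have sb0: "sbound (l + 1) m (norm (1::complex) * B0 * (1 + \<bar>1\<bar>) ^ (l + 1) * ((1 + norm h) * (1 + 1 / \<bar>1\<bar>)) powr m) ?\<phi>"
        by (rule sbound_affine[OF schwartz_smooth[OF \<eta>(1)] B0(2) _ m0]) simp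
      have le: "norm (1::complex) * B0 * (1 + \<bar>1\<bar>) ^ (l + 1) * ((1 + norm h) * (1 + 1 / \<bar>1\<bar>)) powr m \<le> B0 * ?K"
      proof -
        have "((1 + norm h) * (1 + 1 / \<bar>1 :: real\<bar>)) powr m \<le> (2 * (1 + 1 / \<bar>1 :: real\<bar>)) powr m"
          using h1 m0 by (intro powr_mono2 mult_right_mono) auto
        then show ?thesis using B0 by (simp add: mult_left_mono)
      qed
      have sb: "sbound (l + 1) m (B0 * ?K) ?\<phi>" by (rule sbound_mono[OF sb0 order_refl order_refl le])
      have I: "(LINT z|lebesgue. ?\<phi> z) = 1"
        using integral_affine[OF \<eta>(1), of 1 h] \<eta>(2) by simp
      have BK: "0 < B0 * ?K" using B0 by simp
      have e: "conv (dilate ?t ?\<phi>) u x = conv (dilate ?t \<eta>) u y"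
      proof -
        have "h + (x - z) /\<^sub>R ?t = (y - z) /\<^sub>R ?t" for z
          unfolding h_def scaleR_add_right[symmetric] by simp
        then show ?thesis by (simp add: conv_def dilate_def)
      qed
      have 1: "norm (conv (dilate ?t \<eta>) u y - F x) \<le> C1 * (B0 * ?K) * ?t powr s * \<gamma> x"
        using F[OF \<phi> BK sb \<gamma>(2)[OF x] \<gamma>(1)[OF x], of k] unfolding I e by simp
      have 2: "norm (conv (dilate ?t \<eta>) u y - F y) \<le> C1 * B0 * ?t powr s * \<gamma> y"
        using F[OF \<eta>(1) B0 \<gamma>(2)[OF y] \<gamma>(1)[OF y], of k] unfolding \<eta>(2) by simp
      have "norm (F x - F y) \<le> C1 * (B0 * ?K) * ?t powr s * \<gamma> x + C1 * B0 * ?t powr s * \<gamma> y"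
        using 1 2 norm_triangle_ineq4[of "conv (dilate ?t \<eta>) u y - F y" "conv (dilate ?t \<eta>) u y - F x"] by simp
      also have "\<dots> \<le> C1 * (B0 * ?K + B0) * ?t powr s * \<gamma> x + C1 * (B0 * ?K + B0) * ?t powr s * \<gamma> y"
        using C1 B0 \<gamma>(2)[OF x] \<gamma>(2)[OF y] by (intro add_mono mult_right_mono mult_left_mono) auto
      also have "\<dots> = C1 * (B0 * ?K + B0) * (\<gamma> x + \<gamma> y) * ?t powr s" by (simp only: distrib_left distrib_right mult_ac)
      also have "\<dots> \<le> C1 * (B0 * ?K + B0) * (\<gamma> x + \<gamma> y) * (2 powr s * norm (x - y) powr s)"
      proof (rule mult_left_mono)
        have "?t powr s \<le> (2 * norm (x - y)) powr s" using k(2) s t by (intro powr_mono2) auto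
        then show "?t powr s \<le> 2 powr s * norm (x - y) powr s" by (simp only: powr_mult)
        show "0 \<le> C1 * (B0 * ?K + B0) * (\<gamma> x + \<gamma> y)" using C1 B0 \<gamma>(2)[OF x] \<gamma>(2)[OF y] by (intro mult_nonneg_nonneg add_nonneg_nonneg) auto
      qed
      also have "\<dots> = norm (x - y) powr s * (g x + g y)" unfolding g_def Ch_def by (simp only: distrib_left distrib_right mult_ac)
      finally show ?thesis .
    qed
    have gL: "Lp_norm p (\<lambda>x. ennreal (g x)) \<le> ennreal Ch * Lp_norm p ?G"
      unfolding Lp_norm_cmult[OF p0 Ch Gm, symmetric]
    proof (rule Lp_norm_mono_AE[OF p0])
      show "AE x in lebesgue. ennreal (g x) \<le> ennreal Ch * ?G x"
        using AE_not_in[OF N(1)] by eventually_elim (use Ch in \<open>simp add: g_def \<gamma>(1) ennreal_mult'\<close>)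
    qed
    also have "\<dots> < top" using fin by (simp add: ennreal_mult_less_top)
    finally have gfin: "Lp_norm p (\<lambda>x. ennreal (g x)) < \<infinity>" by simp
    have gg: "g \<in> hajlasz_gradients s p F"
      unfolding hajlasz_gradients_def
    proof (intro CollectI conjI gm gfin bexI[of _ N] N ballI allI)
      show "0 \<le> g x" for x using Ch by (simp add: g_def \<gamma>_def)
      show "norm (F x - F y) \<le> norm (x - y) powr s * (g x + g y)" if "x \<in> - N" "y \<in> - N" for x y
        using that by (intro holder) auto
    qed
    have FH: "F \<in> hajlasz_space s p"
      unfolding hajlasz_space_def using Lp_loc_of_gradient[OF p0 s(1) Fm gg] gg by blast
    from bspec[OF bspec[OF C2 FH] gg] obtain E T where dt: "defines_tempered F"
      and dom: "dominates_convolutions s m F E T" and TL: "Lp_norm p T \<le> ennreal C2 * Lp_norm p (\<lambda>x. ennreal (g x))"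
      by (elim exE conjE) (rule that)
    have Tm: "T \<in> borel_measurable lebesgue" and E: "E \<in> null_sets lebesgue"
      using dom by (simp_all add: dominates_convolutions_def)
    have tF: "tempered (dist_of F)" using dt by (simp add: defines_tempered_def)
    \<comment> \<open>Both u and F are compared with the number F x times the mean of the test
      function: \<open>C1 * ?G\<close> controls u and \<open>T\<close> controls F. The comparison
      number cancels in the difference.\<close>
    let ?T = "\<lambda>x. ennreal C1 * ?G x + T x"
    have CGm: "(\<lambda>x. ennreal C1 * ?G x) \<in> borel_measurable lebesgue" by measurable
    have Tfin: "Lp_norm p ?T < top"
    proof (rule Lp_norm_add_finite[OF p0 _ _ CGm Tm])
      show "Lp_norm p (\<lambda>x. ennreal C1 * ?G x) < top"
        unfolding Lp_norm_cmult[OF p0 C1 Gm] using fin by (simp add: ennreal_mult_less_top)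
      show "Lp_norm p T < top"
        using le_less_trans[OF TL] gfin by (simp add: ennreal_mult_less_top)
    qed
    have "u \<phi> - dist_of F \<phi> = 0" if \<phi>: "\<phi> \<in> schwartz" for \<phi>
    proof (rule tempered_vanishes[where v = "\<lambda>\<phi>. u \<phi> - dist_of F \<phi>" and T = ?T and E = "N \<union> E" and K = "l + 1"])
      show "tempered (\<lambda>\<phi>. u \<phi> - dist_of F \<phi>)" by (rule tempered_diff[OF u tF])
      show "?T \<in> borel_measurable lebesgue" using CGm Tm by (rule borel_measurable_add)
      show "(\<integral>\<^sup>+x. epowr (?T x) p \<partial>lebesgue) < top" using Tfin by (simp only: Lp_norm_finite_iff)
      show "N \<union> E \<in> null_sets lebesgue" using N(1) E by blast
      fix \<psi> :: "real^'n \<Rightarrow> complex" and B and k :: nat and x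
      assume \<psi>: "\<psi> \<in> schwartz" and B: "0 < B" and sb: "sbound (l + 1) m B \<psi>" and x: "x \<notin> N \<union> E"
      let ?t = "2 powi (- int k) :: real" and ?I = "LINT y|lebesgue. \<psi> y"
      let ?d = "\<lambda>y. dilate ?t \<psi> (x - y)"
      have xN: "x \<notin> N" and xE: "x \<notin> E" using x by auto
      have 1: "norm (u ?d - ?I * F x) \<le> C1 * B * ?t powr s * \<gamma> x"
        using F[OF \<psi> B sb \<gamma>(2)[OF xN] \<gamma>(1)[OF xN], of "int k"] by (simp only: conv_def)
      have 2: "ennreal (norm (dist_of F ?d - F x * ?I)) \<le> ennreal (B * ?t powr s) * T x"
        by (rule dominates_convolutionsD(2)[OF dom \<psi> B two_powi_pos sbound0[OF sb] xE])
      have "u ?d - dist_of F ?d = (u ?d - ?I * F x) - (dist_of F ?d - F x * ?I)" by (simp add: mult.commute)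
      then have "norm (u ?d - dist_of F ?d) \<le> norm (u ?d - ?I * F x) + norm (dist_of F ?d - F x * ?I)"
        by (simp only: norm_triangle_ineq4)
      then have "ennreal (norm (u ?d - dist_of F ?d)) \<le> ennreal (norm (u ?d - ?I * F x)) + ennreal (norm (dist_of F ?d - F x * ?I))"
        by (simp add: ennreal_plus[symmetric] ennreal_leI del: ennreal_plus)
      also have "\<dots> \<le> ennreal (C1 * B * ?t powr s * \<gamma> x) + ennreal (B * ?t powr s) * T x"
        using 1 2 by (intro add_mono ennreal_leI) auto
      also have "ennreal (C1 * B * ?t powr s * \<gamma> x) = ennreal (B * ?t powr s) * (ennreal C1 * ?G x)"
        unfolding \<gamma>(1)[OF xN] using C1 B \<gamma>(2)[OF xN] by (simp add: ennreal_mult[symmetric] mult_ac)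
      also have "ennreal (B * ?t powr s) * (ennreal C1 * ?G x) + ennreal (B * ?t powr s) * T x = ennreal (B * ?t powr s) * ?T x"
        by (simp only: distrib_left)
      finally show "ennreal (norm (u ?d - dist_of F ?d)) \<le> ennreal (B * ?t powr s) * ?T x" .
    qed (use s p m0 \<phi> in auto)
    then have "\<forall>\<phi>\<in>schwartz. u \<phi> = dist_of F \<phi>" by simp
    with FH gg gL show ?thesis unfolding grand_TL_norm_eq by blast
  qed
  with Ch show ?thesis by blast
qed

theorem hajlasz_to_grand_TL:
  fixes s p m :: real and l :: nat
  assumes s: "0 < s" "s \<le> 1" and p: "real CARD('n) / (real CARD('n) + s) < p" and m: "real CARD('n) + 1 < m"
  shows "\<exists>C>0. \<forall>f\<in>hajlasz_space s p. locally_integrable (f :: real^'n \<Rightarrow> complex) \<and> defines_tempered f \<and>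
    grand_TL_norm (test_class l 0 m) s p (dist_of f) \<le> ennreal C * hajlasz_norm s p f \<and>
    dist_of f \<in> grand_TL_space (test_class l 0 m) s p"
proof -
  let ?A = "test_class l 0 m :: (real^'n \<Rightarrow> complex) set"
  have p0: "0 < p" using p s by (smt (verit) divide_nonneg_nonneg of_nat_0_le_iff)
  have ms: "real CARD('n) + s < m" using m s by linarith
  from hajlasz_convolution[OF s(1) p ms] obtain C where C: "0 < C" "\<forall>f\<in>hajlasz_space s p. \<forall>g\<in>hajlasz_gradients s p f.
    locally_integrable f \<and> defines_tempered f \<and>
    (\<exists>E T. dominates_convolutions s m (f :: real^'n \<Rightarrow> complex) E T \<and>
      Lp_norm p T \<le> ennreal C * Lp_norm p (\<lambda>x. ennreal (g x)))"
    by (elim exE conjE) (rule that)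
  have main: "locally_integrable f \<and> defines_tempered f \<and>
    grand_TL_norm ?A s p (dist_of f) \<le> ennreal C * hajlasz_norm s p f \<and> dist_of f \<in> grand_TL_space ?A s p"
    if f: "f \<in> hajlasz_space s p" for f
  proof -
    have le: "grand_TL_norm ?A s p (dist_of f) \<le> ennreal C * Lp_norm p (\<lambda>x. ennreal (g x))"
      if g: "g \<in> hajlasz_gradients s p f" for g
    proof -
      from bspec[OF bspec[OF C(2) f] g] obtain E T where dom: "dominates_convolutions s m f E T"
        and TL: "Lp_norm p T \<le> ennreal C * Lp_norm p (\<lambda>x. ennreal (g x))"
        by (elim exE conjE) (rule that)
      have "grand_sup ?A s (dist_of f) x \<le> T x" for x
      proof (rule grand_sup_le)
        fix \<phi> and k :: int assume "\<phi> \<in> ?A"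
        then have \<phi>: "\<phi> \<in> schwartz" "(LINT y|lebesgue. \<phi> y) = 0" "sbound (l + 1) m 1 \<phi>"
          by (auto simp: test_class_0_iff)
        show "ennreal (norm (conv (dilate (2 powi (- k)) \<phi>) (dist_of f) x)) \<le> ennreal ((2 powi (- k)) powr s) * T x"
          using dominates_convolutionsD(1)[OF dom \<phi>(1) zero_less_one two_powi_pos sbound0[OF \<phi>(3)] \<phi>(2), of "- k" x] by (simp only: conv_def mult_1_left)
      qed
      then have "grand_TL_norm ?A s p (dist_of f) \<le> Lp_norm p T"
        unfolding grand_TL_norm_eq by (intro Lp_norm_mono_AE[OF p0] AE_I2)
      then show ?thesis using TL by (rule order_trans)
    qed
    obtain g where g: "g \<in> hajlasz_gradients s p f" using f by (auto simp: hajlasz_space_def)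
    have li: "locally_integrable f" and dt: "defines_tempered f" using bspec[OF bspec[OF C(2) f] g] by auto
    \<comment> \<open>Dividing by C turns the bounds by individual gradients into a lower bound for
      all of them, which passes to the infimum.\<close>
    have "grand_TL_norm ?A s p (dist_of f) / ennreal C \<le> hajlasz_norm s p f"
      unfolding hajlasz_norm_def
    proof (rule INF_greatest)
      fix g assume "g \<in> hajlasz_gradients s p f"
      from le[OF this] show "grand_TL_norm ?A s p (dist_of f) / ennreal C \<le> Lp_norm p (\<lambda>x. ennreal (g x))"
        using C(1) by (intro divide_le_posI_ennreal) auto
    qed
    then have "ennreal C * (grand_TL_norm ?A s p (dist_of f) / ennreal C) \<le> ennreal C * hajlasz_norm s p f"
      by (rule mult_left_mono) simp
    then have norm: "grand_TL_norm ?A s p (dist_of f) \<le> ennreal C * hajlasz_norm s p f"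
      using C(1) by (simp add: ennreal_times_divide ennreal_mult_divide_eq mult.commute[of "ennreal C"])
    have "grand_TL_norm ?A s p (dist_of f) < \<infinity>"
    proof -
      have "Lp_norm p (\<lambda>x. ennreal (g x)) < top" using g by (simp add: hajlasz_gradients_def)
      then show ?thesis using le_less_trans[OF le[OF g]] by (simp add: ennreal_mult_less_top)
    qed
    then have "dist_of f \<in> grand_TL_space ?A s p"
      using dt by (simp add: grand_TL_space_def defines_tempered_def)
    with li dt norm show ?thesis by blast
  qed
  with C(1) show ?thesis by blast
qed

text \<open>At almost every x the mollifications at scale t approximate each function with an error
  of order t^s, so letting t tend to 0 recovers both functions from their distributions. This
  transfers gradients from the function constructed from u to any given representative.\<close>

lemma hajlasz_eq_of_dist_of_eq:
  fixes f F :: "real^'n \<Rightarrow> complex"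
  assumes s: "0 < s" and p: "real CARD('n) / (real CARD('n) + s) < p"
    and f: "f \<in> hajlasz_space s p" and F: "F \<in> hajlasz_space s p"
    and eq: "\<And>\<phi>. \<phi> \<in> schwartz \<Longrightarrow> dist_of F \<phi> = dist_of f \<phi> + dist_of (\<lambda>_. c) \<phi>"
  shows "AE x in lebesgue. F x = f x + c"
proof -
  define m where "m = real CARD('n) + s + 1"
  have m: "real CARD('n) + s < m" by (simp add: m_def)
  obtain \<eta> :: "real^'n \<Rightarrow> complex" where \<eta>: "\<eta> \<in> schwartz" "(LINT y|lebesgue. \<eta> y) = 1" by (rule exists_mollifier)
  obtain B where B: "0 < B" "sbound 0 m B \<eta>" using schwartzE[OF \<eta>(1)] .
  have approx: "\<exists>E T. dominates_convolutions s m f E T \<and> Lp_norm p T < top"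
    if f: "f \<in> hajlasz_space s p" for f :: "real^'n \<Rightarrow> complex"
  proof -
    obtain g where g: "g \<in> hajlasz_gradients s p f" using f by (auto simp: hajlasz_space_def)
    from hajlasz_convolution[OF s p m] obtain C where C: "\<forall>f\<in>hajlasz_space s p. \<forall>g\<in>hajlasz_gradients s p f.
      locally_integrable f \<and> defines_tempered f \<and>
      (\<exists>E T. dominates_convolutions s m (f :: real^'n \<Rightarrow> complex) E T \<and>
        Lp_norm p T \<le> ennreal C * Lp_norm p (\<lambda>x. ennreal (g x)))"
      by (elim exE conjE) (rule that)
    from bspec[OF bspec[OF C f] g] obtain E T where T: "dominates_convolutions s m f E T"
        "Lp_norm p T \<le> ennreal C * Lp_norm p (\<lambda>x. ennreal (g x))"
      by (elim exE conjE) (rule that)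
    have "Lp_norm p (\<lambda>x. ennreal (g x)) < top" using g by (simp add: hajlasz_gradients_def)
    then have "Lp_norm p T < top" using le_less_trans[OF T(2)] by (simp add: ennreal_mult_less_top)
    with T(1) show ?thesis by blast
  qed
  from approx[OF f] obtain E1 T1 where d1: "dominates_convolutions s m f E1 T1" and f1: "Lp_norm p T1 < top" by blast
  from approx[OF F] obtain E2 T2 where d2: "dominates_convolutions s m F E2 T2" and f2: "Lp_norm p T2 < top" by blast
  note 1 = d1[unfolded dominates_convolutions_def, THEN conjunct1] f1 d1[unfolded dominates_convolutions_def, THEN conjunct2, THEN conjunct1]
    dominates_convolutionsD(2)[OF d1 \<eta>(1) B(1) _ sbound0[OF B(2)], unfolded \<eta>(2) mult_1_right]
  note 2 = d2[unfolded dominates_convolutions_def, THEN conjunct1] f2 d2[unfolded dominates_convolutions_def, THEN conjunct2, THEN conjunct1]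
    dominates_convolutionsD(2)[OF d2 \<eta>(1) B(1) _ sbound0[OF B(2)], unfolded \<eta>(2) mult_1_right]
  show ?thesis
    using AE_not_in[OF 1(3)] AE_not_in[OF 2(3)] Lp_norm_finite_AE[OF 1(2,1)] Lp_norm_finite_AE[OF 2(2,1)]
  proof eventually_elim
    case (elim x)
    obtain a where a: "T1 x = ennreal a" "0 \<le> a" using elim(3) by (cases "T1 x") auto
    obtain b where b: "T2 x = ennreal b" "0 \<le> b" using elim(4) by (cases "T2 x") auto
    have le: "norm (F x - f x - c) \<le> B * (a + b) * t powr s" if t: "0 < t" for t
    proof -
      let ?d = "\<lambda>y. dilate t \<eta> (x - y)"
      have d: "dist_of F ?d = dist_of f ?d + c"
      proof -
        have "dist_of (\<lambda>_. c) ?d = c * (LINT y|lebesgue. ?d y)" by (simp add: dist_of_def)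
        also have "\<dots> = c" unfolding integral_dilate[OF \<eta>(1) t] \<eta>(2) by simp
        finally show ?thesis using eq[OF dilate_schwartz[OF \<eta>(1) t, of x]] by simp
      qed
      have "ennreal (norm (dist_of f ?d - f x)) \<le> ennreal (B * t powr s * a)"
        using 1(4)[OF t elim(1)] B(1) a by (simp add: ennreal_mult)
      then have 3: "norm (dist_of f ?d - f x) \<le> B * t powr s * a" using B(1) a by (simp add: ennreal_le_iff)
      have "ennreal (norm (dist_of F ?d - F x)) \<le> ennreal (B * t powr s * b)"
        using 2(4)[OF t elim(2)] B(1) b by (simp add: ennreal_mult)
      then have 4: "norm (dist_of F ?d - F x) \<le> B * t powr s * b" using B(1) b by (simp add: ennreal_le_iff)
      have "F x - f x - c = (dist_of f ?d - f x) - (dist_of F ?d - F x)" unfolding d by simp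
      then have "norm (F x - f x - c) \<le> norm (dist_of f ?d - f x) + norm (dist_of F ?d - F x)"
        by (simp only: norm_triangle_ineq4)
      also have "\<dots> \<le> B * t powr s * a + B * t powr s * b" using 3 4 by (rule add_mono)
      finally show ?thesis by (simp add: algebra_simps)
    qed
    have "norm (F x - f x - c) \<le> 0"
    proof (rule tendsto_lowerbound)
      have "((\<lambda>t. B * (a + b) * t powr s) \<longlongrightarrow> B * (a + b) * 0 powr s) (at_right 0)"
        using s by (intro tendsto_intros tendsto_powr') (auto intro!: eventually_mono[OF eventually_at_right_less[of 0]])
      then show "((\<lambda>t. B * (a + b) * t powr s) \<longlongrightarrow> 0) (at_right 0)" using s by simp
      show "\<forall>\<^sub>F t in at_right 0. norm (F x - f x - c) \<le> B * (a + b) * t powr s"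
        using eventually_at_right_less[of 0] by eventually_elim (rule le)
    qed simp
    then show ?case by (simp add: algebra_simps)
  qed
qed

lemma hajlasz_gradients_add_const:
  assumes "AE x in lebesgue. F x = f x + c"
  shows "hajlasz_gradients s p F \<subseteq> hajlasz_gradients s p f"
proof
  fix g assume g: "g \<in> hajlasz_gradients s p F"
  obtain E where E: "E \<in> null_sets lebesgue"
    "\<And>x y. x \<notin> E \<Longrightarrow> y \<notin> E \<Longrightarrow> norm (F x - F y) \<le> norm (x - y) powr s * (g x + g y)"
    using g unfolding hajlasz_gradients_def by blast
  obtain N where N: "N \<in> null_sets lebesgue" "{x. F x \<noteq> f x + c} \<subseteq> N"
    using assms unfolding eventually_ae_filter by auto
  have "norm (f x - f y) \<le> norm (x - y) powr s * (g x + g y)" if "x \<notin> E \<union> N" "y \<notin> E \<union> N" for x y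
  proof -
    have "F x = f x + c" "F y = f y + c" using N(2) that by blast+
    then show ?thesis using E(2)[of x y] that by simp
  qed
  moreover have "E \<union> N \<in> null_sets lebesgue" using E(1) N(1) by blast
  ultimately show "g \<in> hajlasz_gradients s p f"
    using g unfolding hajlasz_gradients_def by blast
qed

theorem theorem1p1:
  fixes s p m :: real and l :: nat and A :: "(real^'n \<Rightarrow> complex) set"
  assumes "0 < s" and "s \<le> 1"
    and "real CARD('n) / (real CARD('n) + s) < p"
    and "real CARD('n) + 1 < m"
    and "A = test_class l 0 m"
  shows
    "(\<forall>f\<in>hajlasz_space s p. locally_integrable f \<and> defines_tempered f \<and>
        dist_of f \<in> grand_TL_space A s p) \<and>
     (\<forall>u\<in>grand_TL_space A s p. \<exists>f\<in>hajlasz_space s p. coincides_mod_const u f) \<and>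
     (\<exists>C>0. \<forall>f\<in>hajlasz_space s p. \<forall>u\<in>grand_TL_space A s p. coincides_mod_const u f \<longrightarrow>
        hajlasz_norm s p f \<le> ennreal C * grand_TL_norm A s p u \<and>
        grand_TL_norm A s p u \<le> ennreal C * hajlasz_norm s p f)"
proof -
  let ?H = "hajlasz_space s p :: (real^'n \<Rightarrow> complex) set"
  from hajlasz_to_grand_TL[OF assms(1-4), of l, folded assms(5)] obtain C1 where C1: "0 < C1"
    "\<forall>f\<in>?H. locally_integrable f \<and> defines_tempered f \<and>
      grand_TL_norm A s p (dist_of f) \<le> ennreal C1 * hajlasz_norm s p f \<and> dist_of f \<in> grand_TL_space A s p"
    by (elim exE conjE) (rule that)
  from grand_TL_to_hajlasz[OF assms(1-4), of l, folded assms(5)] obtain C2 where C2: "0 < C2"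
    "\<forall>u\<in>grand_TL_space A s p. \<exists>F\<in>?H. \<exists>g\<in>hajlasz_gradients s p F.
      Lp_norm p (\<lambda>x. ennreal (g x)) \<le> ennreal C2 * grand_TL_norm A s p u \<and> (\<forall>\<phi>\<in>schwartz. u \<phi> = dist_of F \<phi>)"
    by (elim exE conjE) (rule that)
  have 1: "locally_integrable f \<and> defines_tempered f \<and> dist_of f \<in> grand_TL_space A s p" if "f \<in> ?H" for f
    using bspec[OF C1(2) that] by simp
  have 2: "\<exists>f\<in>?H. coincides_mod_const u f" if u: "u \<in> grand_TL_space A s p" for u
  proof -
    from bspec[OF C2(2) u] obtain F where F: "F \<in> ?H" "\<forall>\<phi>\<in>schwartz. u \<phi> = dist_of F \<phi>" by blast
    have "dist_of (\<lambda>_. 0) \<phi> = 0" for \<phi> :: "real^'n \<Rightarrow> complex" by (simp add: dist_of_def)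
    then have "\<forall>\<phi>\<in>schwartz. u \<phi> = dist_of F \<phi> + dist_of (\<lambda>_. 0) \<phi>" using F(2) by simp
    then have "coincides_mod_const u F" using 1[OF F(1)] unfolding coincides_mod_const_def by blast
    with F(1) show ?thesis by blast
  qed
  have 3: "hajlasz_norm s p f \<le> ennreal (max C1 C2) * grand_TL_norm A s p u \<and>
      grand_TL_norm A s p u \<le> ennreal (max C1 C2) * hajlasz_norm s p f"
    if f: "f \<in> ?H" and u: "u \<in> grand_TL_space A s p" and co: "coincides_mod_const u f" for f u
  proof
    obtain c where c: "\<And>\<phi>. \<phi> \<in> schwartz \<Longrightarrow> u \<phi> = dist_of f \<phi> + dist_of (\<lambda>_. c) \<phi>"
      using co unfolding coincides_mod_const_def by blast
    from bspec[OF C2(2) u] obtain F g where F: "F \<in> ?H" "g \<in> hajlasz_gradients s p F"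
        "Lp_norm p (\<lambda>x. ennreal (g x)) \<le> ennreal C2 * grand_TL_norm A s p u" "\<And>\<phi>. \<phi> \<in> schwartz \<Longrightarrow> u \<phi> = dist_of F \<phi>"
      by blast
    \<comment> \<open>The representative f is prescribed and F is the one constructed from u. They
      differ by a constant almost everywhere, so the gradient \<open>g\<close> of F is also a
      gradient of f.\<close>
    have "AE x in lebesgue. F x = f x + c"
      by (rule hajlasz_eq_of_dist_of_eq[OF assms(1,3) f F(1)]) (simp add: F(4)[symmetric] c)
    then have "g \<in> hajlasz_gradients s p f" using hajlasz_gradients_add_const F(2) by blast
    then have "hajlasz_norm s p f \<le> Lp_norm p (\<lambda>x. ennreal (g x))" unfolding hajlasz_norm_def by (rule INF_lower)
    also have "\<dots> \<le> ennreal C2 * grand_TL_norm A s p u" by (rule F(3))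
    also have "\<dots> \<le> ennreal (max C1 C2) * grand_TL_norm A s p u" by (intro mult_right_mono ennreal_leI) auto
    finally show "hajlasz_norm s p f \<le> ennreal (max C1 C2) * grand_TL_norm A s p u" .
    \<comment> \<open>Zero-mean test functions annihilate the constant \<open>c\<close>, so u and
      \<open>dist_of f\<close> have the same grand maximal function.\<close>
    have conv: "conv (dilate (2 powi (- k)) \<phi>) u x = conv (dilate (2 powi (- k)) \<phi>) (dist_of f) x" if "\<phi> \<in> A" for \<phi> x k
    proof -
      have \<phi>: "\<phi> \<in> schwartz" "(LINT y|lebesgue. \<phi> y) = 0" using that unfolding assms(5) test_class_0_iff by auto
      have "dist_of (\<lambda>_. c) (\<lambda>y. dilate (2 powi (- k)) \<phi> (x - y)) = c * (LINT y|lebesgue. dilate (2 powi (- k)) \<phi> (x - y))"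
        by (simp add: dist_of_def)
      then show ?thesis
        unfolding conv_def integral_dilate[OF \<phi>(1) two_powi_pos] \<phi>(2) c[OF dilate_schwartz[OF \<phi>(1) two_powi_pos]] by simp
    qed
    have "grand_TL_norm A s p u = grand_TL_norm A s p (dist_of f)"
      unfolding grand_TL_norm_def by (simp add: conv cong: SUP_cong_simp)
    also have "\<dots> \<le> ennreal C1 * hajlasz_norm s p f" using bspec[OF C1(2) f] by simp
    also have "\<dots> \<le> ennreal (max C1 C2) * hajlasz_norm s p f" by (intro mult_right_mono ennreal_leI) auto
    finally show "grand_TL_norm A s p u \<le> ennreal (max C1 C2) * hajlasz_norm s p f" .
  qed
  have "0 < max C1 C2" using C1(1) by simp
  with 1 2 3 show ?thesis by blast
qed

end
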